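(* Let $K$ be a field and $\mathbf R=\operatorname{Lie}(v_0,v_1)$. The growth of the Lie superalgebra $\mathbf R$ is linear, with the following properties: (i) if $\operatorname{char}K\ne 2$, the weight growth function is $\tilde\gamma_{\mathbf R}(m)=2m-2$ for all $m\ge 3$; (ii) if $\operatorname{char}K=2$, the weight growth function is $\tilde\gamma_{\mathbf R}(m)=m+\lfloor\log_2 m\rfloor$ for all $m\ge 1$; (iii) $\operatorname{GKdim}\mathbf R=\underline{\operatorname{GKdim}}\,\mathbf R=1$; (iv) if $\operatorname{char}K\ne 2$, the ordinary growth function satisfies $\lim_{m\to\infty}\gamma_{\mathbf R}(m)/(3m)=1$; (v) if $\operatorname{char}K=2$, the ordinary growth function satisfies $\lim_{m\to\infty}\gamma_{\mathbf R}(m)/(3m/2)=1$.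
   Context: Let $\Lambda=\Lambda(x_i\mid i\ge 0)$ be the Grassmann (exterior) algebra over $K$ on odd generators $x_0,x_1,\dots$, a $\mathbb Z_2$-graded algebra. In $\operatorname{End}\Lambda$ identify $x_i$ with left multiplication by $x_i$, and let $\partial_i$ be the odd superderivation of $\Lambda$ with $\partial_i(x_j)=\delta_{ij}$. The supercommutator is $[a,b]=ab-(-1)^{\deg a\deg b}ba$. The pivot elements are the odd superderivations $v_i=\partial_i+x_ix_{i+1}(\partial_{i+2}+x_{i+2}x_{i+3}(\partial_{i+4}+\cdots))$, $i\ge 0$, that is, $v_i=\partial_i+x_ix_{i+1}v_{i+2}$ (well defined on $\Lambda$, since each element involves finitely many letters). $\mathbf R=\operatorname{Lie}(v_0,v_1)$ is the smallest $\mathbb Z_2$-graded subspace of $\operatorname{End}\Lambda$ containing $v_0,v_1$, closed under the supercommutator and, if $\operatorname{char}K=2$, also under $a\mapsto a^2$ for odd elements $a$. Ordinary growth function: $\gamma_{\mathbf R}(m)$ is the dimension of the span of all Lie monomials in $v_0,v_1$ of length at most $m$ (if $\operatorname{char}K=2$, together with squares of odd Lie monomials of length at most $m/2$). Weight growth function: $\tilde\gamma_{\mathbf R}(m)$ is defined in the same way, with length replaced by total weight, where $\operatorname{wt}(v_0)=1$, $\operatorname{wt}(v_1)=2$ and weights add over the factors (a square has twice the weight). $\operatorname{GKdim}\mathbf R=\limsup_{n\to\infty}\ln\gamma_{\mathbf R}(n)/\ln n$ and $\underline{\operatorname{GKdim}}\,\mathbf R=\liminf_{n\to\infty}\ln\gamma_{\mathbf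 R}(n)/\ln n$. *)

theory Defs
  imports Complex_Main
    "HOL-Library.Function_Algebras"
    "HOL-Library.Landau_Symbols"
    "HOL-Library.Extended_Real"
begin

section \<open>The Grassmann algebra on generators indexed by the natural numbers\<close>

text \<open>An element is given by its coefficients with respect to the basis of monomials
  $x_A = x_{a_1} \cdots x_{a_r}$, where $A = \{a_1 < \dots < a_r\}$ runs through the finite sets of
  natural numbers.\<close>

typedef (overloaded) 'k grass =
  "{f :: nat set \<Rightarrow> 'k::zero. finite {A. f A \<noteq> 0} \<and> (\<forall>A. f A \<noteq> 0 \<longrightarrow> finite A)}"
  morphisms coef Abs_grass
  by (intro exI[of _ "\<lambda>_. 0"]) simp

setup_lifting type_definition_grass

type_synonym 'k gop = "'k grass \<Rightarrow> 'k grass"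

lemma grass_eqI: "(\<And>A. coef f A = coef g A) \<Longrightarrow> f = g"
  by (simp add: coef_inject[symmetric] fun_eq_iff)

lemma finite_support [simp]: "finite {A. coef f A \<noteq> 0}"
  using coef[of f] by simp

lemma coef_infinite: "infinite A \<Longrightarrow> coef f A = 0"
  using coef[of f] by blast

text \<open>For disjoint \<open>A\<close> and \<open>B\<close> one has $x_A x_B = \pm x_{A \cup B}$, the sign being determined by the
  number of pairs of letters in the wrong order.\<close>

definition shuffle_sign :: "nat set \<Rightarrow> nat set \<Rightarrow> 'k::comm_ring_1" where
  "shuffle_sign A B = (-1) ^ card {(a, b). a \<in> A \<and> b \<in> B \<and> b < a}"

instantiation grass :: (comm_ring_1) ring_1
begin

lift_definition zero_grass :: "'a grass" is "\<lambda>_. 0" by simp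

lift_definition one_grass :: "'a grass" is "\<lambda>A. if A = {} then 1 else 0" by simp

lift_definition plus_grass :: "'a grass \<Rightarrow> 'a grass \<Rightarrow> 'a grass" is "\<lambda>f g A. f A + g A"
proof -
  fix f g :: "nat set \<Rightarrow> 'a"
  assume f: "finite {A. f A \<noteq> 0} \<and> (\<forall>A. f A \<noteq> 0 \<longrightarrow> finite A)"
    and g: "finite {A. g A \<noteq> 0} \<and> (\<forall>A. g A \<noteq> 0 \<longrightarrow> finite A)"
  have "{A. f A + g A \<noteq> 0} \<subseteq> {A. f A \<noteq> 0} \<union> {A. g A \<noteq> 0}" by auto
  with f g show "finite {A. f A + g A \<noteq> 0} \<and> (\<forall>A. f A + g A \<noteq> 0 \<longrightarrow> finite A)"
    by (metis (no_types, lifting) add.right_neutral add.left_neutral finite_UnI finite_subset)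
qed

lift_definition uminus_grass :: "'a grass \<Rightarrow> 'a grass" is "\<lambda>f A. - f A" by simp

definition minus_grass :: "'a grass \<Rightarrow> 'a grass \<Rightarrow> 'a grass" where "f - g = f + - (g :: 'a grass)"

lift_definition times_grass :: "'a grass \<Rightarrow> 'a grass \<Rightarrow> 'a grass" is
  "\<lambda>f g C. \<Sum>A\<in>Pow C. shuffle_sign A (C - A) * (f A * g (C - A))"
proof -
  fix f g :: "nat set \<Rightarrow> 'a"
  assume f: "finite {A. f A \<noteq> 0} \<and> (\<forall>A. f A \<noteq> 0 \<longrightarrow> finite A)"
    and g: "finite {A. g A \<noteq> 0} \<and> (\<forall>A. g A \<noteq> 0 \<longrightarrow> finite A)"
  let ?h = "\<lambda>C. \<Sum>A\<in>Pow C. shuffle_sign A (C - A) * (f A * g (C - A))"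
  have *: "\<exists>A. A \<subseteq> C \<and> f A \<noteq> 0 \<and> g (C - A) \<noteq> 0" if C: "?h C \<noteq> 0" for C
  proof -
    obtain A where "A \<in> Pow C" "shuffle_sign A (C - A) * (f A * g (C - A)) \<noteq> 0"
      using sum.not_neutral_contains_not_neutral[OF C] by blast
    then show ?thesis by (intro exI[of _ A]) auto
  qed
  have "{C. ?h C \<noteq> 0} \<subseteq> (\<lambda>(A, B). A \<union> B) ` ({A. f A \<noteq> 0} \<times> {A. g A \<noteq> 0})"
  proof
    fix C assume "C \<in> {C. ?h C \<noteq> 0}"
    then obtain A where "A \<subseteq> C" "f A \<noteq> 0" "g (C - A) \<noteq> 0" using * by blast
    then show "C \<in> (\<lambda>(A, B). A \<union> B) ` ({A. f A \<noteq> 0} \<times> {A. g A \<noteq> 0})"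
      by (intro image_eqI[of _ _ "(A, C - A)"]) auto
  qed
  moreover have "finite C" if "?h C \<noteq> 0" for C
    using *[OF that] f g finite_Diff2 by blast
  ultimately show "finite {C. ?h C \<noteq> 0} \<and> (\<forall>C. ?h C \<noteq> 0 \<longrightarrow> finite C)"
    using f g by (simp add: finite_subset[OF _ finite_imageI[OF finite_cartesian_product]])
qed

lemma shuffle_sign_Un_left:
  assumes "finite A" "finite B" "finite C" "A \<inter> B = {}"
  shows "shuffle_sign (A \<union> B) C = (shuffle_sign A C * shuffle_sign B C :: 'k::comm_ring_1)"
proof -
  have fin: "finite {(a, b). a \<in> X \<and> b \<in> C \<and> b < a}" if "finite X" for X :: "nat set"
    by (rule finite_subset[of _ "X \<times> C"]) (use that assms in auto)
  have "{(a, b). a \<in> A \<union> B \<and> b \<in> C \<and> b < a} =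
    {(a, b). a \<in> A \<and> b \<in> C \<and> b < a} \<union> {(a, b). a \<in> B \<and> b \<in> C \<and> b < a}" by auto
  then show ?thesis unfolding shuffle_sign_def power_add[symmetric]
    using assms fin[of A] fin[of B] by (subst card_Un_disjoint[symmetric]) auto
qed

lemma shuffle_sign_Un_right:
  assumes "finite A" "finite B" "finite C" "B \<inter> C = {}"
  shows "shuffle_sign A (B \<union> C) = (shuffle_sign A B * shuffle_sign A C :: 'k::comm_ring_1)"
proof -
  have fin: "finite {(a, b). a \<in> A \<and> b \<in> X \<and> b < a}" if "finite X" for X :: "nat set"
    by (rule finite_subset[of _ "A \<times> X"]) (use that assms in auto)
  have "{(a, b). a \<in> A \<and> b \<in> B \<union> C \<and> b < a} =
    {(a, b). a \<in> A \<and> b \<in> B \<and> b < a} \<union> {(a, b). a \<in> A \<and> b \<in> C \<and> b < a}" by auto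
  then show ?thesis unfolding shuffle_sign_def power_add[symmetric]
    using assms fin[of B] fin[of C] by (subst card_Un_disjoint[symmetric]) auto
qed

lemma shuffle_sign_empty [simp]: "shuffle_sign {} A = 1" "shuffle_sign A {} = 1"
  by (simp_all add: shuffle_sign_def)

lemma times_grass_assoc: "(f * g) * h = f * (g * h :: 'a grass)"
proof (rule grass_eqI)
  fix C :: "nat set"
  show "coef ((f * g) * h) C = coef (f * (g * h)) C"
  proof (cases "finite C")
    case False
    then show ?thesis by (simp add: coef_infinite)
  next
    case C: True
    have "coef ((f * g) * h) C =
      (\<Sum>D\<in>Pow C. \<Sum>A\<in>Pow D. shuffle_sign D (C - D) * (shuffle_sign A (D - A) *
        (coef f A * coef g (D - A)) * coef h (C - D)))"
      by (simp add: times_grass.rep_eq sum_distrib_left sum_distrib_right mult.assoc)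
    also have "\<dots> = (\<Sum>(D, A)\<in>Sigma (Pow C) Pow. shuffle_sign D (C - D) * (shuffle_sign A (D - A) *
        (coef f A * coef g (D - A)) * coef h (C - D)))"
      using C by (intro sum.Sigma) (auto intro: finite_subset)
    also have "\<dots> = (\<Sum>(A, B)\<in>Sigma (Pow C) (\<lambda>A. Pow (C - A)). shuffle_sign A (C - A) * (coef f A *
        (shuffle_sign B (C - A - B) * (coef g B * coef h (C - A - B)))))"
    proof (rule sum.reindex_bij_witness[of _ "\<lambda>(A, B). (A \<union> B, A)" "\<lambda>(D, A). (A, D - A)"],
        goal_cases)
      case (5 x)
      obtain D A where x: "x = (D, A)" by (cases x)
      have DA: "A \<subseteq> D" "D \<subseteq> C" using 5 x by auto
      have fin: "finite D" "finite A" "finite (D - A)" "finite (C - D)"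
        using DA C by (auto intro: finite_subset)
      have "shuffle_sign D (C - D) = (shuffle_sign A (C - D) * shuffle_sign (D - A) (C - D) :: 'a)"
        using shuffle_sign_Un_left[of A "D - A" "C - D"] fin DA by (simp add: Un_absorb1)
      moreover have "shuffle_sign A (C - A) = (shuffle_sign A (D - A) * shuffle_sign A (C - D) :: 'a)"
      proof -
        have "C - A = (D - A) \<union> (C - D)" using DA by auto
        then show ?thesis using shuffle_sign_Un_right[of A "D - A" "C - D"] fin by auto
      qed
      moreover have "C - A - (D - A) = C - D" using DA by auto
      ultimately show ?case using x by (simp add: algebra_simps)
    qed auto
    also have "\<dots> = (\<Sum>A\<in>Pow C. \<Sum>B\<in>Pow (C - A). shuffle_sign A (C - A) * (coef f A *
        (shuffle_sign B (C - A - B) * (coef g B * coef h (C - A - B)))))"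
      using C by (intro sum.Sigma[symmetric]) (auto intro: finite_subset)
    also have "\<dots> = coef (f * (g * h)) C"
      by (simp add: times_grass.rep_eq sum_distrib_left)
    finally show ?thesis .
  qed
qed

instance
proof
  fix f g h :: "'a grass"
  show "f + g + h = f + (g + h)" by (rule grass_eqI) (simp add: plus_grass.rep_eq add.assoc)
  show "f + g = g + f" by (rule grass_eqI) (simp add: plus_grass.rep_eq add.commute)
  show "0 + f = f" by (rule grass_eqI) (simp add: plus_grass.rep_eq zero_grass.rep_eq)
  show "- f + f = 0"
    by (rule grass_eqI) (simp add: plus_grass.rep_eq zero_grass.rep_eq uminus_grass.rep_eq)
  show "f - g = f + - g" by (rule minus_grass_def)
  show "f * g * h = f * (g * h)" by (rule times_grass_assoc)
  show "(f + g) * h = f * h + g * h"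
    by (rule grass_eqI)
      (simp add: times_grass.rep_eq plus_grass.rep_eq sum.distrib[symmetric] algebra_simps)
  show "f * (g + h) = f * g + f * h"
    by (rule grass_eqI)
      (simp add: times_grass.rep_eq plus_grass.rep_eq sum.distrib[symmetric] algebra_simps)
  show "(0::'a grass) \<noteq> 1"
    by (metis one_grass.rep_eq zero_grass.rep_eq zero_neq_one)
  show "1 * f = f"
  proof (rule grass_eqI)
    fix C
    show "coef (1 * f) C = coef f C"
    proof (cases "finite C")
      case True
      have "coef (1 * f) C = (\<Sum>A\<in>Pow C. if A = {} then coef f C else 0)"
        unfolding times_grass.rep_eq one_grass.rep_eq by (intro sum.cong) auto
      with True show ?thesis by simp
    qed (simp add: coef_infinite)
  qed
  show "f * 1 = f"
  proof (rule grass_eqI)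
    fix C
    show "coef (f * 1) C = coef f C"
    proof (cases "finite C")
      case True
      have "coef (f * 1) C = (\<Sum>A\<in>Pow C. if A = C then coef f C else 0)"
        unfolding times_grass.rep_eq one_grass.rep_eq by (intro sum.cong) auto
      with True show ?thesis by simp
    qed (simp add: coef_infinite)
  qed
qed

end

lift_definition gscale :: "'k::comm_ring_1 \<Rightarrow> 'k grass \<Rightarrow> 'k grass" is "\<lambda>c f A. c * f A"
  by (metis (mono_tags, lifting) Collect_mono mult_zero_right rev_finite_subset)

lift_definition gmon :: "nat set \<Rightarrow> 'k::comm_ring_1 grass" is
  "\<lambda>A B. if finite A \<and> B = A then 1 else 0"
  by auto

definition gvar :: "nat \<Rightarrow> 'k::comm_ring_1 grass" where
  "gvar i = gmon {i}"

text \<open>The component of parity \<open>p\<close> (only \<open>p mod 2\<close> matters).\<close>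

lift_definition gpart :: "nat \<Rightarrow> 'k::comm_ring_1 grass \<Rightarrow> 'k grass" is
  "\<lambda>p f A. if even (card A + p) then f A else 0"
proof -
  fix p :: nat and f :: "nat set \<Rightarrow> 'k"
  assume f: "finite {A. f A \<noteq> 0} \<and> (\<forall>A. f A \<noteq> 0 \<longrightarrow> finite A)"
  have "finite {A. (if even (card A + p) then f A else 0) \<noteq> 0}"
    by (rule finite_subset[of _ "{A. f A \<noteq> 0}"]) (use f in \<open>auto split: if_splits\<close>)
  with f show "finite {A. (if even (card A + p) then f A else 0) \<noteq> 0} \<and>
      (\<forall>A. (if even (card A + p) then f A else 0) \<noteq> 0 \<longrightarrow> finite A)"
    by meson
qed

lemma coef_minus: "coef (f - g) A = coef f A - coef g A" for f g :: "'k::comm_ring_1 grass"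
  unfolding minus_grass_def plus_grass.rep_eq uminus_grass.rep_eq by simp

lemmas coef_simps = zero_grass.rep_eq one_grass.rep_eq plus_grass.rep_eq uminus_grass.rep_eq
  coef_minus gscale.rep_eq gmon.rep_eq gpart.rep_eq

global_interpretation grass: vector_space "gscale :: 'k::field \<Rightarrow> 'k grass \<Rightarrow> 'k grass"
  by standard (auto intro!: grass_eqI simp: coef_simps algebra_simps)

lemma gscale_mult:
  "gscale c f * g = gscale c (f * g)" "f * gscale c g = gscale c (f * g)"
  by (rule grass_eqI, simp add: times_grass.rep_eq coef_simps sum_distrib_left algebra_simps)+


section \<open>Linear operators and the supercommutator\<close>

abbreviation glinear :: "'k::field gop \<Rightarrow> bool" where
  "glinear \<equiv> Vector_Spaces.linear gscale gscale"

definition op_scale :: "'k::field \<Rightarrow> 'k gop \<Rightarrow> 'k gop" where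
  "op_scale c S = (\<lambda>f. gscale c (S f))"

lemma op_scale_apply: "op_scale c S f = gscale c (S f)"
  by (simp add: op_scale_def)

global_interpretation gop: vector_space "op_scale :: 'k::field \<Rightarrow> 'k gop \<Rightarrow> 'k gop"
  by standard (simp_all add: op_scale_def fun_eq_iff grass.scale_right_distrib grass.scale_left_distrib)

text \<open>The component of parity \<open>p\<close> of a linear operator; an operator \<open>S\<close> is homogeneous of parity
  \<open>p\<close> iff \<open>op_part p S = S\<close>.\<close>

definition op_part :: "nat \<Rightarrow> 'k::field gop \<Rightarrow> 'k gop" where
  "op_part p S = (\<lambda>f. \<Sum>q<2. gpart (p + q) (S (gpart q f)))"

text \<open>The bilinear extension of $[S, T] = S T - (-1)^{\deg S \deg T} T S$ from homogeneous
  operators to all of them, see \<open>superbracket_homogeneous\<close> below.\<close>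

definition superbracket :: "'k::field gop \<Rightarrow> 'k gop \<Rightarrow> 'k gop" where
  "superbracket S T =
    (\<lambda>f. S (T f) - (\<Sum>p<2. \<Sum>q<2. (-1) ^ (p * q) * op_part q T (op_part p S f)))"

lemma sum_lessThan_2: "(\<Sum>q<2. F q) = F 0 + (F (Suc 0) :: 'k::comm_ring_1 grass)"
  by (simp add: numeral_2_eq_2)

lemma gpart_add: "gpart p (f + g) = gpart p f + gpart p g"
  by (rule grass_eqI) (simp add: coef_simps)

lemma gpart_scale: "gpart p (gscale c f) = gscale c (gpart p f)"
  by (rule grass_eqI) (simp add: coef_simps)

lemma gpart_zero [simp]: "gpart p 0 = 0"
  by (rule grass_eqI) (simp add: coef_simps)

lemma gpart_gpart: "gpart p (gpart q f) = (if even (p + q) then gpart p f else 0)"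
  by (rule grass_eqI) (auto simp: coef_simps)

lemma gpart_cong: "even (p + q) \<Longrightarrow> gpart p f = gpart q f"
  by (rule grass_eqI) (auto simp: coef_simps)

lemma gpart_sum: "gpart 0 f + gpart (Suc 0) f = f"
  by (rule grass_eqI) (auto simp: coef_simps)

lemma glinear_simps:
  assumes "glinear S"
  shows "S (f + g) = S f + S g" "S (gscale c f) = gscale c (S f)" "S 0 = 0"
    "S (- f) = - S f" "S (f - g) = S f - S g"
proof -
  interpret Vector_Spaces.linear gscale gscale S by fact
  show "S (f + g) = S f + S g" "S (gscale c f) = gscale c (S f)" "S 0 = 0"
    "S (- f) = - S f" "S (f - g) = S f - S g"
    by (fact add scale zero neg diff)+
qed

lemma glinearI:
  assumes "\<And>f g. S (f + g) = S f + S g" "\<And>c f. S (gscale c f) = gscale c (S f)"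
  shows "glinear S"
  using assms by unfold_locales auto

lemma op_part_sum: "glinear S \<Longrightarrow> op_part 0 S f + op_part (Suc 0) S f = S f"
proof -
  assume S: "glinear S"
  have *: "gpart (Suc (Suc 0)) g = gpart 0 g" for g :: "'a grass" by (rule gpart_cong) simp
  have "op_part 0 S f + op_part (Suc 0) S f =
    (gpart 0 (S (gpart 0 f)) + gpart (Suc 0) (S (gpart 0 f))) +
    (gpart 0 (S (gpart (Suc 0) f)) + gpart (Suc 0) (S (gpart (Suc 0) f)))"
    by (simp add: op_part_def sum_lessThan_2 * algebra_simps)
  also have "\<dots> = S (gpart 0 f) + S (gpart (Suc 0) f)" unfolding gpart_sum ..
  also have "\<dots> = S f"
    unfolding glinear_simps(1)[OF S, symmetric] gpart_sum ..
  finally show ?thesis .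
qed

lemma glinear_gpart: "glinear (gpart p)"
  by (rule glinearI) (simp_all add: gpart_add gpart_scale)

lemma glinear_compose: "glinear S \<Longrightarrow> glinear T \<Longrightarrow> glinear (\<lambda>f. S (T f))"
  by (rule glinearI) (simp_all add: glinear_simps)

lemma glinear_add: "glinear S \<Longrightarrow> glinear T \<Longrightarrow> glinear (\<lambda>f. S f + T f)"
  by (rule glinearI) (simp_all add: glinear_simps grass.scale_right_distrib algebra_simps)

lemma glinear_uminus: "glinear S \<Longrightarrow> glinear (\<lambda>f. - S f)"
  by (rule glinearI) (simp_all add: glinear_simps)

lemma glinear_minus: "glinear S \<Longrightarrow> glinear T \<Longrightarrow> glinear (\<lambda>f. S f - T f)"
  by (rule glinearI) (simp_all add: glinear_simps grass.scale_right_diff_distrib algebra_simps)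

lemma glinear_mult: "glinear S \<Longrightarrow> glinear (\<lambda>f. g * S f)"
  by (rule glinearI) (simp_all add: glinear_simps gscale_mult algebra_simps)

lemma glinear_op_part: "glinear S \<Longrightarrow> glinear (op_part p S)"
  unfolding op_part_def sum_lessThan_2
  by (simp add: glinear_add glinear_compose[OF glinear_gpart]
      glinear_compose[OF _ glinear_gpart])

lemma op_part_cong: "even (p + q) \<Longrightarrow> op_part p S = op_part q S"
  unfolding op_part_def by (intro ext sum.cong gpart_cong) auto

lemma op_part_op_part:
  assumes "glinear S"
  shows "op_part p (op_part q S) = (if even (p + q) then op_part p S else 0)"
  using assms
  by (auto simp: op_part_def sum_lessThan_2 fun_eq_iff gpart_add gpart_gpart glinear_simps
      intro: gpart_cong)

lemma superbracket_homogeneous: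
  assumes "glinear S" "glinear T" "op_part p S = S" "op_part q T = T"
  shows "superbracket S T = (\<lambda>f. S (T f) - (-1) ^ (p * q) * T (S f))"
proof -
  have S: "op_part r S = (if even (r + p) then S else 0)" for r
    using op_part_op_part[OF assms(1), of r p] op_part_cong[of r p S] assms(3) by metis
  have T: "op_part r T = (if even (r + q) then T else 0)" for r
    using op_part_op_part[OF assms(2), of r q] op_part_cong[of r q T] assms(4) by metis
  show ?thesis using assms(2)
    by (auto simp: superbracket_def sum_lessThan_2 S T glinear_simps)
qed

section \<open>Partial derivatives and pivot elements\<close>

lift_definition pd :: "nat \<Rightarrow> 'k::comm_ring_1 grass \<Rightarrow> 'k grass" is
  "\<lambda>i f A. if i \<in> A then 0 else (-1) ^ card {a \<in> A. a < i} * f (insert i A)"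
proof -
  fix i and f :: "nat set \<Rightarrow> 'k"
  assume f: "finite {A. f A \<noteq> 0} \<and> (\<forall>A. f A \<noteq> 0 \<longrightarrow> finite A)"
  let ?h = "\<lambda>A. if i \<in> A then 0 else (-1) ^ card {a \<in> A. a < i} * f (insert i A)"
  have "{A. ?h A \<noteq> 0} \<subseteq> (\<lambda>A. A - {i}) ` {A. f A \<noteq> 0}"
  proof
    fix A assume "A \<in> {A. ?h A \<noteq> 0}"
    then have "i \<notin> A" "f (insert i A) \<noteq> 0" by (auto split: if_splits)
    then show "A \<in> (\<lambda>A. A - {i}) ` {A. f A \<noteq> 0}"
      by (intro image_eqI[of _ _ "insert i A"]) auto
  qed
  moreover have "finite A" if "?h A \<noteq> 0" for A
  proof -
    have "f (insert i A) \<noteq> 0" using that by (cases "i \<in> A") auto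
    then have "finite (insert i A)" using conjunct2[OF f] by (elim allE impE)
    then show ?thesis by simp
  qed
  ultimately show "finite {A. ?h A \<noteq> 0} \<and> (\<forall>A. ?h A \<noteq> 0 \<longrightarrow> finite A)"
    using finite_imageI[OF conjunct1[OF f]] by (intro conjI allI impI) (erule finite_subset)
qed

definition odd_superderivation :: "'k::field gop \<Rightarrow> bool" where
  "odd_superderivation D \<longleftrightarrow> glinear D \<and> op_part 1 D = D \<and>
    (\<forall>p f g. gpart p f = f \<longrightarrow> D (f * g) = D f * g + (-1) ^ p * (f * D g))"

text \<open>The letters of \<open>f\<close> below \<open>i\<close> do not contribute to $v_i(f)$, and $v_i(f) = 0$ if \<open>f\<close> has no
  letter from \<open>i\<close> on. Hence the recursion $v_i = \partial_i + x_i x_{i+1} v_{i+2}$ terminates on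
  each element; it is proved without the side condition in \<open>pivot_rec\<close> below.\<close>

function pivot :: "nat \<Rightarrow> 'k::field grass \<Rightarrow> 'k grass" where
  "pivot i f =
    (if \<exists>A j. coef f A \<noteq> 0 \<and> j \<in> A \<and> i \<le> j
     then pd i f + gvar i * gvar (i + 1) * pivot (i + 2) f else 0)"
  by auto

lemma finite_letters: "finite (\<Union>{A. coef f A \<noteq> 0})"
  using coef_infinite[of _ f] by (intro finite_Union) auto

termination
proof (relation "measure (\<lambda>(i, f :: 'k::field grass). Suc (Max (\<Union>{A. coef f A \<noteq> 0})) - i)", goal_cases)
  case (2 i f)
  then obtain A j where "coef f A \<noteq> 0" "j \<in> A" "i \<le> j" by blast
  then have "i \<le> Max (\<Union>{A. coef f A \<noteq> 0})"
    using finite_letters[of f] by (intro order.trans[OF _ Max_ge[of _ j]]) auto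
  then show ?case by simp
qed simp

declare pivot.simps [simp del]

lemma letters_bounded: "\<exists>N. \<forall>A j. coef f A \<noteq> 0 \<longrightarrow> j \<in> A \<longrightarrow> j < N"
  using finite_nat_set_iff_bounded[of "\<Union>{A. coef f A \<noteq> 0}"] finite_letters[of f] by blast

lemma pivot_eq_0: "(\<And>A j. coef f A \<noteq> 0 \<Longrightarrow> j \<in> A \<Longrightarrow> j < i) \<Longrightarrow> pivot i f = 0"
  by (subst pivot.simps) (auto simp: not_less[symmetric])

lemma pivot_rec: "pivot i f = pd i f + gvar i * gvar (i + 1) * pivot (i + 2) f"
proof (cases "\<exists>A j. coef f A \<noteq> 0 \<and> j \<in> A \<and> i \<le> j")
  case True
  then show ?thesis by (subst pivot.simps) simp
next
  case False
  have "pd i f = 0"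
    by (rule grass_eqI) (use False in \<open>auto simp: pd.rep_eq coef_simps\<close>)
  moreover have *: "j < i" if "coef f A \<noteq> 0" "j \<in> A" for A j
    using False that not_le_imp_less by blast
  have "pivot i f = 0" "pivot (i + 2) f = 0"
    by (rule pivot_eq_0, erule (1) *) (rule pivot_eq_0, rule trans_less_add1, erule (1) *)
  with calculation show ?thesis by simp
qed

text \<open>Two-step downward induction, for statements about all pivot elements.\<close>

lemma pivot_induct:
  assumes "\<And>i. N \<le> i \<Longrightarrow> P i" "\<And>i. P (i + 2) \<Longrightarrow> P i"
  shows "P (i :: nat)"
proof (induction "N - i" arbitrary: i rule: less_induct)
  case less
  show ?case
  proof (cases "N \<le> i")
    case False
    then have "P (i + 2)" by (intro less) simp
    then show ?thesis by (rule assms(2))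
  qed (rule assms(1))
qed

subsection \<open>Properties of the operators\<close>

lemma glinear_pd: "glinear (pd i)"
  by (rule glinearI) (rule grass_eqI, simp add: pd.rep_eq coef_simps algebra_simps)+

lemma pd_gvar: "pd i (gvar j) = (if i = j then 1 else 0)"
  by (rule grass_eqI) (auto simp: gvar_def pd.rep_eq coef_simps)

lemma gpart_pd: "gpart p (pd i f) = pd i (gpart (Suc p) f)"
proof (rule grass_eqI)
  fix A show "coef (gpart p (pd i f)) A = coef (pd i (gpart (Suc p) f)) A"
  proof (cases "finite A \<and> i \<notin> A")
    case True
    then have "card (insert i A) = Suc (card A)" by simp
    with True show ?thesis by (simp add: coef_simps pd.rep_eq)
  qed (auto simp: coef_simps pd.rep_eq coef_infinite)
qed

lemma op_part_oddI:
  assumes "glinear S" "\<And>p f. gpart p (S f) = S (gpart (Suc p) f)"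
  shows "op_part 1 S = S"
proof
  fix f
  have "op_part 1 S f = S (gpart 0 f) + S (gpart 1 f)"
    using gpart_cong[of "Suc (Suc 0)" 0 "gpart 0 f"]
      gpart_cong[of "Suc (Suc (Suc 0))" 1 "gpart 1 f"]
    by (simp add: op_part_def sum_lessThan_2 assms(2) gpart_gpart)
  also have "\<dots> = S f"
    using glinear_simps(1)[OF assms(1), of "gpart 0 f" "gpart 1 f"] gpart_sum[of f] by simp
  finally show "op_part 1 S f = S f" .
qed

lemma op_part_pd: "op_part 1 (pd i) = pd i"
  by (intro op_part_oddI glinear_pd gpart_pd)

lemma card_diff_split:
  assumes "finite A"
  shows "card (A - {i}) = card {a \<in> A. a < i} + card {a \<in> A. i < (a::nat)}"
proof -
  have "card {a \<in> A. a < i} + card {a \<in> A. i < a} = card ({a \<in> A. a < i} \<union> {a \<in> A. i < a})"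
    by (rule card_Un_disjoint[symmetric]) (use assms in auto)
  also have "{a \<in> A. a < i} \<union> {a \<in> A. i < a} = A - {i}" by auto
  finally show ?thesis ..
qed

lemma coef_gvar_mult:
  "coef (gvar i * f) A =
    (if finite A \<and> i \<in> A then (-1) ^ card {a \<in> A. a < i} * coef f (A - {i}) else 0)"
proof (cases "finite A")
  case A: True
  have "{(a, b). a \<in> {i} \<and> b \<in> A - {i} \<and> b < a} = Pair i ` {a \<in> A. a < i}" by auto
  then have s: "shuffle_sign {i} (A - {i}) = ((-1) ^ card {a \<in> A. a < i} :: 'a)"
    by (simp add: shuffle_sign_def card_image inj_on_def)
  have "coef (gvar i * f) A = (\<Sum>B\<in>Pow A. if B = {i}
    then (-1) ^ card {a \<in> A. a < i} * coef f (A - {i}) else 0)"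
    unfolding times_grass.rep_eq by (intro sum.cong) (auto simp: gvar_def coef_simps s)
  with A show ?thesis by auto
qed (simp add: coef_infinite)

lemma coef_mult_gvar:
  "coef (f * gvar i) A =
    (if finite A \<and> i \<in> A then (-1) ^ card {a \<in> A. i < a} * coef f (A - {i}) else 0)"
proof (cases "finite A")
  case A: True
  show ?thesis
  proof (cases "i \<in> A")
    case i: True
    have "{(a, b). a \<in> A - {i} \<and> b \<in> {i} \<and> b < a} = (\<lambda>a. (a, i)) ` {a \<in> A. i < a}" by auto
    then have s: "shuffle_sign (A - {i}) {i} = ((-1) ^ card {a \<in> A. i < a} :: 'a)"
      by (simp add: shuffle_sign_def card_image inj_on_def)
    have *: "A - (A - {i}) = {i}" using i by auto
    have "coef (f * gvar i) A = (\<Sum>B\<in>Pow A. if B = A - {i}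
      then (-1) ^ card {a \<in> A. i < a} * coef f (A - {i}) else 0)"
      unfolding times_grass.rep_eq
    proof (intro sum.cong refl)
      fix B assume "B \<in> Pow A"
      then have "A - B = {i} \<longleftrightarrow> B = A - {i}" using i by auto
      then show "shuffle_sign B (A - B) * (coef f B * coef (gvar i) (A - B)) =
        (if B = A - {i} then (-1) ^ card {a \<in> A. i < a} * coef f (A - {i}) else 0)"
        using s * by (auto simp: gvar_def coef_simps)
    qed
    with A i show ?thesis by auto
  next
    case False
    then have "A - B \<noteq> {i}" for B by auto
    with False show ?thesis by (simp add: times_grass.rep_eq gvar_def coef_simps)
  qed
qed (simp add: coef_infinite)

lemma gvar_square: "gvar i * gvar i = 0"
  by (rule grass_eqI) (simp add: coef_gvar_mult coef_simps, auto simp: gvar_def coef_simps)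

lemma gvar_supercommute:
  assumes "gpart p f = f"
  shows "gvar i * f = (-1) ^ p * (f * gvar i)"
proof (rule grass_eqI)
  fix A
  have m1: "coef ((-1) ^ p * g) A = (-1) ^ p * coef g A" for g :: "'a grass"
    by (cases "even p") (simp_all add: coef_simps)
  show "coef (gvar i * f) A = coef ((-1) ^ p * (f * gvar i)) A"
  proof (cases "finite A \<and> i \<in> A \<and> coef f (A - {i}) \<noteq> 0")
    case True
    then have "even (card (A - {i}) + p)"
      using assms by (metis gpart.rep_eq)
    moreover have "card (A - {i}) = card {a \<in> A. a < i} + card {a \<in> A. i < a}"
      using True by (intro card_diff_split) simp
    ultimately have "even (p + card {a \<in> A. a < i} + card {a \<in> A. i < a})" by presburger
    then have "(-1) ^ card {a \<in> A. a < i} = ((-1) ^ p * (-1) ^ card {a \<in> A. i < a} :: 'a)"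
      by (simp add: minus_one_power_iff) blast
    with True show ?thesis by (simp add: m1 coef_gvar_mult coef_mult_gvar)
  qed (auto simp: m1 coef_gvar_mult coef_mult_gvar)
qed

lemma gpart_gvar: "gpart 1 (gvar i) = gvar i"
  by (rule grass_eqI) (auto simp: gvar_def coef_simps)

lemma gvar_anticommute: "gvar i * gvar j = - (gvar j * gvar i)"
  using gvar_supercommute[OF gpart_gvar, of i j] by simp

lemma gpart_gvar_mult: "gpart p (gvar i * f) = gvar i * gpart (Suc p) f"
proof (rule grass_eqI)
  fix A show "coef (gpart p (gvar i * f)) A = coef (gvar i * gpart (Suc p) f) A"
  proof (cases "finite A \<and> i \<in> A")
    case True
    then have "card A = Suc (card (A - {i}))" by (intro card.remove) auto
    then have "even (card (A - {i}) + Suc p) \<longleftrightarrow> even (card A + p)" by presburger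
    then show ?thesis by (simp only: coef_simps coef_gvar_mult) simp
  qed (auto simp: coef_simps coef_gvar_mult)
qed

lemma gvar_pair_central: "gvar i * gvar j * f = f * (gvar i * gvar j)"
proof -
  have *: "gvar i * gvar j * f = f * (gvar i * gvar j)" if "gpart p f = f" for f :: "'a grass" and p
  proof -
    have "gvar i * gvar j * f = gvar i * ((-1) ^ p * (f * gvar j))"
      by (simp add: mult.assoc gvar_supercommute[OF that])
    also have "\<dots> = (-1) ^ p * (gvar i * f) * gvar j"
      by (cases "even p") (simp_all add: mult.assoc)
    also have "\<dots> = f * (gvar i * gvar j)"
      by (cases "even p") (simp_all add: mult.assoc gvar_supercommute[OF that])
    finally show ?thesis .
  qed
  have "gpart p (gpart p f) = gpart p f" for p by (simp add: gpart_gpart)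
  from *[OF this[of 0]] *[OF this[of 1]] show ?thesis
    using gpart_sum[of f] by (metis One_nat_def distrib_left distrib_right)
qed

lemma pd_mult:
  assumes f: "gpart p f = f"
  shows "pd i (f * g) = pd i f * g + (-1) ^ p * (f * pd i g)"
proof (rule grass_eqI)
  fix A
  have m1: "coef ((-1) ^ p * g) A = (-1) ^ p * coef g A" for g :: "'a grass"
    by (cases "even p") (simp_all add: coef_simps)
  define \<sigma> where "\<sigma> X = ((-1) ^ card {a \<in> X. a < i} :: 'a)" for X :: "nat set"
  have \<sigma>_sq [simp]: "\<sigma> X * \<sigma> X = 1" "\<sigma> X * (\<sigma> X * c) = c" for X c
    by (simp_all add: \<sigma>_def mult.assoc[symmetric] power_add[symmetric])
  have \<sigma>_Un: "\<sigma> (X \<union> Y) = \<sigma> X * \<sigma> Y" if "finite X" "finite Y" "X \<inter> Y = {}" for X Y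
  proof -
    have "{a \<in> X \<union> Y. a < i} = {a \<in> X. a < i} \<union> {a \<in> Y. a < i}" by auto
    then show ?thesis using that unfolding \<sigma>_def power_add[symmetric]
      by (subst card_Un_disjoint[symmetric]) auto
  qed
  have ss1: "shuffle_sign (insert i B) C = \<sigma> C * shuffle_sign B C"
    if "finite B" "finite C" "i \<notin> B" for B C
  proof -
    have "{(a, b). a \<in> {i} \<and> b \<in> C \<and> b < a} = Pair i ` {a \<in> C. a < i}" by auto
    then have "shuffle_sign {i} C = \<sigma> C"
      by (simp add: shuffle_sign_def card_image inj_on_def \<sigma>_def)
    then show ?thesis using shuffle_sign_Un_left[where 'k = 'a, of "{i}" B C] that by simp
  qed
  have ss2: "shuffle_sign B (insert i C) = (-1) ^ card B * \<sigma> B * shuffle_sign B C"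
    if "finite B" "finite C" "i \<notin> B" "i \<notin> C" for B C
  proof -
    have "card B = card {a \<in> B. a < i} + card {a \<in> B. i < a}"
      using card_diff_split[of B i] that by simp
    then have "(-1) ^ card B * \<sigma> B = (-1) ^ card {a \<in> B. i < a}"
      by (simp add: \<sigma>_def minus_one_power_iff)
    moreover have "{(a, b). a \<in> B \<and> b \<in> {i} \<and> b < a} = (\<lambda>a. (a, i)) ` {a \<in> B. i < a}" by auto
    then have "shuffle_sign B {i} = ((-1) ^ card {a \<in> B. i < a} :: 'a)"
      by (simp add: shuffle_sign_def card_image inj_on_def)
    ultimately show ?thesis using shuffle_sign_Un_right[where 'k = 'a, of B "{i}" C] that by simp
  qed
  have par: "(-1) ^ p = ((-1) ^ card B :: 'a)" if "coef f B \<noteq> 0" for B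
  proof -
    have "even (card B + p)" using f that by (metis gpart.rep_eq)
    then show ?thesis by (simp add: minus_one_power_iff)
  qed
  have split: "(\<Sum>B\<in>Pow (insert i C). F B) = (\<Sum>B\<in>Pow C. F B) + (\<Sum>B\<in>Pow C. F (insert i B))"
    if "finite C" "i \<notin> C" for C and F :: "nat set \<Rightarrow> 'a"
  proof -
    have "inj_on (insert i) (Pow C)"
      by (rule inj_onI) (metis PowD insert_ident subsetD that(2))
    then have "sum F (insert i ` Pow C) = (\<Sum>B\<in>Pow C. F (insert i B))"
      by (simp add: sum.reindex)
    moreover have "sum F (Pow C \<union> insert i ` Pow C) = sum F (Pow C) + sum F (insert i ` Pow C)"
      by (rule sum.union_disjoint) (use that in auto)
    ultimately show ?thesis by (simp add: Pow_insert)
  qed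
  show "coef (pd i (f * g)) A = coef (pd i f * g + (-1) ^ p * (f * pd i g)) A"
  proof (cases "finite A")
    case False
    then show ?thesis by (simp add: coef_infinite)
  next
    case A: True
    have [simp]: "coef (pd i h) B = (if i \<in> B then 0 else \<sigma> B * coef h (insert i B))" for h B
      by (simp add: pd.rep_eq \<sigma>_def)
    show ?thesis
    proof (cases "i \<in> A")
      case False
      have "coef (pd i (f * g)) A =
        \<sigma> A * (\<Sum>B\<in>Pow A. shuffle_sign B (insert i A - B) * (coef f B * coef g (insert i A - B))) +
        \<sigma> A * (\<Sum>B\<in>Pow A. shuffle_sign (insert i B) (insert i A - insert i B) *
          (coef f (insert i B) * coef g (insert i A - insert i B)))"
        using False A by (simp add: times_grass.rep_eq split distrib_left)
      also have "\<sigma> A * (\<Sum>B\<in>Pow A. shuffle_sign B (insert i A - B) *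
          (coef f B * coef g (insert i A - B))) = (-1) ^ p * coef (f * pd i g) A"
        unfolding times_grass.rep_eq sum_distrib_left
      proof (intro sum.cong refl)
        fix B assume "B \<in> Pow A"
        then have B: "B \<subseteq> A" "finite B" "finite (A - B)" "i \<notin> B" "i \<notin> A - B"
          using A False by (auto intro: finite_subset)
        have *: "insert i A - B = insert i (A - B)" using B by auto
        have "\<sigma> A = \<sigma> B * \<sigma> (A - B)" using \<sigma>_Un[of B "A - B"] B by (simp add: Un_absorb1)
        then show "\<sigma> A * (shuffle_sign B (insert i A - B) * (coef f B * coef g (insert i A - B))) =
          (-1) ^ p * (shuffle_sign B (A - B) * (coef f B * coef (pd i g) (A - B)))"
          using B par[of B] unfolding * by (cases "coef f B = 0") (simp_all add: ss2 mult_ac)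
      qed
      also have "\<sigma> A * (\<Sum>B\<in>Pow A. shuffle_sign (insert i B) (insert i A - insert i B) *
          (coef f (insert i B) * coef g (insert i A - insert i B))) = coef (pd i f * g) A"
        unfolding times_grass.rep_eq sum_distrib_left
      proof (intro sum.cong refl)
        fix B assume "B \<in> Pow A"
        then have B: "B \<subseteq> A" "finite B" "finite (A - B)" "i \<notin> B" "i \<notin> A - B"
          using A False by (auto intro: finite_subset)
        have *: "insert i A - insert i B = A - B" using B False by auto
        have "\<sigma> A = \<sigma> B * \<sigma> (A - B)" using \<sigma>_Un[of B "A - B"] B by (simp add: Un_absorb1)
        then show "\<sigma> A * (shuffle_sign (insert i B) (insert i A - insert i B) *
            (coef f (insert i B) * coef g (insert i A - insert i B))) =
          shuffle_sign B (A - B) * (coef (pd i f) B * coef g (A - B))"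
          using B unfolding * by (simp add: ss1 mult_ac)
      qed
      finally show ?thesis by (simp add: m1 plus_grass.rep_eq)
    next
      case True
      define C where "C = A - {i}"
      have C: "finite C" "i \<notin> C" "A = insert i C" using A True by (auto simp: C_def)
      have "coef (pd i f * g) A = (\<Sum>B\<in>Pow C. shuffle_sign B (A - B) *
          (\<sigma> B * coef f (insert i B) * coef g (A - B)))"
        unfolding times_grass.rep_eq \<open>A = insert i C\<close> using C
        by (subst split) (auto intro!: sum.cong)
      also have "\<dots> = (\<Sum>B\<in>Pow C. - ((-1) ^ p * (shuffle_sign (insert i B) (A - insert i B) *
          (coef f (insert i B) * coef (pd i g) (A - insert i B)))))"
      proof (intro sum.cong refl)
        fix B assume "B \<in> Pow C"
        then have B: "B \<subseteq> C" "finite B" "finite (C - B)" "i \<notin> B" "i \<notin> C - B"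
          using C by (auto intro: finite_subset)
        have *: "A - B = insert i (C - B)" "A - insert i B = C - B" using B C by auto
        show "shuffle_sign B (A - B) * (\<sigma> B * coef f (insert i B) * coef g (A - B)) =
          - ((-1) ^ p * (shuffle_sign (insert i B) (A - insert i B) *
            (coef f (insert i B) * coef (pd i g) (A - insert i B))))"
          using B par[of "insert i B"] unfolding *
          by (cases "coef f (insert i B) = 0") (simp_all add: ss1 ss2 mult_ac)
      qed
      also have "\<dots> = - ((-1) ^ p * coef (f * pd i g) A)"
        unfolding times_grass.rep_eq \<open>A = insert i C\<close> using C
        by (subst split, simp, simp, subst (2) sum.neutral) (auto simp: sum_negf sum_distrib_left)
      finally show ?thesis using True by (simp add: m1 plus_grass.rep_eq)
    qed
  qed
qed

lemma odd_superderivation_pd: "odd_superderivation (pd i)"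
  using glinear_pd op_part_pd pd_mult unfolding odd_superderivation_def by blast

lemma gmon_insert:
  assumes "finite A" "\<And>a. a \<in> A \<Longrightarrow> i < a"
  shows "gmon (insert i A) = gvar i * gmon A"
proof (rule grass_eqI)
  fix B
  have i: "i \<notin> A" using assms(2) by blast
  have E: "{a \<in> insert i A. a < i} = {}" using assms(2) by force
  have "B = insert i A \<longleftrightarrow> i \<in> B \<and> B - {i} = A" using i by blast
  then show "coef (gmon (insert i A)) B = coef (gvar i * gmon A) B"
  proof (cases "B = insert i A")
    case True
    show ?thesis unfolding True coef_gvar_mult gmon.rep_eq E using i assms(1) by simp
  qed (use assms(1) in \<open>auto simp: coef_gvar_mult gmon.rep_eq\<close>)
qed

lemma grass_eq_sum_gmon: "f = (\<Sum>A | coef f A \<noteq> 0. gscale (coef f A) (gmon A))"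
proof (rule grass_eqI)
  fix B
  have sum: "coef (sum F X) B = (\<Sum>A\<in>X. coef (F A) B)" for F :: "nat set \<Rightarrow> 'a grass" and X
    by (induction X rule: infinite_finite_induct) (simp_all add: coef_simps)
  have "(\<Sum>A | coef f A \<noteq> 0. coef (gscale (coef f A) (gmon A)) B) =
      (\<Sum>A | coef f A \<noteq> 0. if A = B then coef f B else 0)"
    using coef_infinite[of B f] by (intro sum.cong) (auto simp: coef_simps)
  then show "coef f B = coef (\<Sum>A | coef f A \<noteq> 0. gscale (coef f A) (gmon A)) B"
    unfolding sum by simp
qed

text \<open>An odd superderivation is determined by its values on the generators; so \<open>pd i\<close> is the one
  with $\partial_i(x_j) = \delta_{ij}$.\<close>

lemma odd_superderivation_unique:
  assumes D: "odd_superderivation D" and E: "odd_superderivation E"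
    and eq: "\<And>j. D (gvar j) = E (gvar j)"
  shows "D = E"
proof
  fix f
  have one: "F 1 = 0" if "odd_superderivation F" for F :: "'a gop"
  proof -
    have "gpart 0 1 = (1 :: 'a grass)" by (rule grass_eqI) (simp add: coef_simps)
    then have "F (1 * 1) = F 1 * 1 + (-1) ^ 0 * (1 * F 1)"
      using that unfolding odd_superderivation_def by blast
    then show ?thesis by simp
  qed
  have gmon: "D (gmon A) = E (gmon A)" if "finite A" for A
    using that
  proof (induction A rule: finite_linorder_min_induct)
    case empty
    have "gmon {} = (1 :: 'a grass)" by (rule grass_eqI) (simp add: coef_simps)
    then show ?case using one[OF D] one[OF E] by simp
  next
    case (insert i A)
    have step: "F (gmon (insert i A)) = F (gvar i) * gmon A + (-1) ^ 1 * (gvar i * F (gmon A))"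
      if "odd_superderivation F" for F :: "'a gop"
    proof -
      have "gmon (insert i A) = gvar i * (gmon A :: 'a grass)"
        using insert by (intro gmon_insert) auto
      then show ?thesis using gpart_gvar[of i] that unfolding odd_superderivation_def by metis
    qed
    show ?case unfolding step[OF D] step[OF E] eq insert.IH ..
  qed
  have sum: "F (sum G X) = (\<Sum>A\<in>X. F (G A))"
    if "glinear F" for F :: "'a gop" and G :: "nat set \<Rightarrow> 'a grass" and X
    by (induction X rule: infinite_finite_induct) (simp_all add: glinear_simps[OF that])
  have lin: "glinear D" "glinear E" using D E unfolding odd_superderivation_def by blast+
  have "D (\<Sum>A | coef f A \<noteq> 0. gscale (coef f A) (gmon A)) =
      E (\<Sum>A | coef f A \<noteq> 0. gscale (coef f A) (gmon A))"
    unfolding sum[OF lin(1)] sum[OF lin(2)]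
  proof (rule sum.cong[OF refl])
    fix A assume "A \<in> {A. coef f A \<noteq> 0}"
    then have "finite A" using coef_infinite[of A f] by blast
    then show "D (gscale (coef f A) (gmon A)) = E (gscale (coef f A) (gmon A))"
      by (simp add: glinear_simps[OF lin(1)] glinear_simps[OF lin(2)] gmon)
  qed
  then show "D f = E f" unfolding grass_eq_sum_gmon[of f, symmetric] .
qed

lemma pd_unique:
  assumes "odd_superderivation D" "\<And>j. D (gvar j) = (if i = j then 1 else 0)"
  shows "D = pd i"
  using assms by (intro odd_superderivation_unique odd_superderivation_pd) (auto simp: pd_gvar)

lemma letters_bounded3:
  "\<exists>N. (\<forall>A j. coef f A \<noteq> 0 \<longrightarrow> j \<in> A \<longrightarrow> j < N) \<and> (\<forall>A j. coef g A \<noteq> 0 \<longrightarrow> j \<in> A \<longrightarrow> j < N) \<and>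
    (\<forall>A j. coef h A \<noteq> 0 \<longrightarrow> j \<in> A \<longrightarrow> j < N)"
proof -
  obtain N1 where 1: "\<forall>A j. coef f A \<noteq> 0 \<longrightarrow> j \<in> A \<longrightarrow> j < N1" using letters_bounded by blast
  obtain N2 where 2: "\<forall>A j. coef g A \<noteq> 0 \<longrightarrow> j \<in> A \<longrightarrow> j < N2" using letters_bounded by blast
  obtain N3 where 3: "\<forall>A j. coef h A \<noteq> 0 \<longrightarrow> j \<in> A \<longrightarrow> j < N3" using letters_bounded by blast
  show ?thesis
    by (rule exI[of _ "N1 + N2 + N3"]) (use 1 2 3 in \<open>meson trans_less_add1 trans_less_add2\<close>)
qed

lemma pivot_eq_0_bound:
  "\<forall>A j. coef f A \<noteq> 0 \<longrightarrow> j \<in> A \<longrightarrow> j < N \<Longrightarrow> N \<le> i \<Longrightarrow> pivot i f = 0"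
  by (rule pivot_eq_0) (rule order_less_le_trans, auto)

lemma pivot_add: "pivot i (f + g) = pivot i f + pivot i g"
proof -
  obtain N where N: "\<forall>A j. coef f A \<noteq> 0 \<longrightarrow> j \<in> A \<longrightarrow> j < N"
      "\<forall>A j. coef g A \<noteq> 0 \<longrightarrow> j \<in> A \<longrightarrow> j < N" "\<forall>A j. coef (f + g) A \<noteq> 0 \<longrightarrow> j \<in> A \<longrightarrow> j < N"
    using letters_bounded3[of f g "f + g"] by blast
  show ?thesis
  proof (rule pivot_induct[where N = N])
    fix i assume "N \<le> i"
    then have "pivot i f = 0" "pivot i g = 0" "pivot i (f + g) = 0"
      by (rule N[THEN pivot_eq_0_bound])+
    then show "pivot i (f + g) = pivot i f + pivot i g" by simp
  next
    fix i assume "pivot (i + 2) (f + g) = pivot (i + 2) f + pivot (i + 2) g"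
    then show "pivot i (f + g) = pivot i f + pivot i g"
      unfolding pivot_rec[of i] by (simp add: glinear_simps[OF glinear_pd] algebra_simps)
  qed
qed

lemma pivot_scale: "pivot i (gscale c f) = gscale c (pivot i f)"
proof -
  obtain N where N: "\<forall>A j. coef f A \<noteq> 0 \<longrightarrow> j \<in> A \<longrightarrow> j < N"
      "\<forall>A j. coef (gscale c f) A \<noteq> 0 \<longrightarrow> j \<in> A \<longrightarrow> j < N"
    using letters_bounded3[of f "gscale c f" f] by blast
  show ?thesis
  proof (rule pivot_induct[where N = N])
    fix i assume "N \<le> i"
    then have "pivot i f = 0" "pivot i (gscale c f) = 0"
      by (rule N[THEN pivot_eq_0_bound])+
    then show "pivot i (gscale c f) = gscale c (pivot i f)" by simp
  next
    fix i assume "pivot (i + 2) (gscale c f) = gscale c (pivot (i + 2) f)"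
    then show "pivot i (gscale c f) = gscale c (pivot i f)"
      unfolding pivot_rec[of i]
      by (simp add: glinear_simps[OF glinear_pd] gscale_mult grass.scale_right_distrib)
  qed
qed

lemma glinear_pivot: "glinear (pivot i)"
  by (intro glinearI pivot_add pivot_scale)

lemma gpart_pivot: "gpart p (pivot i f) = pivot i (gpart (Suc p) f)"
proof -
  obtain N where N: "\<forall>A j. coef f A \<noteq> 0 \<longrightarrow> j \<in> A \<longrightarrow> j < N"
      "\<forall>A j. coef (gpart (Suc p) f) A \<noteq> 0 \<longrightarrow> j \<in> A \<longrightarrow> j < N"
    using letters_bounded3[of f "gpart (Suc p) f" f] by blast
  have *: "gpart (Suc (Suc p)) g = gpart p g" for g :: "'a grass" by (rule gpart_cong) simp
  show ?thesis
  proof (rule pivot_induct[where N = N and P = "\<lambda>i. gpart p (pivot i f) = pivot i (gpart (Suc p) f)"])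
    fix i assume "N \<le> i"
    then have "pivot i f = 0" "pivot i (gpart (Suc p) f) = 0"
      by (rule N[THEN pivot_eq_0_bound])+
    then show "gpart p (pivot i f) = pivot i (gpart (Suc p) f)" by simp
  next
    fix i assume "gpart p (pivot (i + 2) f) = pivot (i + 2) (gpart (Suc p) f)"
    then show "gpart p (pivot i f) = pivot i (gpart (Suc p) f)"
      unfolding pivot_rec[of i] by (simp add: gpart_add gpart_pd mult.assoc gpart_gvar_mult *)
  qed
qed

lemma op_part_pivot: "op_part 1 (pivot i) = pivot i"
  by (intro op_part_oddI glinear_pivot gpart_pivot)

lemma pivot_mult:
  assumes f: "gpart p f = f"
  shows "pivot i (f * g) = pivot i f * g + (-1) ^ p * (f * pivot i g)"
proof -
  obtain N where N: "\<forall>A j. coef f A \<noteq> 0 \<longrightarrow> j \<in> A \<longrightarrow> j < N"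
      "\<forall>A j. coef g A \<noteq> 0 \<longrightarrow> j \<in> A \<longrightarrow> j < N" "\<forall>A j. coef (f * g) A \<noteq> 0 \<longrightarrow> j \<in> A \<longrightarrow> j < N"
    using letters_bounded3[of f g "f * g"] by blast
  show ?thesis
  proof (rule pivot_induct[where N = N and
        P = "\<lambda>i. pivot i (f * g) = pivot i f * g + (-1) ^ p * (f * pivot i g)"])
    fix i assume "N \<le> i"
    then have "pivot i f = 0" "pivot i g = 0" "pivot i (f * g) = 0"
      by (rule N[THEN pivot_eq_0_bound])+
    then show "pivot i (f * g) = pivot i f * g + (-1) ^ p * (f * pivot i g)" by simp
  next
    fix i assume IH: "pivot (i + 2) (f * g) = pivot (i + 2) f * g + (-1) ^ p * (f * pivot (i + 2) g)"
    let ?u = "gvar i * gvar (i + 1) :: 'a grass"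
    have "?u * ((-1) ^ p * (f * h)) = (-1) ^ p * (f * (?u * h))" for h
    proof -
      have "?u * (f * h) = f * (?u * h)"
        by (metis gvar_pair_central mult.assoc)
      then show ?thesis by (cases "even p") simp_all
    qed
    then show "pivot i (f * g) = pivot i f * g + (-1) ^ p * (f * pivot i g)"
      unfolding pivot_rec[of i] IH pd_mult[OF f]
      by (simp add: distrib_left distrib_right mult.assoc)
  qed
qed

lemma odd_superderivation_pivot: "odd_superderivation (pivot i)"
  using glinear_pivot op_part_pivot pivot_mult unfolding odd_superderivation_def by blast

section \<open>Generated Lie superalgebras and their growth\<close>

text \<open>Graded subspaces of the space of linear operators closed under the supercommutator and, in
  characteristic 2, under squares of odd elements.\<close>

definition lie_closed :: "'k::field gop set \<Rightarrow> bool" where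
  "lie_closed L \<longleftrightarrow> gop.subspace L \<and> (\<forall>S\<in>L. glinear S) \<and> (\<forall>S\<in>L. \<forall>p. op_part p S \<in> L) \<and>
    (\<forall>S\<in>L. \<forall>T\<in>L. superbracket S T \<in> L) \<and>
    (CHAR('k) = 2 \<longrightarrow> (\<forall>S\<in>L. op_part 1 S = S \<longrightarrow> S \<circ> S \<in> L))"

definition lie_hull :: "'k::field gop set \<Rightarrow> 'k gop set" where
  "lie_hull X = \<Inter>{L. lie_closed L \<and> X \<subseteq> L}"

text \<open>\<open>lie_monomial G S n\<close>: the operator \<open>S\<close> is the value of an arbitrarily bracketed Lie monomial of
  total weight \<open>n\<close> in the generators, where \<open>G\<close> consists of the pairs of a generator and its weight.
  Length is the special case where all weights are 1.\<close>

inductive lie_monomial :: "('k::field gop \<times> nat) set \<Rightarrow> 'k gop \<Rightarrow> nat \<Rightarrow> bool" for G where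
  generator: "(S, n) \<in> G \<Longrightarrow> lie_monomial G S n"
| bracket: "lie_monomial G S m \<Longrightarrow> lie_monomial G T n \<Longrightarrow> lie_monomial G (superbracket S T) (m + n)"

definition lie_spanning :: "('k::field gop \<times> nat) set \<Rightarrow> nat \<Rightarrow> 'k gop set" where
  "lie_spanning G m = {S. \<exists>n\<le>m. lie_monomial G S n} \<union>
    {S \<circ> S | S. CHAR('k) = 2 \<and> op_part 1 S = S \<and> (\<exists>n. 2 * n \<le> m \<and> lie_monomial G S n)}"

definition lie_filtration :: "('k::field gop \<times> nat) set \<Rightarrow> nat \<Rightarrow> 'k gop set" where
  "lie_filtration G m = gop.span (lie_spanning G m)"

definition lie_growth :: "('k::field gop \<times> nat) set \<Rightarrow> nat \<Rightarrow> nat" where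
  "lie_growth G m = gop.dim (lie_filtration G m)"

definition upper_GKdim :: "(nat \<Rightarrow> nat) \<Rightarrow> ereal" where
  "upper_GKdim \<gamma> = limsup (\<lambda>n. ereal (ln (real (\<gamma> n)) / ln (real n)))"

definition lower_GKdim :: "(nat \<Rightarrow> nat) \<Rightarrow> ereal" where
  "lower_GKdim \<gamma> = liminf (\<lambda>n. ereal (ln (real (\<gamma> n)) / ln (real n)))"

definition R_pivot :: "'k::field gop set" where
  "R_pivot = lie_hull {pivot 0, pivot 1}"

definition R_growth :: "'k::field itself \<Rightarrow> nat \<Rightarrow> nat" where
  "R_growth _ = lie_growth {(pivot 0 :: 'k gop, 1), (pivot 1, 1)}"

definition R_weight_growth :: "'k::field itself \<Rightarrow> nat \<Rightarrow> nat" where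
  "R_weight_growth _ = lie_growth {(pivot 0 :: 'k gop, 1), (pivot 1, 2)}"

subsection \<open>The growth functions count an exhausting filtration by finite-dimensional subspaces\<close>

lemma op_partI:
  assumes S: "glinear S" and "\<And>r f. gpart r (S f) = S (gpart (r + p) f)"
  shows "op_part p S = S"
proof
  fix f
  have "op_part p S f = S (gpart (p + p) (gpart 0 f)) + S (gpart (Suc (p + p)) (gpart (Suc 0) f))"
    by (simp add: op_part_def sum_lessThan_2 assms(2) add.commute)
  also have "gpart (p + p) (gpart 0 f) = gpart 0 f"
    by (rule grass_eqI) (simp add: coef_simps)
  also have "gpart (Suc (p + p)) (gpart (Suc 0) f) = gpart (Suc 0) f"
    by (rule grass_eqI) (simp add: coef_simps)
  also have "S (gpart 0 f) + S (gpart (Suc 0) f) = S f"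
    unfolding glinear_simps(1)[OF S, symmetric] gpart_sum ..
  finally show "op_part p S f = S f" .
qed

lemma gpart_homogeneous:
  assumes S: "glinear S" and p: "op_part p S = S"
  shows "gpart r (S f) = S (gpart (r + p) f)"
proof -
  let ?h = "\<lambda>q. S (gpart q f)"
  have Sf: "S g = gpart p (S (gpart 0 g)) + gpart (Suc p) (S (gpart (Suc 0) g))" for g
    using fun_cong[OF p, of g] by (simp add: op_part_def sum_lessThan_2)
  have 1: "gpart r (S f) = gpart r (gpart p (?h 0)) + gpart r (gpart (Suc p) (?h (Suc 0)))"
    by (subst Sf) (simp only: gpart_add)
  have 2: "S (gpart (r + p) f) = gpart p (S (gpart 0 (gpart (r + p) f))) +
      gpart (Suc p) (S (gpart (Suc 0) (gpart (r + p) f)))"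
    by (rule Sf)
  show ?thesis
  proof (cases "even (r + p)")
    case True
    have "gpart r (?h 0) = gpart p (?h 0)" by (rule gpart_cong) (use True in simp)
    with True show ?thesis unfolding 1 2 gpart_gpart by (simp add: glinear_simps[OF S])
  next
    case False
    have "gpart r (?h (Suc 0)) = gpart (Suc p) (?h (Suc 0))"
      by (rule gpart_cong) (use False in simp)
    with False show ?thesis unfolding 1 2 gpart_gpart by (simp add: glinear_simps[OF S])
  qed
qed

lemma glinear_superbracket:
  assumes "glinear S" "glinear T" shows "glinear (superbracket S T)"
  unfolding superbracket_def sum_lessThan_2
  by (rule glinearI) (simp_all add: glinear_simps[OF glinear_op_part] glinear_simps assms
      gscale_mult grass.scale_right_diff_distrib grass.scale_right_distrib algebra_simps)

lemma op_part_superbracket: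
  assumes "glinear S" "glinear T" "op_part p S = S" "op_part q T = T"
  shows "op_part (p + q) (superbracket S T) = superbracket S T"
proof (rule op_partI)
  fix r f
  have m: "gpart r ((-1) ^ n * g) = (-1) ^ n * gpart r g" for n and g :: "'a grass"
    by (cases "even n") (simp_all add: glinear_simps[OF glinear_gpart])
  show "gpart r (superbracket S T f) = superbracket S T (gpart (r + (p + q)) f)"
    unfolding superbracket_homogeneous[OF assms]
    by (simp add: glinear_simps[OF glinear_gpart] m gpart_homogeneous[OF assms(1,3)]
        gpart_homogeneous[OF assms(2,4)] add.assoc add.commute[of p q])
qed (intro glinear_superbracket assms)

lemma op_part_add: "op_part p (S + T) = op_part p S + op_part p T"
  by (rule ext) (simp add: op_part_def sum_lessThan_2 gpart_add algebra_simps)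

lemma op_part_scale: "op_part p (op_scale c S) = op_scale c (op_part p S)"
  by (rule ext)
    (simp add: op_part_def sum_lessThan_2 op_scale_def gpart_scale grass.scale_right_distrib)

lemma op_part_zero: "op_part p 0 = 0"
  by (rule ext) (simp add: op_part_def)

lemma superbracket_add_left:
  "glinear T \<Longrightarrow> superbracket (S + S') T = superbracket S T + superbracket S' T"
  by (rule ext) (simp add: superbracket_def sum_lessThan_2 op_part_add
      glinear_simps[OF glinear_op_part] algebra_simps)

lemma superbracket_add_right:
  "glinear S \<Longrightarrow> superbracket S (T + T') = superbracket S T + superbracket S T'"
  by (rule ext) (simp add: superbracket_def sum_lessThan_2 op_part_add glinear_simps algebra_simps)

lemma superbracket_scale_left:
  "glinear T \<Longrightarrow> superbracket (op_scale c S) T = op_scale c (superbracket S T)"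
  by (rule ext) (simp add: superbracket_def sum_lessThan_2 op_part_scale op_scale_apply
      glinear_simps[OF glinear_op_part] grass.scale_right_diff_distrib grass.scale_right_distrib)

lemma superbracket_scale_right:
  "glinear S \<Longrightarrow> superbracket S (op_scale c T) = op_scale c (superbracket S T)"
  by (rule ext) (simp add: superbracket_def sum_lessThan_2 op_part_scale op_scale_apply
      glinear_simps grass.scale_right_diff_distrib grass.scale_right_distrib)

lemma superbracket_zero_left: "glinear T \<Longrightarrow> superbracket 0 T = 0"
  by (rule ext) (simp add: superbracket_def sum_lessThan_2 op_part_zero
      glinear_simps[OF glinear_op_part] glinear_simps)

lemma superbracket_zero_right: "glinear S \<Longrightarrow> superbracket S 0 = 0"
  by (rule ext) (simp add: superbracket_def sum_lessThan_2 op_part_zero glinear_simps)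

lemma subspace_glinear: "gop.subspace {S. glinear S}"
proof (rule gop.subspaceI, goal_cases)
  case 1
  show ?case unfolding mem_Collect_eq by (rule glinearI) simp_all
next
  case (2 S T)
  then have "glinear (\<lambda>f. S f + T f)" by (intro glinear_add) simp_all
  then show ?case by (simp add: plus_fun_def)
next
  case (3 c S)
  then show ?case unfolding op_scale_def mem_Collect_eq
    by (intro glinearI)
      (simp_all add: glinear_simps grass.scale_right_distrib mult.commute)
qed

lemma char2_uminus:
  assumes "CHAR('k::field) = 2"
  shows "- f = (f :: 'k grass)"
proof (rule grass_eqI)
  fix A
  have "(1 :: 'k) + 1 = 0" using of_nat_CHAR[where 'a = 'k] assms by simp
  then have "coef f A + coef f A = 0"
    using distrib_right[of 1 1 "coef f A"] by simp
  then show "coef (- f) A = coef f A" by (simp add: coef_simps minus_equation_iff eq_neg_iff_add_eq_0)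
qed

lemma char2_cancel:
  assumes "CHAR('k::field) = 2"
  shows "a + x + (x + b) = a + (b :: 'k grass)"
proof -
  have "x + x = 0" using char2_uminus[OF assms, of x] by (metis ab_left_minus)
  then show ?thesis by (metis add.assoc add.left_neutral)
qed

lemma superbracket_char2:
  assumes "CHAR('k::field) = 2" "glinear S" "glinear (T :: 'k gop)"
  shows "superbracket S T = (S \<circ> T) + (T \<circ> S)"
proof
  fix f
  have m: "(-1) ^ n * g = g" for n and g :: "'k grass"
    using char2_uminus[OF assms(1), of g] by (cases "even n") simp_all
  have minus: "g - h = g + h" for g h :: "'k grass"
    using char2_uminus[OF assms(1), of h] by (metis diff_conv_add_uminus)
  have "(\<Sum>p<2. \<Sum>q<2. (-1) ^ (p * q) * op_part q T (op_part p S f)) =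
      T (op_part 0 S f) + T (op_part (Suc 0) S f)"
    unfolding m sum_lessThan_2 op_part_sum[OF assms(3)] ..
  also have "\<dots> = T (S f)"
    unfolding glinear_simps(1)[OF assms(3), symmetric] op_part_sum[OF assms(2)] ..
  finally show "superbracket S T f = ((S \<circ> T) + (T \<circ> S)) f"
    unfolding superbracket_def minus by simp
qed

lemma superbracket_square_right:
  assumes "CHAR('k::field) = 2" "glinear S" "glinear (T :: 'k gop)"
  shows "superbracket T (S \<circ> S) = superbracket (superbracket T S) S"
proof -
  have SS: "glinear (S \<circ> S)" unfolding comp_def by (rule glinear_compose[OF assms(2) assms(2)])
  have "superbracket (superbracket T S) S = (superbracket T S \<circ> S) + (S \<circ> superbracket T S)"
    by (rule superbracket_char2[OF assms(1) glinear_superbracket[OF assms(3,2)] assms(2)])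
  then show ?thesis
    unfolding superbracket_char2[OF assms(1,3) SS] superbracket_char2[OF assms(1,3,2)]
    by (simp add: fun_eq_iff glinear_simps[OF assms(2)] char2_cancel[OF assms(1)])
qed

lemma superbracket_square_left:
  assumes "CHAR('k::field) = 2" "glinear S" "glinear (T :: 'k gop)"
  shows "superbracket (S \<circ> S) T = superbracket S (superbracket S T)"
proof -
  have SS: "glinear (S \<circ> S)" unfolding comp_def by (rule glinear_compose[OF assms(2) assms(2)])
  have "superbracket S (superbracket S T) = (S \<circ> superbracket S T) + (superbracket S T \<circ> S)"
    by (rule superbracket_char2[OF assms(1,2) glinear_superbracket[OF assms(2,3)]])
  then show ?thesis
    unfolding superbracket_char2[OF assms(1) SS assms(3)] superbracket_char2[OF assms]
    by (simp add: fun_eq_iff glinear_simps[OF assms(2)] char2_cancel[OF assms(1)])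
qed

context
  fixes G :: "('k::field gop \<times> nat) set"
  assumes odd_generators: "\<And>S n. (S, n) \<in> G \<Longrightarrow> glinear S \<and> op_part 1 S = S"
begin

lemma lie_monomial_homogeneous:
  "lie_monomial G S n \<Longrightarrow> glinear S \<and> (\<exists>p. op_part p S = S)"
proof (induction rule: lie_monomial.induct)
  case (generator S n)
  then show ?case using odd_generators by blast
next
  case (bracket S m T n)
  then obtain p q where "op_part p S = S" "op_part q T = T" by blast
  with bracket have "op_part (p + q) (superbracket S T) = superbracket S T"
    by (intro op_part_superbracket) auto
  with bracket show ?case using glinear_superbracket by blast
qed

lemma glinear_lie_spanning: "S \<in> lie_spanning G m \<Longrightarrow> glinear S"
  unfolding lie_spanning_def
proof (elim UnE CollectE exE conjE)
  fix T n assume *: "S = T \<circ> T" "lie_monomial G T n"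
  then have T: "glinear T" using lie_monomial_homogeneous by blast
  show "glinear S" unfolding *(1) comp_def by (rule glinear_compose[OF T T])
qed (use lie_monomial_homogeneous in blast)

lemma glinear_lie_filtration: "S \<in> lie_filtration G m \<Longrightarrow> glinear S"
  using gop.span_minimal[of "lie_spanning G m" "{S. glinear S}"] subspace_glinear
    glinear_lie_spanning unfolding lie_filtration_def by blast

lemma subspace_lie_filtration: "gop.subspace (lie_filtration G m)"
  unfolding lie_filtration_def by (rule gop.subspace_span)

lemma lie_filtration_mono: "m \<le> n \<Longrightarrow> lie_filtration G m \<subseteq> lie_filtration G n"
  unfolding lie_filtration_def
  by (rule gop.span_mono) (force simp: lie_spanning_def intro: order.trans)

lemma lie_monomial_filtration: "lie_monomial G S n \<Longrightarrow> n \<le> m \<Longrightarrow> S \<in> lie_filtration G m"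
  unfolding lie_filtration_def lie_spanning_def by (intro gop.span_base) auto

lemma lie_monomial_bracket_spanning:
  assumes S: "lie_monomial G S m" and T: "T \<in> lie_spanning G n"
  shows "\<exists>k\<le>m + n. lie_monomial G (superbracket S T) k"
  using T unfolding lie_spanning_def
proof (elim UnE CollectE exE conjE)
  fix k assume "k \<le> n" "lie_monomial G T k"
  then show ?thesis using lie_monomial.bracket[OF S] by (meson add_left_mono)
next
  fix U k assume *: "T = U \<circ> U" "CHAR('k) = 2" "2 * k \<le> n" "lie_monomial G U k"
  have "lie_monomial G (superbracket (superbracket S U) U) (m + k + k)"
    by (intro lie_monomial.bracket S *)
  moreover have "superbracket S T = superbracket (superbracket S U) U"
    unfolding *(1) using lie_monomial_homogeneous *(4) S
    by (intro superbracket_square_right *(2)) blast+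
  ultimately show ?thesis using *(3) by (intro exI[of _ "m + k + k"]) simp
qed

lemma lie_spanning_bracket:
  assumes S: "S \<in> lie_spanning G m" and T: "T \<in> lie_spanning G n"
  shows "superbracket S T \<in> lie_filtration G (m + n)"
  using S unfolding lie_spanning_def[of _ m]
proof (elim UnE CollectE exE conjE)
  fix k assume "k \<le> m" "lie_monomial G S k"
  with lie_monomial_bracket_spanning[OF this(2) T] show ?thesis
    by (meson add_right_mono lie_monomial_filtration order.trans)
next
  fix U k assume *: "S = U \<circ> U" "CHAR('k) = 2" "2 * k \<le> m" "lie_monomial G U k"
  obtain l where l: "l \<le> k + n" "lie_monomial G (superbracket U T) l"
    using lie_monomial_bracket_spanning[OF *(4) T] by blast
  have "lie_monomial G (superbracket U (superbracket U T)) (k + l)"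
    by (intro lie_monomial.bracket l *)
  moreover have "superbracket S T = superbracket U (superbracket U T)"
    unfolding *(1) using lie_monomial_homogeneous *(4) glinear_lie_spanning[OF T]
    by (intro superbracket_square_left *(2)) blast+
  ultimately show ?thesis using *(3) l(1) by (auto intro: lie_monomial_filtration)
qed

lemma lie_filtration_bracket:
  assumes S: "S \<in> lie_filtration G m" and T: "T \<in> lie_filtration G n"
  shows "superbracket S T \<in> lie_filtration G (m + n)"
proof -
  note sub = subspace_lie_filtration[of "m + n"]
  have *: "superbracket S T \<in> lie_filtration G (m + n)" if T: "T \<in> lie_spanning G n" for T
  proof -
    have T': "glinear T" using T by (rule glinear_lie_spanning)
    have "gop.subspace {S. superbracket S T \<in> lie_filtration G (m + n)}"
      by (rule gop.subspaceI) (simp_all add: superbracket_zero_left superbracket_add_left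
          superbracket_scale_left T' gop.subspace_0[OF sub] gop.subspace_add[OF sub]
          gop.subspace_scale[OF sub])
    then have "gop.span (lie_spanning G m) \<subseteq> {S. superbracket S T \<in> lie_filtration G (m + n)}"
      by (intro gop.span_minimal) (use lie_spanning_bracket T in blast)+
    then show ?thesis using S unfolding lie_filtration_def[of _ m] by blast
  qed
  have S': "glinear S" using S by (rule glinear_lie_filtration)
  have "gop.subspace {T. superbracket S T \<in> lie_filtration G (m + n)}"
    by (rule gop.subspaceI) (simp_all add: superbracket_zero_right superbracket_add_right
        superbracket_scale_right S' gop.subspace_0[OF sub] gop.subspace_add[OF sub]
        gop.subspace_scale[OF sub])
  then have "gop.span (lie_spanning G n) \<subseteq> {T. superbracket S T \<in> lie_filtration G (m + n)}"
    by (intro gop.span_minimal) (use * in blast)+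
  then show ?thesis using T unfolding lie_filtration_def[of _ n] by blast
qed

lemma lie_spanning_homogeneous:
  assumes "S \<in> lie_spanning G m"
  shows "(\<exists>n\<le>m. lie_monomial G S n) \<and> (\<exists>p. op_part p S = S) \<or> op_part 0 S = S"
  using assms unfolding lie_spanning_def
proof (elim UnE CollectE exE conjE)
  fix U k assume *: "S = U \<circ> U" "op_part 1 U = U" "lie_monomial G U k"
  then have U: "glinear U" using lie_monomial_homogeneous by blast
  have "op_part 0 S = S"
  proof (rule op_partI)
    show "glinear S" unfolding *(1) comp_def by (rule glinear_compose[OF U U])
    have "gpart (Suc (Suc r)) f = gpart r f" for r and f :: "'k grass" by (rule gpart_cong) simp
    then show "gpart r (S f) = S (gpart (r + 0) f)" for r f
      by (simp add: *(1) gpart_homogeneous[OF U *(2)])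
  qed
  then show ?thesis by blast
qed (use lie_monomial_homogeneous in blast)

lemma op_part_cases:
  "glinear S \<Longrightarrow> op_part p S = S \<Longrightarrow> op_part q S = S \<or> op_part q S = 0"
  using op_part_op_part[of S q p] op_part_cong[of q p S] by (metis op_part_op_part)

lemma lie_filtration_op_part:
  assumes "S \<in> lie_filtration G m"
  shows "op_part p S \<in> lie_filtration G m"
proof -
  note sub = subspace_lie_filtration[of m]
  have "gop.subspace {S. op_part p S \<in> lie_filtration G m}"
    by (rule gop.subspaceI) (simp_all add: op_part_zero op_part_add op_part_scale
        gop.subspace_0[OF sub] gop.subspace_add[OF sub] gop.subspace_scale[OF sub])
  moreover have "op_part p S \<in> lie_filtration G m" if S: "S \<in> lie_spanning G m" for S
  proof -
    have "op_part p S = S \<or> op_part p S = 0"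
      using lie_spanning_homogeneous[OF S] op_part_cases[OF glinear_lie_spanning[OF S]] by blast
    moreover have "S \<in> lie_filtration G m" using S unfolding lie_filtration_def
      by (rule gop.span_base)
    ultimately show ?thesis using gop.subspace_0[OF sub] by metis
  qed
  ultimately have "gop.span (lie_spanning G m) \<subseteq> {S. op_part p S \<in> lie_filtration G m}"
    by (intro gop.span_minimal) blast+
  then show ?thesis using assms unfolding lie_filtration_def[of _ m] by blast
qed

lemma lie_filtration_square:
  assumes char2: "CHAR('k) = 2" and S: "S \<in> lie_filtration G m"
  shows "op_part 1 S \<circ> op_part 1 S \<in> lie_filtration G (2 * m)"
proof -
  note sub = subspace_lie_filtration[of m] and sub2 = subspace_lie_filtration[of "2 * m"]
  let ?L = "{S \<in> lie_filtration G m. op_part 1 S \<circ> op_part 1 S \<in> lie_filtration G (2 * m)}"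
  have "gop.subspace ?L"
  proof (rule gop.subspaceI, goal_cases)
    case 1
    have "(0 :: 'k gop) \<circ> (0 :: 'k gop) = 0" by (simp add: fun_eq_iff)
    then show ?case by (simp add: op_part_zero gop.subspace_0[OF sub] gop.subspace_0[OF sub2])
  next
    case (2 S T)
    let ?S = "op_part 1 S" and ?T = "op_part 1 T"
    have lin: "glinear ?S" "glinear ?T"
      using 2 by (auto intro: glinear_op_part glinear_lie_filtration)
    have "(?S + ?T) \<circ> (?S + ?T) = (?S \<circ> ?S) + (?T \<circ> ?T) + superbracket ?S ?T"
      unfolding superbracket_char2[OF char2 lin]
      by (simp add: fun_eq_iff glinear_simps[OF lin(1)] glinear_simps[OF lin(2)] algebra_simps
          del: One_nat_def)
    moreover have "superbracket ?S ?T \<in> lie_filtration G (2 * m)"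
      unfolding mult_2 using 2 by (intro lie_filtration_bracket lie_filtration_op_part) auto
    ultimately show ?case
      using 2 by (simp add: op_part_add gop.subspace_add[OF sub] gop.subspace_add[OF sub2]
          del: One_nat_def)
  next
    case (3 c S)
    have "glinear (op_part 1 S)" using 3 by (auto intro: glinear_op_part glinear_lie_filtration)
    then have "op_scale c (op_part 1 S) \<circ> op_scale c (op_part 1 S) =
        op_scale (c * c) (op_part 1 S \<circ> op_part 1 S)"
      by (simp add: fun_eq_iff op_scale_def glinear_simps del: One_nat_def)
    then show ?case
      using 3 by (simp add: op_part_scale gop.subspace_scale[OF sub] gop.subspace_scale[OF sub2]
          del: One_nat_def)
  qed
  moreover have "S \<in> ?L" if S: "S \<in> lie_spanning G m" for S
  proof -
    have lin: "glinear S" using S by (rule glinear_lie_spanning)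
    have "S \<in> lie_filtration G m" using S unfolding lie_filtration_def by (rule gop.span_base)
    moreover have "op_part 1 S \<circ> op_part 1 S \<in> lie_filtration G (2 * m)"
    proof (cases "op_part 1 S = 0")
      case True
      have "(0 :: 'k gop) \<circ> (0 :: 'k gop) = 0" by (simp add: fun_eq_iff)
      then show ?thesis unfolding True by (simp add: gop.subspace_0[OF sub2])
    next
      case False
      have "op_part 0 S \<noteq> S"
        using False op_part_op_part[OF lin, of 1 0] by auto
      then obtain n p where n: "n \<le> m" "lie_monomial G S n" and p: "op_part p S = S"
        using lie_spanning_homogeneous[OF S] by blast
      have "op_part 1 S = S" using op_part_cases[OF lin p, of 1] False by blast
      then have "S \<circ> S \<in> lie_spanning G (2 * m)"
        unfolding lie_spanning_def using n char2 by (intro UnI2 CollectI exI[of _ S]) auto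
      then show ?thesis
        unfolding \<open>op_part 1 S = S\<close> lie_filtration_def by (rule gop.span_base)
    qed
    ultimately show ?thesis by blast
  qed
  ultimately have "gop.span (lie_spanning G m) \<subseteq> ?L"
    by (intro gop.span_minimal) blast+
  then show ?thesis using S unfolding lie_filtration_def[of _ m] by blast
qed

theorem lie_hull_eq_filtration: "lie_hull (fst ` G) = (\<Union>m. lie_filtration G m)"
proof
  let ?F = "lie_filtration G"
  have "lie_closed (\<Union>m. ?F m)"
    unfolding lie_closed_def
  proof (intro conjI ballI allI impI)
    show "gop.subspace (\<Union>m. ?F m)"
    proof (rule gop.subspaceI)
      show "0 \<in> (\<Union>m. ?F m)" using gop.subspace_0[OF subspace_lie_filtration] by blast
      fix S T assume "S \<in> (\<Union>m. ?F m)" "T \<in> (\<Union>m. ?F m)"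
      then obtain m n where "S \<in> ?F m" "T \<in> ?F n" by blast
      then have "S \<in> ?F (m + n)" "T \<in> ?F (m + n)"
        using lie_filtration_mono[of m "m + n"] lie_filtration_mono[of n "m + n"] by auto
      then show "S + T \<in> (\<Union>m. ?F m)" using gop.subspace_add[OF subspace_lie_filtration] by blast
    next
      fix c S assume "S \<in> (\<Union>m. ?F m)"
      then show "op_scale c S \<in> (\<Union>m. ?F m)"
        using gop.subspace_scale[OF subspace_lie_filtration] by blast
    qed
  next
    fix S assume "S \<in> (\<Union>m. ?F m)" then show "glinear S" using glinear_lie_filtration by blast
  next
    fix S p assume "S \<in> (\<Union>m. ?F m)" then show "op_part p S \<in> (\<Union>m. ?F m)"
      using lie_filtration_op_part by blast
  next
    fix S T assume "S \<in> (\<Union>m. ?F m)" "T \<in> (\<Union>m. ?F m)"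
    then show "superbracket S T \<in> (\<Union>m. ?F m)" using lie_filtration_bracket by blast
  next
    fix S assume "CHAR('k) = 2" "S \<in> (\<Union>m. ?F m)" "op_part 1 S = S"
    then show "S \<circ> S \<in> (\<Union>m. ?F m)" using lie_filtration_square[of S] by (metis UN_iff UNIV_I)
  qed
  moreover have "fst ` G \<subseteq> (\<Union>m. ?F m)"
    using lie_monomial_filtration[OF lie_monomial.generator] by force
  ultimately show "lie_hull (fst ` G) \<subseteq> (\<Union>m. ?F m)"
    unfolding lie_hull_def by blast
next
  show "(\<Union>m. lie_filtration G m) \<subseteq> lie_hull (fst ` G)"
    unfolding lie_hull_def
  proof (intro UN_least Inter_greatest)
    fix L m assume "L \<in> {L. lie_closed L \<and> fst ` G \<subseteq> L}"
    then have L: "lie_closed L" "fst ` G \<subseteq> L" by blast+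
    have mon: "S \<in> L" if "lie_monomial G S n" for S n
      using that
    proof (induction rule: lie_monomial.induct)
      case (generator S n)
      then show ?case using L(2) by force
    next
      case (bracket S m T n)
      then show ?case using L(1) unfolding lie_closed_def by blast
    qed
    have "lie_spanning G m \<subseteq> L"
      using mon L(1) unfolding lie_spanning_def lie_closed_def by auto
    then show "lie_filtration G m \<subseteq> L"
      using L(1) unfolding lie_filtration_def lie_closed_def by (intro gop.span_minimal) auto
  qed
qed

end

theorem R_pivot_eq_filtration:
  "R_pivot = (\<Union>m. lie_filtration {(pivot 0 :: 'k::field gop, 1), (pivot 1, w)} m)"
  using lie_hull_eq_filtration[of "{(pivot 0 :: 'k gop, 1), (pivot 1, w)}"]
    glinear_pivot op_part_pivot unfolding R_pivot_def by auto

lemma finite_lie_monomials: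
  assumes "finite G" "\<And>S n. (S, n) \<in> G \<Longrightarrow> 0 < n"
  shows "finite {S. \<exists>n\<le>m. lie_monomial G S n}"
proof (induction m)
  case 0
  have pos: "lie_monomial G S n \<Longrightarrow> 0 < n" for S n
    by (induction rule: lie_monomial.induct) (use assms(2) in auto)
  then have "{S. \<exists>n\<le>0. lie_monomial G S n} = {}" by force
  then show ?case by (simp only: finite.emptyI)
next
  case (Suc m)
  have pos: "lie_monomial G S n \<Longrightarrow> 0 < n" for S n
    by (induction rule: lie_monomial.induct) (use assms(2) in auto)
  let ?M = "{S. \<exists>n\<le>m. lie_monomial G S n}"
  have "{S. \<exists>n\<le>Suc m. lie_monomial G S n} \<subseteq> fst ` G \<union> (\<lambda>(S, T). superbracket S T) ` (?M \<times> ?M)"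
  proof
    fix S assume "S \<in> {S. \<exists>n\<le>Suc m. lie_monomial G S n}"
    then obtain n where "n \<le> Suc m" "lie_monomial G S n" by blast
    from this(2,1) show "S \<in> fst ` G \<union> (\<lambda>(S, T). superbracket S T) ` (?M \<times> ?M)"
    proof cases
      case generator
      then show ?thesis by force
    next
      case (bracket S1 n1 T1 n2)
      then have "n1 \<le> m" "n2 \<le> m"
        using pos[of S1 n1] pos[of T1 n2] \<open>n \<le> Suc m\<close> by auto
      with bracket show ?thesis by blast
    qed
  qed
  then show ?case using Suc assms(1) by (meson finite_SigmaI finite_UnI finite_imageI finite_subset)
qed

lemma finite_lie_spanning:
  fixes G :: "('k::field gop \<times> nat) set"
  assumes "finite G" "\<And>S n. (S, n) \<in> G \<Longrightarrow> 0 < n"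
  shows "finite (lie_spanning G m)"
proof -
  have "lie_spanning G m \<subseteq> {S. \<exists>n\<le>m. lie_monomial G S n} \<union>
      (\<lambda>S. S \<circ> S) ` {S. \<exists>n\<le>m. lie_monomial G S n}"
    unfolding lie_spanning_def by force
  then show ?thesis using finite_lie_monomials[OF assms] by (simp add: finite_subset)
qed

end

theory Submission
  imports Defs "HOL-Library.Nat_Bijection" "HOL-Real_Asymp.Real_Asymp"
begin

text \<open>Up to scalars, every Lie monomial in $v_0, v_1$ is a tail monomial $x_A v_n$ with all
  letters of \<open>A\<close> below \<open>n\<close>. The bracket of two pivot elements is
  $[v_n, v_m] = \pm x_n \cdots x_{m-1} v_{m+1}$ for $m - n > 0$ odd and
  $\pm 2 x_n \cdots x_{m-1} x_{m+1} v_{m+2}$ for $m - n \ge 0$ even, so brackets only produce tail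
  monomials of two kinds: all letters of \<open>A\<close> are at most $n - 2$, or \<open>A\<close> contains $n - 1$ and all
  other letters are at most $n - 3$. Conversely, bracketing with $v_{n-1}$ builds up
  $x_0 \cdots x_{n-2} v_n$, and bracketing with $v_i$, where $i \in A$, removes the letter $x_i$, so
  all of them (except $x_0 v_1$ and $x_0 x_2 v_3$, and in characteristic 2 except most of the second
  kind) are reached. The coefficient of $x_A$ in the image of $x_n$ is a dual basis.

  Both degrees are of the form $d_n - \sum_{i \in A} d_i$ with $d_{n+2} = d_{n+1} + 2 d_n$. For the
  weight, $d_n = 2^n$, and by binary expansion each kind contains each weight once, up to the
  exceptions. The length \<open>l\<close> satisfies $|3 l - 2 w| \le n + 1 = O(\log w)$, where \<open>w\<close> is the
  weight, so the ordinary growth is asymptotic to the weight growth at $3m/2$.\<close>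

section \<open>Monomials of the Grassmann algebra\<close>

text \<open>Parities add under multiplication, so left multiplication by g is an operator of parity
  p. This is the form that \<open>op_partI\<close> asks for.\<close>

lemma gpart_mult_left:
  assumes "gpart p g = g"
  shows "gpart r (g * f) = g * gpart (r + p) f"
proof (rule grass_eqI)
  fix C
  show "coef (gpart r (g * f)) C = coef (g * gpart (r + p) f) C"
  proof (cases "finite C")
    case True
    have "coef (g * gpart (r + p) f) C = (\<Sum>A\<in>Pow C. if even (card C + r)
        then shuffle_sign A (C - A) * (coef g A * coef f (C - A)) else 0)"
      unfolding times_grass.rep_eq
    proof (intro sum.cong refl)
      fix A assume A: "A \<in> Pow C"
      then have "finite A" "card A \<le> card C" "card (C - A) = card C - card A"
        using True by (auto intro: finite_subset card_mono card_Diff_subset)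
      moreover have "coef g A \<noteq> 0 \<Longrightarrow> even (card A + p)"
        using assms by (metis gpart.rep_eq)
      ultimately have "coef g A \<noteq> 0 \<Longrightarrow> even (card (C - A) + (r + p)) \<longleftrightarrow> even (card C + r)"
        by auto
      then show "shuffle_sign A (C - A) * (coef g A * coef (gpart (r + p) f) (C - A)) =
          (if even (card C + r) then shuffle_sign A (C - A) * (coef g A * coef f (C - A)) else 0)"
        by (cases "coef g A = 0") (simp_all add: gpart.rep_eq)
    qed
    then show ?thesis by (simp add: gpart.rep_eq times_grass.rep_eq)
  qed (simp add: coef_infinite)
qed

lemma gpart_gmon: "gpart (card A) (gmon A) = gmon A"
  by (rule grass_eqI) (simp add: coef_simps)

lemma shuffle_sign_nonzero: "shuffle_sign A B \<noteq> (0 :: 'k::field)"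
  by (simp add: shuffle_sign_def)

lemma gmon_mult:
  assumes "finite A" "finite B"
  shows "gmon A * gmon B =
    (if A \<inter> B = {} then gscale (shuffle_sign A B) (gmon (A \<union> B)) else 0)"
proof (rule grass_eqI)
  fix C
  show "coef (gmon A * gmon B) C =
    coef (if A \<inter> B = {} then gscale (shuffle_sign A B) (gmon (A \<union> B)) else 0) C"
  proof (cases "finite C")
    case True
    have "coef (gmon A * gmon B) C =
        (\<Sum>X\<in>Pow C. if X = A then (if C - A = B then shuffle_sign A B else 0) else 0)"
      unfolding times_grass.rep_eq using assms by (intro sum.cong) (auto simp: coef_simps)
    also have "\<dots> = (if A \<subseteq> C \<and> C - A = B then shuffle_sign A B else 0)"
      using True by simp
    also have "A \<subseteq> C \<and> C - A = B \<longleftrightarrow> A \<inter> B = {} \<and> C = A \<union> B" by auto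
    finally show ?thesis using assms by (cases "A \<inter> B = {}") (simp_all add: coef_simps)
  qed (simp add: coef_infinite)
qed

text \<open>Fixes a monomial only up to a nonzero scalar: dimensions depend on the sets of letters,
  so signs need not be followed.\<close>

definition is_mon :: "'k::field grass \<Rightarrow> nat set \<Rightarrow> bool" where
  "is_mon f A \<longleftrightarrow> finite A \<and> (\<exists>c. c \<noteq> 0 \<and> f = gscale c (gmon A))"

lemma is_monE:
  assumes "is_mon f A"
  obtains c where "finite A" "c \<noteq> 0" "f = gscale c (gmon A)"
  using assms unfolding is_mon_def by blast

lemma is_mon_gmon: "finite A \<Longrightarrow> is_mon (gmon A) A"
  unfolding is_mon_def by (auto intro!: exI[of _ 1])

lemma is_mon_gvar: "is_mon (gvar i) {i}"
  unfolding gvar_def by (rule is_mon_gmon) simp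

lemma is_mon_scale: "is_mon f A \<Longrightarrow> c \<noteq> 0 \<Longrightarrow> is_mon (gscale c f) A"
  unfolding is_mon_def by (auto intro: exI[of _ "c * _"])

lemma sign_mult: "(-1) ^ n * f = gscale ((-1) ^ n) (f :: 'k::field grass)"
  by (cases "even n") (auto intro!: grass_eqI simp: coef_simps)

lemma is_mon_sign: "is_mon f A \<Longrightarrow> is_mon ((-1) ^ n * f) A"
  unfolding sign_mult by (rule is_mon_scale) simp_all

lemma is_mon_uminus: "is_mon f A \<Longrightarrow> is_mon (- f) A"
  using is_mon_sign[of f A 1] by simp

lemma is_mon_mult: "is_mon f A \<Longrightarrow> is_mon g B \<Longrightarrow> A \<inter> B = {} \<Longrightarrow> is_mon (f * g) (A \<union> B)"
  by (elim is_monE) (simp add: gscale_mult gmon_mult is_mon_scale is_mon_gmon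
      shuffle_sign_nonzero)

lemma is_mon_mult_zero: "is_mon f A \<Longrightarrow> is_mon g B \<Longrightarrow> A \<inter> B \<noteq> {} \<Longrightarrow> f * g = 0"
  by (elim is_monE) (simp add: gscale_mult gmon_mult)

lemma coef_is_mon: "is_mon f A \<Longrightarrow> coef f C \<noteq> 0 \<longleftrightarrow> C = A"
  by (elim is_monE) (auto simp: coef_simps)

section \<open>Partial derivatives of monomials and their anticommutation\<close>

lemma pd_gmon:
  assumes "finite A"
  shows "pd i (gmon A) =
    (if i \<in> A then gscale ((-1) ^ card {a \<in> A. a < i}) (gmon (A - {i})) else 0)"
proof (rule grass_eqI)
  fix C
  have "{a \<in> A - {i}. a < i} = {a \<in> A. a < i}" by auto
  moreover have "i \<notin> C \<Longrightarrow> insert i C = A \<longleftrightarrow> i \<in> A \<and> C = A - {i}" by auto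
  ultimately show "coef (pd i (gmon A)) C = coef (if i \<in> A
      then gscale ((-1) ^ card {a \<in> A. a < i}) (gmon (A - {i})) else 0) C"
    using assms by (auto simp: pd.rep_eq coef_simps)
qed

lemma pd_pd: "pd i (pd i f) = 0"
  by (rule grass_eqI) (simp add: pd.rep_eq coef_simps)

lemma pd_pd_anticommute:
  assumes "i < j"
  shows "pd i (pd j f) = - pd j (pd i f)"
proof (rule grass_eqI)
  fix A
  show "coef (pd i (pd j f)) A = coef (- pd j (pd i f)) A"
  proof (cases "finite A \<and> i \<notin> A \<and> j \<notin> A")
    case True
    have "{a \<in> insert i A. a < j} = insert i {a \<in> A. a < j}"
      and "{a \<in> insert j A. a < i} = {a \<in> A. a < i}"
      using assms by auto
    with True assms show ?thesis
      by (simp add: pd.rep_eq coef_simps insert_commute[of j i])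
  next
    case False
    then show ?thesis using coef_infinite[of A "pd i (pd j f)"] coef_infinite[of A "- pd j (pd i f)"]
      by (auto simp: pd.rep_eq coef_simps)
  qed
qed

section \<open>Relations between the pivot elements\<close>

lemma pivot_gvar_less: "j < i \<Longrightarrow> pivot i (gvar j) = 0"
  by (rule pivot_eq_0) (auto simp: gvar_def coef_simps split: if_splits)

lemma pivot_gvar_self: "pivot i (gvar i) = 1"
  by (subst pivot_rec) (simp add: pd_gvar pivot_gvar_less)

lemma odd_superderivation_gvar_mult:
  "odd_superderivation D \<Longrightarrow> D (gvar i * f) = D (gvar i) * f - gvar i * D f"
  using gpart_gvar[of i] unfolding odd_superderivation_def by (metis (no_types, lifting)
      add_uminus_conv_diff mult_minus_left mult_1 power_one_right)

lemmas pd_gvar_mult = odd_superderivation_gvar_mult[OF odd_superderivation_pd]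
lemmas pivot_gvar_mult = odd_superderivation_gvar_mult[OF odd_superderivation_pivot]
lemmas pivot_linear = glinear_simps[OF glinear_pivot]
lemmas pd_linear = glinear_simps[OF glinear_pd]

lemma gvar_gvar_mult: "gvar i * (gvar i * f) = 0"
  by (simp add: mult.assoc[symmetric] gvar_square)

text \<open>$v_m$ involves only letters and derivatives of index at least m > n, and
  \<open>pd n\<close> passes $x_i x_{i+1}$ with two sign changes. The downward induction starts
  above all letters of f and of \<open>pd n f\<close>.\<close>

lemma pivot_pd_anticommute:
  assumes "n < m"
  shows "pivot m (pd n f) = - pd n (pivot m f)"
proof -
  obtain N where N: "\<forall>A j. coef f A \<noteq> 0 \<longrightarrow> j \<in> A \<longrightarrow> j < N"
      "\<forall>A j. coef (pd n f) A \<noteq> 0 \<longrightarrow> j \<in> A \<longrightarrow> j < N"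
    using letters_bounded3[of f "pd n f" f] by blast
  have "n < m \<longrightarrow> pivot m (pd n f) = - pd n (pivot m f)"
  proof (rule pivot_induct[where N = N and
        P = "\<lambda>m. n < m \<longrightarrow> pivot m (pd n f) = - pd n (pivot m f)"])
    fix i assume "N \<le> i"
    then have "pivot i f = 0" "pivot i (pd n f) = 0" by (rule N[THEN pivot_eq_0_bound])+
    then show "n < i \<longrightarrow> pivot i (pd n f) = - pd n (pivot i f)" by (simp add: pd_linear)
  next
    fix i assume IH: "n < i + 2 \<longrightarrow> pivot (i + 2) (pd n f) = - pd n (pivot (i + 2) f)"
    show "n < i \<longrightarrow> pivot i (pd n f) = - pd n (pivot i f)"
      unfolding pivot_rec[of i] using IH
      by (auto simp: pd_pd_anticommute pd_linear mult.assoc pd_gvar_mult pd_gvar)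
  qed
  with assms show ?thesis by blast
qed

section \<open>Supercommutators of pivot elements; these are anticommutators, as pivot elements are
  odd\<close>

definition acomm :: "nat \<Rightarrow> nat \<Rightarrow> 'k::field gop" where
  "acomm n m f = pivot n (pivot m f) + pivot m (pivot n f)"

text \<open>In $v_n = \<open>pd n\<close> + x_n x_{n+1} v_{n+2}$ the first summand anticommutes with
  $v_m$. Moving $v_m$ past $x_n x_{n+1}$ costs only the term with $v_m(x_{n+1})$, because $v_m(x_n)
  = 0$.\<close>

lemma acomm_rec:
  assumes "n < m"
  shows "acomm n m f =
    gvar n * (gvar (n + 1) * acomm (n + 2) m f - pivot m (gvar (n + 1)) * pivot (n + 2) f)"
  unfolding acomm_def pivot_rec[of n] using assms
  by (simp add: pivot_linear pivot_pd_anticommute mult.assoc pivot_gvar_mult pivot_gvar_less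
      algebra_simps del: pivot.simps)

lemma gvar_left_anticommute: "gvar i * (gvar j * f) = - (gvar j * (gvar i * f))"
proof -
  have "gvar i * (gvar j * f) = (gvar i * gvar j) * f" by (simp add: mult.assoc)
  also have "\<dots> = - (gvar j * (gvar i * f))"
    by (subst gvar_anticommute) (simp add: mult.assoc)
  finally show ?thesis .
qed

lemma gvar_gvar_gvar_mult: "gvar i * (gvar j * (gvar i * f)) = 0"
  by (subst gvar_left_anticommute) (simp add: gvar_gvar_mult)

text \<open>Both summands of $v_n$ square to zero, the second because $x_n$ is repeated. Of the
  mixed terms only the one where \<open>pd n\<close> hits $x_n$ survives.\<close>

lemma pivot_pivot: "pivot n (pivot n f) = gvar (n + 1) * pivot (n + 2) f"
  unfolding pivot_rec[of n]
  by (simp add: pivot_linear pd_linear pd_pd mult.assoc pd_gvar_mult pd_gvar pivot_gvar_mult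
      pivot_gvar_less pivot_pd_anticommute gvar_gvar_mult gvar_gvar_gvar_mult algebra_simps)

text \<open>For k > 0, $v_{n+2k}$ kills $x_{n+1}$, so \<open>acomm_rec\<close> peels off $x_n
  x_{n+1}$ and raises n by 2; the base case is $2 v_n^2$. Keeping 2 as a scalar of the field covers
  characteristic 2, where these brackets vanish.\<close>

lemma acomm_even:
  "\<exists>g. is_mon g ({n..<n + 2 * k} \<union> {n + 2 * k + 1}) \<and>
    (\<forall>f. acomm n (n + 2 * k) f = gscale (2 :: 'k::field) (g * pivot (n + 2 * k + 2) f))"
proof (induction k arbitrary: n)
  case 0
  have "gscale 2 f = f + f" for f :: "'k grass"
    using grass.scale_left_distrib[of 1 1 f] by simp
  then have "acomm n n f = gscale 2 (gvar (n + 1) * pivot (n + 2) f)" for f :: "'k grass"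
    unfolding acomm_def pivot_pivot by simp
  then show ?case using is_mon_gvar[of "n + 1"] by (intro exI[of _ "gvar (n + 1)"]) simp
next
  case (Suc k)
  obtain g where g: "is_mon g ({n + 2..<n + 2 + 2 * k} \<union> {n + 2 + 2 * k + 1})"
    "\<And>f. acomm (n + 2) (n + 2 + 2 * k) f = gscale (2 :: 'k) (g * pivot (n + 2 + 2 * k + 2) f)"
    using Suc.IH[of "n + 2"] by blast
  have "is_mon (gvar n * (gvar (n + 1) * g))
      ({n} \<union> ({n + 1} \<union> ({n + 2..<n + 2 + 2 * k} \<union> {n + 2 + 2 * k + 1})))"
    by (intro is_mon_mult is_mon_gvar g) auto
  also have "{n} \<union> ({n + 1} \<union> ({n + 2..<n + 2 + 2 * k} \<union> {n + 2 + 2 * k + 1})) =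
      {n..<n + 2 * Suc k} \<union> {n + 2 * Suc k + 1}" by auto
  finally have "is_mon (gvar n * (gvar (n + 1) * g)) \<dots>" .
  moreover have "acomm n (n + 2 * Suc k) f =
      gscale 2 (gvar n * (gvar (n + 1) * g) * pivot (n + 2 * Suc k + 2) f)" for f
    using g(2)[of f] acomm_rec[of n "n + 2 * Suc k" f]
    by (simp add: pivot_gvar_less gscale_mult mult.assoc)
  ultimately show ?case by blast
qed

text \<open>The same recursion, ending at $[v_n, v_{n+1}] = -x_n v_{n+2}$, which stems from
  $v_{n+1}(x_{n+1}) = 1$.\<close>

lemma acomm_odd:
  "\<exists>g :: 'k::field grass. is_mon g {n..<n + 2 * k + 1} \<and>
    (\<forall>f. acomm n (n + 2 * k + 1) f = g * pivot (n + 2 * k + 2) f)"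
proof (induction k arbitrary: n)
  case 0
  have "acomm n (n + 1) f = - gvar n * pivot (n + 2) f" for f :: "'k grass"
  proof -
    \<comment> \<open>By symmetry this is $x_{n+1} [v_{n+1}, v_{n+2}] f$, and
      \<open>acomm_rec\<close> exhibits another left factor $x_{n+1}$.\<close>
    have "gvar (n + 1) * acomm (n + 2) (n + 1) f = gvar (n + 1) * acomm (n + 1) (n + 2) f"
      by (simp add: acomm_def add.commute)
    also have "\<dots> = 0" by (subst acomm_rec) (simp, simp only: gvar_gvar_mult)
    finally show ?thesis using acomm_rec[of n "n + 1" f] by (simp add: pivot_gvar_self)
  qed
  then show ?case using is_mon_uminus[OF is_mon_gvar[of n]]
    by (intro exI[of _ "- gvar n"]) simp
next
  case (Suc k)
  obtain g :: "'k grass" where g: "is_mon g {n + 2..<n + 2 + 2 * k + 1}"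
    "\<And>f. acomm (n + 2) (n + 2 + 2 * k + 1) f = g * pivot (n + 2 + 2 * k + 2) f"
    using Suc.IH[of "n + 2"] by blast
  have "is_mon (gvar n * (gvar (n + 1) * g)) ({n} \<union> ({n + 1} \<union> {n + 2..<n + 2 + 2 * k + 1}))"
    by (intro is_mon_mult is_mon_gvar g) auto
  also have "{n} \<union> ({n + 1} \<union> {n + 2..<n + 2 + 2 * k + 1}) = {n..<n + 2 * Suc k + 1}" by auto
  finally have "is_mon (gvar n * (gvar (n + 1) * g)) \<dots>" .
  moreover have "acomm n (n + 2 * Suc k + 1) f =
      gvar n * (gvar (n + 1) * g) * pivot (n + 2 * Suc k + 2) f" for f
    using g(2)[of f] acomm_rec[of n "n + 2 * Suc k + 1" f]
    by (simp add: pivot_gvar_less mult.assoc)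
  ultimately show ?case by blast
qed

text \<open>In $v_n$ the derivative \<open>pd j\<close>, with j - n even, carries the factor $x_n
  ... x_{j-1}$. Hence only the least letter j of B from n on can contribute, and it is replaced by
  $x_n ... x_{j-1}$. Recording \<open>n \<notin> B\<close> in the zero case ensures a nonzero value
  whenever n is a letter of B.\<close>

lemma pivot_gmon:
  fixes B n
  defines "g \<equiv> gmon B :: 'k::field grass"
  assumes B: "finite B"
  shows "pivot n g = 0 \<and> n \<notin> B \<or>
    (\<exists>j\<in>B. n \<le> j \<and> even (j - n) \<and> {n..<j} \<inter> B = {} \<and>
      is_mon (pivot n g) (B - {j} \<union> {n..<j}))"
    (is "?P n")
proof -
  obtain N where N: "B \<subseteq> {..<N}" using B finite_nat_iff_bounded by blast
  show "?P n"
  proof (rule pivot_induct[where N = N and P = ?P])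
    fix n assume n: "N \<le> n"
    have "pivot n g = 0"
      using N n by (intro pivot_eq_0) (auto simp: g_def coef_simps split: if_splits)
    then show "?P n" using N n by auto
  next
    fix n assume IH: "?P (n + 2)"
    let ?v = "gvar n * (gvar (n + 1) * pivot (n + 2) g)"
    have rec: "pivot n g = pd n g + ?v" by (subst pivot_rec) (simp add: mult.assoc)
    show "?P n"
    proof (cases "n \<in> B \<or> n + 1 \<in> B \<or> pivot (n + 2) g = 0")
      case True
      \<comment> \<open>Applying $v_{n+2}$ changes no letter below n + 2, so a letter n or n + 1 of
        B meets its own copy in the factor $x_n x_{n+1}$.\<close>
      have "gvar n * (gvar (n + 1) * pivot (n + 2) g) = 0"
      proof (cases "pivot (n + 2) g = 0")
        case False
        then obtain j where j: "is_mon (pivot (n + 2) g) (B - {j} \<union> {n + 2..<j})" "n + 2 \<le> j"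
          using IH by blast
        consider "n \<in> B" | "n + 1 \<in> B" using True False by blast
        then show ?thesis
        proof cases
          case 1
          have "gvar n * pivot (n + 2) g = 0"
            using 1 j(2) by (intro is_mon_mult_zero[OF is_mon_gvar j(1)]) auto
          then show ?thesis
            by (subst gvar_left_anticommute) simp
        next
          case 2
          have "gvar (n + 1) * pivot (n + 2) g = 0"
            using 2 j(2) by (intro is_mon_mult_zero[OF is_mon_gvar j(1)]) auto
          then show ?thesis by simp
        qed
      qed simp
      then have "pivot n g = pd n g" unfolding rec by simp
      then show ?thesis unfolding g_def pd_gmon[OF B]
        using B by (auto intro!: bexI[of _ n] is_mon_scale is_mon_gmon)
    next
      case False
      then obtain j where j: "j \<in> B" "n + 2 \<le> j" "even (j - (n + 2))" "{n + 2..<j} \<inter> B = {}"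
        "is_mon (pivot (n + 2) g) (B - {j} \<union> {n + 2..<j})"
        using IH by blast
      have "is_mon ?v ({n} \<union> ({n + 1} \<union> (B - {j} \<union> {n + 2..<j})))"
        by (intro is_mon_mult is_mon_gvar j) (use False in auto)
      also have "{n} \<union> ({n + 1} \<union> (B - {j} \<union> {n + 2..<j})) = B - {j} \<union> {n..<j}"
        using j(2) by auto
      finally have "is_mon ?v (B - {j} \<union> {n..<j})" .
      moreover have "pd n g = 0" unfolding g_def pd_gmon[OF B] using False by simp
      ultimately have "is_mon (pivot n g) (B - {j} \<union> {n..<j})"
        unfolding rec \<open>pd n g = 0\<close> by simp
      moreover have "{n..<j} = {n, n + 1} \<union> {n + 2..<j}" using j(2) by auto
      moreover have "even (j - n)"
      proof -
        have "j - n = (j - (n + 2)) + 2" using j(2) by simp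
        then show ?thesis using j(3) by simp
      qed
      ultimately show ?thesis using j False by (intro disjI2 bexI[of _ j]) auto
    qed
  qed
qed

section \<open>Brackets of tail monomials\<close>

lemma shuffle_sign_swap:
  assumes "finite A" "finite B" "A \<inter> B = {}"
  shows "shuffle_sign B A = (-1) ^ (card A * card B) * (shuffle_sign A B :: 'k::comm_ring_1)"
proof -
  let ?X = "{(a, b). a \<in> A \<and> b \<in> B \<and> b < a}" and ?Y = "{(a, b). a \<in> A \<and> b \<in> B \<and> a < b}"
  have "{(b, a). b \<in> B \<and> a \<in> A \<and> a < b} = prod.swap ` ?Y" by auto
  then have Y: "card {(b, a). b \<in> B \<and> a \<in> A \<and> a < b} = card ?Y"
    by (simp add: card_image)
  have fin: "finite ?X" "finite ?Y"
    using assms by (auto intro: finite_subset[of _ "A \<times> B"])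
  \<comment> \<open>Each pair is inverted in exactly one of the two orders, so the two inversion
    numbers add up to the size of the product.\<close>
  have "A \<times> B = ?X \<union> ?Y" using assms(3) by (auto simp: neq_iff)
  then have "card A * card B = card ?X + card ?Y"
    using fin card_cartesian_product[of A B] card_Un_disjoint[of ?X ?Y] by force
  then show ?thesis
    unfolding shuffle_sign_def Y by (simp add: power_add[symmetric] minus_one_power_iff)
qed

lemma grass_supercommute:
  assumes g: "gpart p g = g" and h: "gpart q h = h"
  shows "h * g = (-1) ^ (p * q) * (g * h :: 'k::field grass)"
proof (rule grass_eqI)
  fix C
  show "coef (h * g) C = coef ((-1) ^ (p * q) * (g * h)) C"
  proof (cases "finite C")
    case C: True
    have "coef (h * g) C =
        (\<Sum>A\<in>Pow C. shuffle_sign (C - A) A * (coef h (C - A) * coef g A))"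
      unfolding times_grass.rep_eq
      by (rule sum.reindex_bij_witness[of _ "\<lambda>A. C - A" "\<lambda>A. C - A"])
        (auto simp: double_diff)
    also have "\<dots> =
        (\<Sum>A\<in>Pow C. (-1) ^ (p * q) * (shuffle_sign A (C - A) * (coef g A * coef h (C - A))))"
    proof (intro sum.cong refl)
      fix A assume "A \<in> Pow C"
      then have fin: "finite A" "finite (C - A)" using C by (auto intro: finite_subset)
      have "coef g A \<noteq> 0 \<Longrightarrow> even (card A + p)" "coef h (C - A) \<noteq> 0 \<Longrightarrow> even (card (C - A) + q)"
        using g h by (metis gpart.rep_eq)+
      then have "coef g A \<noteq> 0 \<Longrightarrow> coef h (C - A) \<noteq> 0 \<Longrightarrow>
          (-1) ^ (card A * card (C - A)) = ((-1) ^ (p * q) :: 'k)"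
        by (simp add: minus_one_power_iff)
      moreover have "shuffle_sign (C - A) A =
          (-1) ^ (card A * card (C - A)) * (shuffle_sign A (C - A) :: 'k)"
        using fin by (intro shuffle_sign_swap) auto
      ultimately show "shuffle_sign (C - A) A * (coef h (C - A) * coef g A) =
          (-1) ^ (p * q) * (shuffle_sign A (C - A) * (coef g A * coef h (C - A)))"
        by (cases "coef g A = 0 \<or> coef h (C - A) = 0") auto
    qed
    finally show ?thesis
      by (simp add: sign_mult coef_simps times_grass.rep_eq sum_distrib_left)
  qed (simp add: coef_infinite)
qed

text \<open>The Leibniz rule expands D(hE) and E(gD); after commuting h past g, the two second-order
  terms combine to the bracket of D and E. The operator gD has parity \<open>Suc p\<close>.\<close>

lemma superbracket_mult_superderivation:
  assumes D: "odd_superderivation D" and E: "odd_superderivation E"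
    and g: "gpart p g = g" and h: "gpart q h = h"
  shows "superbracket (\<lambda>f. g * D f) (\<lambda>f. h * E f) =
    (\<lambda>f. g * D h * E f - (-1) ^ (Suc p * Suc q) * (h * E g * D f) +
      (-1) ^ q * (g * h * (D (E f) + E (D f))))"
proof -
  have lin: "glinear D" "glinear E" and odd: "op_part 1 D = D" "op_part 1 E = E"
    using D E unfolding odd_superderivation_def by blast+
  have hom: "op_part (Suc r) (\<lambda>f. k * F f) = (\<lambda>f. k * F f)"
    if "glinear F" "op_part 1 F = F" "gpart r k = k" for F :: "'a gop" and k r
  proof (rule op_partI)
    show "glinear (\<lambda>f. k * F f)" using that by (intro glinear_mult)
    show "gpart s (k * F f) = k * F (gpart (s + Suc r) f)" for s f
      by (simp add: gpart_mult_left[OF that(3)] gpart_homogeneous[OF that(1,2)])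
  qed
  have DE: "D (h * E f) = D h * E f + (-1) ^ q * (h * D (E f))"
    and ED: "E (g * D f) = E g * D f + (-1) ^ p * (g * E (D f))" for f
    using D E g h unfolding odd_superderivation_def by blast+
  have hg: "h * (g * k) = (-1) ^ (p * q) * (g * (h * k))" for k
    using grass_supercommute[OF g h] by (metis mult.assoc)
  show ?thesis
    unfolding superbracket_homogeneous[OF glinear_mult[OF lin(1)] glinear_mult[OF lin(2)]
        hom[OF lin(1) odd(1) g] hom[OF lin(2) odd(2) h]] DE ED
    by (cases "even p"; cases "even q") (simp_all add: hg algebra_simps)
qed

section \<open>Tail monomials and their brackets\<close>

definition tail_mon :: "nat set \<Rightarrow> nat \<Rightarrow> 'k::field gop" where
  "tail_mon A n = (\<lambda>f. gmon A * pivot n f)"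

lemma glinear_tail_mon: "glinear (tail_mon A n)"
  unfolding tail_mon_def by (intro glinear_mult glinear_pivot)

lemma op_part_tail_mon: "op_part (Suc (card A)) (tail_mon A n) = tail_mon A n"
proof (rule op_partI[OF glinear_tail_mon])
  show "gpart r (tail_mon A n f) = tail_mon A n (gpart (r + Suc (card A)) f)" for r f
    by (simp add: tail_mon_def gpart_mult_left[OF gpart_gmon] gpart_pivot)
qed

lemma tail_mon_empty: "tail_mon {} n = pivot n"
proof -
  have "gmon {} = (1 :: 'a grass)" by (rule grass_eqI) (simp add: coef_simps)
  then show ?thesis by (simp add: tail_mon_def)
qed

lemma is_mon_tail_mon:
  "is_mon g A \<Longrightarrow> \<exists>c. c \<noteq> 0 \<and> (\<forall>f. g * pivot n f = op_scale c (tail_mon A n) f)"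
  by (elim is_monE) (auto simp: op_scale_def tail_mon_def gscale_mult)

lemma superbracket_tail_mon:
  assumes "finite A" "finite B"
  shows "superbracket (tail_mon A n) (tail_mon B m) f =
    gmon A * pivot n (gmon B) * pivot m f -
    (-1) ^ (Suc (card A) * Suc (card B)) * (gmon B * pivot m (gmon A) * pivot n f) +
    (-1) ^ card B * (gmon A * gmon B * acomm n m f)"
  unfolding tail_mon_def acomm_def
  by (simp add: superbracket_mult_superderivation[OF odd_superderivation_pivot
        odd_superderivation_pivot gpart_gmon gpart_gmon])

text \<open>Super-anticommutativity on homogeneous elements; it reduces the computation of brackets
  to the case \<open>n \<le> m\<close>.\<close>

lemma superbracket_tail_mon_commute:
  "\<exists>c. c \<noteq> 0 \<and>
    superbracket (tail_mon B m) (tail_mon A n) = op_scale c (superbracket (tail_mon A n) (tail_mon B m))"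
proof -
  let ?e = "Suc (card A) * Suc (card B)"
  have "superbracket (tail_mon B m) (tail_mon A n) =
      op_scale ((-1) ^ Suc ?e) (superbracket (tail_mon A n) (tail_mon B m))"
    unfolding superbracket_homogeneous[OF glinear_tail_mon glinear_tail_mon
        op_part_tail_mon[of A n] op_part_tail_mon[of B m]]
      superbracket_homogeneous[OF glinear_tail_mon glinear_tail_mon
        op_part_tail_mon[of B m] op_part_tail_mon[of A n]]
    by (cases "even ?e") (auto simp: op_scale_def fun_eq_iff mult.commute[of "Suc (card B)"]
        simp del: mult_Suc mult_Suc_right)
  then show ?thesis by (intro exI[of _ "(-1) ^ Suc ?e"]) simp
qed

lemma pivot_gmon_below: "A \<subseteq> {..<n} \<Longrightarrow> pivot n (gmon A) = 0"
  by (rule pivot_eq_0) (auto simp: coef_simps split: if_splits)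

text \<open>Letters below n are killed by both $v_n$ and $v_m$, so neither coefficient is
  differentiated and only the bracket of the tails remains.\<close>

lemma superbracket_tail_mon_disjoint:
  assumes A: "A \<subseteq> {..<n}" and B: "B \<subseteq> {..<n}" and "n \<le> m"
  shows "superbracket (tail_mon A n) (tail_mon B m :: 'k::field gop) =
    (\<lambda>f. (-1) ^ card B * (gmon A * gmon B * acomm n m f))"
proof -
  have "finite A" "finite B" using A B finite_subset by blast+
  moreover have "pivot n (gmon B :: 'k grass) = 0" "pivot m (gmon A :: 'k grass) = 0"
    using assms by (auto intro!: pivot_gmon_below)
  ultimately show ?thesis by (simp add: superbracket_tail_mon fun_eq_iff)
qed

lemma superbracket_tail_mon_odd:
  assumes A: "A \<subseteq> {..<n}" and B: "B \<subseteq> {..<n}" and m: "n \<le> m" "odd (m - n)"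
  obtains c where "superbracket (tail_mon A n) (tail_mon B m) =
      op_scale c (tail_mon (A \<union> B \<union> {n..<m}) (m + 1))"
    and "c \<noteq> 0 \<longleftrightarrow> A \<inter> B = {}"
proof -
  have fin: "finite A" "finite B" using A B finite_subset by blast+
  obtain k where k: "m = n + 2 * k + 1" using m by (metis oddE add.assoc le_add_diff_inverse)
  obtain g where g: "is_mon g {n..<m}" "\<And>f. acomm n m f = (g :: 'a grass) * pivot (m + 1) f"
    using acomm_odd[of n k] unfolding k by auto
  have eq: "superbracket (tail_mon A n) (tail_mon B m) =
      (\<lambda>f. ((-1) ^ card B * (gmon A * gmon B * g)) * pivot (m + 1) f)"
    unfolding superbracket_tail_mon_disjoint[OF A B m(1)] g(2) by (simp add: mult.assoc)
  show ?thesis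
  proof (cases "A \<inter> B = {}")
    case True
    have "is_mon ((-1) ^ card B * (gmon A * gmon B * g)) (A \<union> B \<union> {n..<m})"
      by (intro is_mon_sign is_mon_mult is_mon_gmon fin g) (use A B True in auto)
    then obtain c where "c \<noteq> 0" "\<And>f. (-1) ^ card B * (gmon A * gmon B * g) * pivot (m + 1) f =
        op_scale c (tail_mon (A \<union> B \<union> {n..<m}) (m + 1)) f"
      using is_mon_tail_mon by blast
    then show ?thesis using True by (intro that[of c]) (simp_all add: eq fun_eq_iff)
  next
    case False
    have "gmon A * gmon B = (0 :: 'a grass)" using False fin by (simp add: gmon_mult)
    then show ?thesis using False by (intro that[of 0]) (simp_all add: eq op_scale_def)
  qed
qed

lemma superbracket_tail_mon_even:
  assumes A: "A \<subseteq> {..<n}" and B: "B \<subseteq> {..<n}" and m: "n \<le> m" "even (m - n)"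
  obtains c where "superbracket (tail_mon A n) (tail_mon B m :: 'k::field gop) =
      op_scale c (tail_mon (A \<union> B \<union> {n..<m} \<union> {m + 1}) (m + 2))"
    and "c \<noteq> 0 \<longleftrightarrow> A \<inter> B = {} \<and> (2 :: 'k) \<noteq> 0"
proof -
  have fin: "finite A" "finite B" using A B finite_subset by blast+
  obtain k where k: "m = n + 2 * k" using m by (metis evenE le_add_diff_inverse)
  obtain g where g: "is_mon g ({n..<m} \<union> {m + 1})"
      "\<And>f. acomm n m f = gscale (2 :: 'k) (g * pivot (m + 2) f)"
    using acomm_even[of n k] unfolding k by auto
  have eq: "superbracket (tail_mon A n) (tail_mon B m) =
      (\<lambda>f. gscale (2 :: 'k) (((-1) ^ card B * (gmon A * gmon B * g)) * pivot (m + 2) f))"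
    unfolding superbracket_tail_mon_disjoint[OF A B m(1)] g(2) by (simp add: mult.assoc gscale_mult)
  show ?thesis
  proof (cases "A \<inter> B = {}")
    case True
    have "is_mon ((-1) ^ card B * (gmon A * gmon B * g)) (A \<union> B \<union> ({n..<m} \<union> {m + 1}))"
      by (intro is_mon_sign is_mon_mult is_mon_gmon fin g) (use A B True m(1) in auto)
    then have "is_mon ((-1) ^ card B * (gmon A * gmon B * g)) (A \<union> B \<union> {n..<m} \<union> {m + 1})"
      by (simp only: Un_assoc)
    then obtain c where "c \<noteq> 0" "\<And>f. (-1) ^ card B * (gmon A * gmon B * g) * pivot (m + 2) f =
        op_scale c (tail_mon (A \<union> B \<union> {n..<m} \<union> {m + 1}) (m + 2)) f"
      using is_mon_tail_mon by blast
    then show ?thesis using True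
      by (intro that[of "2 * c"]) (simp_all add: eq fun_eq_iff op_scale_def)
  next
    case False
    have "gmon A * gmon B = (0 :: 'k grass)" using False fin by (simp add: gmon_mult)
    then show ?thesis using False by (intro that[of 0]) (simp_all add: eq op_scale_def)
  qed
qed

text \<open>All letters from n to m - 1 occur in the coefficient of $[v_n, v_m]$, so $x_B$
  annihilates it; also $v_m$ kills $x_A$. What is left is $x_A v_n(x_B) v_m$, described by
  \<open>pivot_gmon\<close>. The side condition of the zero case says that bracketing with $v_n$
  itself is nonzero if n is a letter of B.\<close>

lemma superbracket_tail_mon_overlap:
  assumes A: "A \<subseteq> {..<n}" and B: "B \<subseteq> {..<m}" and m: "n \<le> m" and j: "B \<inter> {n..<m} \<noteq> {}"
  obtains "superbracket (tail_mon A n) (tail_mon B m) = (0 :: 'k::field gop)" "\<not> (A = {} \<and> n \<in> B)"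
  | c j where "j \<in> B" "n \<le> j" "even (j - n)" "{n..<j} \<inter> B = {}"
    "A \<inter> (B - {j}) = {}" "c \<noteq> 0"
    "superbracket (tail_mon A n) (tail_mon B m :: 'k::field gop) =
      op_scale c (tail_mon (A \<union> (B - {j} \<union> {n..<j})) m)"
proof -
  have fin: "finite A" "finite B" using A B finite_subset by blast+
  have "pivot m (gmon A :: 'k grass) = 0" using A m by (intro pivot_gmon_below) auto
  moreover have "gmon B * acomm n m f = (0 :: 'k grass)" for f
  proof (cases "odd (m - n)")
    case True
    obtain k where k: "m = n + 2 * k + 1" using m True by (metis oddE add.assoc le_add_diff_inverse)
    obtain g where g: "is_mon g {n..<m}" "\<And>f. acomm n m f = (g :: 'k grass) * pivot (m + 1) f"
      using acomm_odd[of n k] unfolding k by auto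
    have "gmon B * g = 0" using j by (intro is_mon_mult_zero[OF is_mon_gmon[OF fin(2)] g(1)])
    then show ?thesis unfolding g(2) by (simp add: mult.assoc[symmetric])
  next
    case False
    obtain k where k: "m = n + 2 * k" using m False by (metis evenE le_add_diff_inverse)
    obtain g where g: "is_mon g ({n..<m} \<union> {m + 1})"
        "\<And>f. acomm n m f = gscale (2 :: 'k) (g * pivot (m + 2) f)"
      using acomm_even[of n k] unfolding k by auto
    have "gmon B * g = 0" using j by (intro is_mon_mult_zero[OF is_mon_gmon[OF fin(2)] g(1)]) auto
    then show ?thesis unfolding g(2) by (simp add: mult.assoc[symmetric] gscale_mult)
  qed
  ultimately have eq: "superbracket (tail_mon A n) (tail_mon B m) f =
      gmon A * pivot n (gmon B) * (pivot m f :: 'k grass)" for f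
    unfolding superbracket_tail_mon[OF fin] by (simp add: mult.assoc)
  note zero = that(1) and nonzero = that(2)
  have *: thesis if "gmon A * pivot n (gmon B) = (0 :: 'k grass)" "\<not> (A = {} \<and> n \<in> B)"
    using that by (intro zero) (auto simp: fun_eq_iff eq)
  from pivot_gmon[OF fin(2), of n, where 'k = 'k] show thesis
  proof (elim disjE bexE conjE)
    assume "pivot n (gmon B) = (0 :: 'k grass)" "n \<notin> B"
    then show thesis by (intro *) auto
  next
    fix j assume j: "j \<in> B" "n \<le> j" "even (j - n)" "{n..<j} \<inter> B = {}"
      "is_mon (pivot n (gmon B :: 'k grass)) (B - {j} \<union> {n..<j})"
    show thesis
    proof (cases "A \<inter> (B - {j}) = {}")
      case True
      have "is_mon (gmon A * pivot n (gmon B :: 'k grass)) (A \<union> (B - {j} \<union> {n..<j}))"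
        by (intro is_mon_mult is_mon_gmon fin j) (use A True in auto)
      then obtain c where "c \<noteq> 0" "\<And>f. gmon A * pivot n (gmon B) * pivot m f =
          op_scale c (tail_mon (A \<union> (B - {j} \<union> {n..<j})) m) (f :: 'k grass)"
        using is_mon_tail_mon by blast
      then show thesis using True j by (intro nonzero[of j c]) (simp_all add: eq fun_eq_iff)
    next
      case False
      then have "gmon A * pivot n (gmon B :: 'k grass) = 0"
        by (intro is_mon_mult_zero[OF is_mon_gmon[OF fin(1)] j(5)]) auto
      then show thesis using False by (intro *) auto
    qed
  qed
qed

text \<open>By \<open>pivot_gmon\<close>, $v_n$ sends $x_k$ to 0 or to a multiple of $x_n ...
  x_{k-1}$. The letters thus serve as test elements that tell tail monomials apart.\<close>

lemma coef_tail_mon_gvar: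
  assumes "finite A"
  shows "coef (tail_mon A n (gvar n :: 'k::field grass)) C = (if C = A then 1 else 0)"
    "coef (tail_mon A n (gvar k :: 'k grass)) C \<noteq> 0 \<Longrightarrow> n \<le> k \<and> even (k - n) \<and> C = A \<union> {n..<k}"
proof -
  show "coef (tail_mon A n (gvar n :: 'k grass)) C = (if C = A then 1 else 0)"
    using assms by (simp add: tail_mon_def pivot_gvar_self coef_simps)
  assume C: "coef (tail_mon A n (gvar k :: 'k grass)) C \<noteq> 0"
  then have "pivot n (gmon {k} :: 'k grass) \<noteq> 0"
    by (auto simp: tail_mon_def gvar_def coef_simps)
  then have k: "n \<le> k" "even (k - n)" "is_mon (pivot n (gmon {k} :: 'k grass)) {n..<k}"
    using pivot_gmon[of "{k}" n, where 'k = 'k] by auto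
  have "A \<inter> {n..<k} = {}"
  proof (rule ccontr)
    assume "A \<inter> {n..<k} \<noteq> {}"
    from is_mon_mult_zero[OF is_mon_gmon[OF assms] k(3) this] show False
      using C by (simp add: tail_mon_def gvar_def coef_simps)
  qed
  then have "is_mon (tail_mon A n (gvar k :: 'k grass)) (A \<union> {n..<k})"
    unfolding tail_mon_def gvar_def by (intro is_mon_mult is_mon_gmon assms k)
  then show "n \<le> k \<and> even (k - n) \<and> C = A \<union> {n..<k}" using C k coef_is_mon by blast
qed

lemma glinear_op_scale: "glinear S \<Longrightarrow> glinear (op_scale c S)"
  using gop.subspace_scale[OF subspace_glinear] by blast

section \<open>A basis of the Lie superalgebra\<close>

text \<open>Stated with addition: under \<open>i \<le> n - 2\<close> truncated subtraction would
  admit $x_0 v_1$.\<close>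

definition tail_index1 :: "(nat set \<times> nat) set" where
  "tail_index1 = {(A, n). \<forall>i\<in>A. i + 2 \<le> n}"

text \<open>The exception $x_0 x_2 v_3$ could only arise by differentiating a monomial with the letters
  $x_0, x_2$ and tail $v_3$, or as $[r v_1, s v_1]$ with $rs = \pm x_0$; but $x_0 v_1$ does not occur.\<close>

definition tail_index2 :: "(nat set \<times> nat) set" where
  "tail_index2 = {(A, n). 2 \<le> n \<and> n - 1 \<in> A \<and> (\<forall>i\<in>A. i = n - 1 \<or> i + 3 \<le> n) \<and>
    (A, n) \<noteq> ({0, 2}, 3)}"

text \<open>The flag will be \<open>(2 :: 'k) \<noteq> 0\<close>: in characteristic 2, brackets
  produce only the first kind.\<close>

definition tail_index :: "bool \<Rightarrow> (nat set \<times> nat) set" where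
  "tail_index P = tail_index1 \<union> (if P then tail_index2 else {})"

lemma tail_index_subset: "(A, n) \<in> tail_index P \<Longrightarrow> A \<subseteq> {..<n}"
  by (auto simp: tail_index_def tail_index1_def tail_index2_def split: if_splits)

lemma tail_index_finite: "(A, n) \<in> tail_index P \<Longrightarrow> finite A"
  by (rule finite_subset[OF tail_index_subset]) auto

lemma tail_index_mono: "tail_index P \<subseteq> tail_index True"
  by (auto simp: tail_index_def)

text \<open>If n and k differ, then k - n is even and at least 2, so a nonzero coefficient forces
  both k - 1 and k - 2 into C. Neither kind of index allows this.\<close>

lemma coef_tail_mon_dual:
  assumes "(A, n) \<in> tail_index True" "(C, k) \<in> tail_index True"
  shows "coef (tail_mon A n (gvar k :: 'k::field grass)) C = (if (A, n) = (C, k) then 1 else 0)"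
proof (cases "coef (tail_mon A n (gvar k :: 'k grass)) C = 0")
  case True
  then show ?thesis using coef_tail_mon_gvar(1)[OF tail_index_finite[OF assms(1)], of n C, where 'k = 'k] by auto
next
  case False
  then have nk: "n \<le> k" "even (k - n)" "C = A \<union> {n..<k}"
    using coef_tail_mon_gvar(2)[OF tail_index_finite[OF assms(1)] False] by auto
  have "n = k"
  proof (rule ccontr)
    assume "n \<noteq> k"
    then have "n + 2 \<le> k" using nk(1,2) by (cases "k = n + 1") auto
    then have "k - 1 \<in> C" "k - 2 \<in> C" "2 \<le> k" using nk(3) by auto
    then show False using assms(2)
      by (auto simp: tail_index_def tail_index1_def tail_index2_def)
  qed
  then show ?thesis using nk coef_tail_mon_gvar(1)[OF tail_index_finite[OF assms(1)], of n C, where 'k = 'k] by auto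
qed

lemma tail_index1_notin: "p \<in> tail_index1 \<Longrightarrow> snd p \<notin> fst p"
proof
  assume "p \<in> tail_index1" "snd p \<in> fst p"
  then have "snd p + 2 \<le> snd p" by (simp only: tail_index1_def mem_Collect_eq split_beta)
  then show False by simp
qed

abbreviation tm :: "nat set \<times> nat \<Rightarrow> 'k::field gop" where
  "tm p \<equiv> tail_mon (fst p) (snd p)"

section \<open>Linear independence of the tail monomials\<close>

lemma tm_dual:
  "p \<in> tail_index True \<Longrightarrow> q \<in> tail_index True \<Longrightarrow>
    coef (tm p (gvar (snd q))) (fst q) = (if p = q then 1 else 0)"
  using coef_tail_mon_dual[of "fst p" "snd p" "fst q" "snd q"] by (simp add: prod_eq_iff)

lemma inj_on_tm: "inj_on (tm :: _ \<Rightarrow> 'k::field gop) (tail_index True)"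
proof (rule inj_onI)
  fix p q :: "nat set \<times> nat"
  assume pq: "p \<in> tail_index True" "q \<in> tail_index True" and eq: "tm p = (tm q :: 'k gop)"
  show "p = q"
    using tm_dual[OF pq, where 'a = 'k] tm_dual[OF pq(2,2), where 'a = 'k] unfolding eq
    by (auto split: if_splits)
qed

lemma independent_tm:
  assumes "I \<subseteq> tail_index True"
  shows "gop.independent ((tm :: _ \<Rightarrow> 'k::field gop) ` I)"
  unfolding gop.dependent_def
proof
  let ?T = "tm :: _ \<Rightarrow> 'k gop"
  assume "\<exists>a\<in>?T ` I. a \<in> gop.span (?T ` I - {a})"
  then obtain p where p: "p \<in> I" "?T p \<in> gop.span (?T ` I - {?T p})" by blast
  \<comment> \<open>The kernel of the coefficient functional dual to p.\<close>
  let ?L = "{S :: 'k gop. coef (S (gvar (snd p))) (fst p) = 0}"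
  have "gop.subspace ?L"
    by (rule gop.subspaceI) (simp_all add: op_scale_def coef_simps)
  moreover have "?T ` I - {?T p} \<subseteq> ?L"
  proof
    fix S assume "S \<in> ?T ` I - {?T p}"
    then obtain q where "q \<in> I" "q \<noteq> p" "S = ?T q" by blast
    then show "S \<in> ?L" using p assms tm_dual[of q p, where 'a = 'k] by auto
  qed
  ultimately have "?T p \<in> ?L" using p(2) gop.span_minimal by blast
  then show False using p assms tm_dual[of p p, where 'a = 'k] by auto
qed

lemma char_eq_2_iff: "CHAR('k::field) = 2 \<longleftrightarrow> (2 :: 'k) = 0"
proof
  assume "CHAR('k) = 2"
  then show "(2 :: 'k) = 0" using of_nat_CHAR[where 'a = 'k] by simp
next
  assume "(2 :: 'k) = 0"
  then have "CHAR('k) dvd 2" using of_nat_eq_0_iff_char_dvd[of 2, where 'a = 'k] by simp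
  moreover have "CHAR('k) \<noteq> 0" using \<open>CHAR('k) dvd 2\<close> by (intro notI) simp
  ultimately have "CHAR('k) \<le> 2" "CHAR('k) \<noteq> 0" using dvd_imp_le[of "CHAR('k)" 2] by auto
  then show "CHAR('k) = 2" using CHAR_not_1[where 'a = 'k] by linarith
qed

text \<open>In characteristic 2 the tail monomials of the second kind arise only as squares of pivot
  elements.\<close>

definition growth_index :: "'k::field itself \<Rightarrow> (nat set \<times> nat) set" where
  "growth_index _ = (if (2 :: 'k) \<noteq> 0 then tail_index True
    else tail_index False \<union> range (\<lambda>n. ({n + 1}, n + 2)))"

lemma square_index: "({n + 1}, n + 2) \<in> tail_index True"
  by (auto simp: tail_index_def tail_index2_def)

lemma growth_index_subset: "growth_index TYPE('k::field) \<subseteq> tail_index True"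
  using tail_index_mono square_index unfolding growth_index_def by (auto simp del: add_2_eq_Suc')

text \<open>With $x_i$ of degree $-d_i$, the recursion says that $[v_n, v_{n+1}] = -x_n v_{n+2}$ is
  homogeneous. Leaving d abstract lets weight and length share the structural argument.\<close>

locale pivot_weights =
  fixes d :: "nat \<Rightarrow> nat"
  assumes d_rec: "d (n + 2) = d (n + 1) + 2 * d n"
begin

definition deg :: "nat set \<times> nat \<Rightarrow> int" where
  "deg p = int (d (snd p)) - (\<Sum>i\<in>fst p. int (d i))"

lemma deg_pair: "deg (A, n) = int (d n) - (\<Sum>i\<in>A. int (d i))"
  by (simp add: deg_def)

text \<open>Pairs telescope, as $d_i + d_{i+1} = d_{i+2} - d_i$. It expresses that $v_n$, of degree
  $d_n$, may turn $x_j$ into $x_n ... x_{j-1}$.\<close>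

lemma sum_d_even:
  assumes "n \<le> j" "even (j - n)"
  shows "(\<Sum>i = n..<j. int (d i)) = int (d j) - int (d n)"
proof -
  obtain k where k: "j = n + 2 * k" using assms by (metis evenE le_add_diff_inverse)
  have "(\<Sum>i = n..<n + 2 * k. int (d i)) = int (d (n + 2 * k)) - int (d n)"
  proof (induction k)
    case (Suc k)
    then show ?case using d_rec[of "n + 2 * k"] by simp
  qed simp
  then show ?thesis by (simp add: k)
qed

lemma sum_d_odd:
  assumes "n \<le> j" "odd (j - n)"
  shows "(\<Sum>i = n..<j. int (d i)) = int (d (j + 1)) - int (d j) - int (d n)"
proof -
  obtain l where l: "j = Suc l" "n \<le> l" "even (l - n)"
    using assms by (cases j) (auto simp: Suc_diff_le le_Suc_eq)
  then show ?thesis using sum_d_even[of n l] d_rec[of l] by simp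
qed

text \<open>If B has no letter from n to m - 1, only $[v_n, v_m]$ contributes: first kind with tail
  $v_{m+1}$ for m - n odd, second kind with tail $v_{m+2}$ for m - n even. Otherwise $v_n$
  differentiates $x_B$ and the tail stays $v_m$. Nothing is claimed about r when c is 0.\<close>

lemma superbracket_tm_le:
  assumes p: "(A, n) \<in> tail_index P" and q: "(B, m) \<in> tail_index P"
    and P: "P \<longleftrightarrow> (2 :: 'k::field) \<noteq> 0" and nm: "n \<le> m"
  shows "\<exists>c r. superbracket (tail_mon A n) (tail_mon B m :: 'k gop) = op_scale c (tm r) \<and>
    (c \<noteq> 0 \<longrightarrow> r \<in> tail_index P \<and> deg r = deg (A, n) + deg (B, m))"
proof -
  have sub: "A \<subseteq> {..<n}" "B \<subseteq> {..<m}" and fin: "finite A" "finite B"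
    using p q tail_index_subset tail_index_finite by blast+
  show ?thesis
  proof (cases "B \<inter> {n..<m} = {}")
    case True
    then have B: "B \<subseteq> {..<n}" using sub by force
    show ?thesis
    proof (cases "odd (m - n)")
      case odd: True
      then have "n < m" using nm by (cases "n = m") auto
      obtain c where c: "superbracket (tail_mon A n) (tail_mon B m :: 'k gop) =
          op_scale c (tail_mon (A \<union> B \<union> {n..<m}) (m + 1))" "c \<noteq> 0 \<longleftrightarrow> A \<inter> B = {}"
        using superbracket_tail_mon_odd[OF sub(1) B nm odd] .
      have "(A \<union> B \<union> {n..<m}, m + 1) \<in> tail_index1"
        using sub B \<open>n < m\<close> by (force simp: tail_index1_def)
      moreover have "deg (A \<union> B \<union> {n..<m}, m + 1) = deg (A, n) + deg (B, m)" if "A \<inter> B = {}"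
      proof -
        have "(\<Sum>i\<in>A \<union> B \<union> {n..<m}. int (d i)) =
            (\<Sum>i\<in>A. int (d i)) + (\<Sum>i\<in>B. int (d i)) + (\<Sum>i = n..<m. int (d i))"
          using fin that sub B by (subst sum.union_disjoint, auto)+
        then show ?thesis using sum_d_odd[OF nm odd] by (simp add: deg_pair)
      qed
      ultimately show ?thesis using c
        by (intro exI[of _ c] exI[of _ "(A \<union> B \<union> {n..<m}, m + 1)"]) (auto simp: tail_index_def)
    next
      case False
      then have even: "even (m - n)" by simp
      let ?C = "A \<union> B \<union> {n..<m} \<union> {m + 1}"
      obtain c where c: "superbracket (tail_mon A n) (tail_mon B m :: 'k gop) =
          op_scale c (tail_mon ?C (m + 2))" "c \<noteq> 0 \<longleftrightarrow> A \<inter> B = {} \<and> (2 :: 'k) \<noteq> 0"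
        using superbracket_tail_mon_even[OF sub(1) B nm even] .
      \<comment> \<open>Tail $v_3$ forces n = m = 1 by parity; then $x_0$ would have to come from
        $x_0 v_1$, which has no index.\<close>
      have "(?C, m + 2) \<noteq> ({0, 2}, 3)"
      proof
        assume *: "(?C, m + 2) = ({0, 2}, 3)"
        then have "m = 1" by simp
        moreover have "n \<noteq> 0" using even \<open>m = 1\<close> by (cases n) auto
        ultimately have "n = 1" "m = 1" using nm by auto
        moreover have "0 \<in> ?C" using * by auto
        ultimately have "0 \<in> A \<or> 0 \<in> B" by auto
        then show False using p q unfolding \<open>n = 1\<close> \<open>m = 1\<close>
          by (auto simp: tail_index_def tail_index1_def tail_index2_def split: if_splits)
      qed
      then have "(?C, m + 2) \<in> tail_index2"
        using sub B nm by (force simp: tail_index2_def)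
      moreover have "deg (?C, m + 2) = deg (A, n) + deg (B, m)" if "A \<inter> B = {}"
      proof -
        have "(\<Sum>i\<in>?C. int (d i)) =
            (\<Sum>i\<in>A. int (d i)) + (\<Sum>i\<in>B. int (d i)) + (\<Sum>i = n..<m. int (d i)) + int (d (m + 1))"
          using fin that sub B nm by (subst sum.union_disjoint, auto)+
        then show ?thesis using sum_d_even[OF nm even] d_rec[of m] by (simp add: deg_pair)
      qed
      ultimately show ?thesis using c P
        by (intro exI[of _ c] exI[of _ "(?C, m + 2)"]) (auto simp: tail_index_def)
    qed
  next
    case False
    from superbracket_tail_mon_overlap[OF sub nm False, where 'k = 'k] show ?thesis
    proof cases
      case 1
      then show ?thesis by (intro exI[of _ 0]) simp
    next
      case (2 c j)
      let ?C = "A \<union> (B - {j} \<union> {n..<j})"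
      have jm: "j < m" using 2 sub by auto
      have "deg (?C, m) = deg (A, n) + deg (B, m)"
      proof -
        have "(\<Sum>i\<in>?C. int (d i)) =
            (\<Sum>i\<in>A. int (d i)) + ((\<Sum>i\<in>B - {j}. int (d i)) + (\<Sum>i = n..<j. int (d i)))"
          using fin 2 sub by (subst sum.union_disjoint, auto)+
        moreover have "(\<Sum>i\<in>B. int (d i)) = int (d j) + (\<Sum>i\<in>B - {j}. int (d i))"
          using fin 2 by (intro sum.remove) auto
        ultimately show ?thesis using sum_d_even[OF 2(2,3)] by (simp add: deg_pair)
      qed
      \<comment> \<open>Replacing $x_j$ by smaller letters preserves the kind, unless j is the top
        letter m - 1 of the second kind; then the result is of the first kind.\<close>
      moreover have "(?C, m) \<in> tail_index P"
      proof (cases "(B, m) \<in> tail_index1")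
        case True
        then have "i + 2 \<le> m" if "i \<in> B" for i using that by (auto simp: tail_index1_def)
        then have "(?C, m) \<in> tail_index1" using 2(1,2) sub by (fastforce simp: tail_index1_def)
        then show ?thesis by (simp add: tail_index_def)
      next
        case False
        then have B: "(B, m) \<in> tail_index2" and P
          using q by (auto simp: tail_index_def split: if_splits)
        have m: "2 \<le> m" "m - 1 \<in> B" "\<And>i. i \<in> B \<Longrightarrow> i = m - 1 \<or> i + 3 \<le> m"
          using B by (auto simp: tail_index2_def)
        show ?thesis
        proof (cases "j = m - 1")
          case True
          have "i + 3 \<le> m" if "i \<in> B" "i \<noteq> j" for i using m that True by blast
          then have "(?C, m) \<in> tail_index1"
            using 2(2) sub True m(1) by (fastforce simp: tail_index1_def)
          then show ?thesis by (simp add: tail_index_def)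
        next
          case j: False
          then have j3: "j + 3 \<le> m" using m(3) 2(1) by blast
          \<comment> \<open>Here m = 3 forces j = 0, so B would already be the excluded set.\<close>
          have "(?C, m) \<noteq> ({0, 2}, 3)"
          proof
            assume *: "(?C, m) = ({0, 2}, 3)"
            then have "j = 0" using j3 by simp
            then have "B \<subseteq> {0, 2}" "2 \<in> B" "0 \<in> B" using * m 2(1) by auto
            then have "B = {0, 2}" by blast
            then show False using B * by (simp add: tail_index2_def)
          qed
          moreover have "\<forall>i\<in>?C. i = m - 1 \<or> i + 3 \<le> m"
            using j3 m(3) 2(2) sub by fastforce
          ultimately have "(?C, m) \<in> tail_index2"
            using m(1,2) j by (auto simp: tail_index2_def)
          then show ?thesis using \<open>P\<close> by (simp add: tail_index_def)
        qed
      qed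
      ultimately show ?thesis using 2
        by (intro exI[of _ c] exI[of _ "(?C, m)"]) simp
    qed
  qed
qed

lemma superbracket_tm:
  assumes "p \<in> tail_index P" "q \<in> tail_index P" "P \<longleftrightarrow> (2 :: 'k::field) \<noteq> 0"
  shows "\<exists>c r. superbracket (tm p) (tm q :: 'k gop) = op_scale c (tm r) \<and>
    (c \<noteq> 0 \<longrightarrow> r \<in> tail_index P \<and> deg r = deg p + deg q)"
proof (cases "snd p \<le> snd q")
  case True
  then show ?thesis
    using superbracket_tm_le[of "fst p" "snd p" P "fst q" "snd q", where 'k = 'k] assms by simp
next
  case False
  then have "\<exists>c r. superbracket (tm q) (tm p :: 'k gop) = op_scale c (tm r) \<and>
      (c \<noteq> 0 \<longrightarrow> r \<in> tail_index P \<and> deg r = deg q + deg p)"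
    using superbracket_tm_le[of "fst q" "snd q" P "fst p" "snd p", where 'k = 'k] assms by simp
  then obtain c r where c: "superbracket (tm q) (tm p :: 'k gop) = op_scale c (tm r)"
    "c \<noteq> 0 \<longrightarrow> r \<in> tail_index P \<and> deg r = deg q + deg p" by blast
  obtain e where "superbracket (tm p) (tm q :: 'k gop) = op_scale e (superbracket (tm q) (tm p))"
    using superbracket_tail_mon_commute by blast
  then have "superbracket (tm p) (tm q :: 'k gop) = op_scale (e * c) (tm r)"
    unfolding c(1) by simp
  then show ?thesis using c(2) by (intro exI[of _ "e * c"] exI[of _ r]) auto
qed

section \<open>Lie monomials in the generators are multiples of indexed tail monomials\<close>

abbreviation generators :: "('k::field gop \<times> nat) set" where
  "generators \<equiv> {(pivot 0, d 0), (pivot 1, d 1)}"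

lemma lie_monomial_tm:
  assumes "lie_monomial generators S k" and P: "P \<longleftrightarrow> (2 :: 'k::field) \<noteq> 0"
  shows "\<exists>c p. S = op_scale c (tm p :: 'k gop) \<and>
    (c \<noteq> 0 \<longrightarrow> p \<in> tail_index P \<and> deg p = int k)"
  using assms(1)
proof (induction rule: lie_monomial.induct)
  case (generator S n)
  have "({}, i) \<in> tail_index P" for i by (simp add: tail_index_def tail_index1_def)
  moreover obtain i where "S = tm ({}, i)" "n = d i" using generator that[of 0] that[of 1] by (auto simp: tail_mon_empty)
  ultimately show ?case by (intro exI[of _ 1] exI[of _ "({}, i)"]) (simp add: deg_def)
next
  case (bracket S m T n)
  then obtain a p b q where S: "S = op_scale a (tm p)" and T: "T = op_scale b (tm q)"
    and p: "a \<noteq> 0 \<longrightarrow> p \<in> tail_index P \<and> deg p = int m"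
    and q: "b \<noteq> 0 \<longrightarrow> q \<in> tail_index P \<and> deg q = int n"
    by blast
  have eq: "superbracket S T = op_scale (a * b) (superbracket (tm p) (tm q))"
    unfolding S T by (simp add: superbracket_scale_left superbracket_scale_right
        glinear_op_scale glinear_tail_mon mult.commute)
  show ?case
  proof (cases "a = 0 \<or> b = 0")
    case True
    then show ?thesis unfolding eq by (intro exI[of _ 0]) auto
  next
    case False
    then obtain c r where "superbracket (tm p) (tm q :: 'k gop) = op_scale c (tm r)"
      "c \<noteq> 0 \<longrightarrow> r \<in> tail_index P \<and> deg r = deg p + deg q"
      using superbracket_tm[of p P q] p q P by blast
    then show ?thesis unfolding eq using p q False
      by (intro exI[of _ "a * b * c"] exI[of _ r]) auto
  qed
qed

text \<open>The weight k is left open, which keeps the constructions free of bookkeeping;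
  \<open>generated_degree\<close> recovers it afterwards.\<close>

definition generated :: "'k::field itself \<Rightarrow> nat set \<Rightarrow> nat \<Rightarrow> bool" where
  "generated _ A n \<longleftrightarrow>
    (\<exists>c k. c \<noteq> 0 \<and> lie_monomial generators (op_scale c (tail_mon A n :: 'k gop)) k)"

lemma generated_bracket:
  assumes "generated TYPE('k::field) A n" "generated TYPE('k) B m"
    and "superbracket (tail_mon A n) (tail_mon B m :: 'k gop) = op_scale c (tail_mon C l)" "c \<noteq> 0"
  shows "generated TYPE('k) C l"
proof -
  obtain a k b j where a: "a \<noteq> 0" "lie_monomial generators (op_scale a (tail_mon A n :: 'k gop)) k"
    and b: "b \<noteq> 0" "lie_monomial generators (op_scale b (tail_mon B m :: 'k gop)) j"
    using assms(1,2) unfolding generated_def by blast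
  have "superbracket (op_scale a (tail_mon A n)) (op_scale b (tail_mon B m :: 'k gop)) =
      op_scale (a * b * c) (tail_mon C l)"
    using assms(3) by (simp add: superbracket_scale_left superbracket_scale_right
        glinear_op_scale glinear_tail_mon mult_ac)
  then have "lie_monomial generators (op_scale (a * b * c) (tail_mon C l :: 'k gop)) (k + j)"
    using lie_monomial.bracket[OF a(2) b(2)] by simp
  then show ?thesis unfolding generated_def using a b assms(4)
    by (intro exI[of _ "a * b * c"] exI[of _ "k + j"]) simp
qed

section \<open>Reaching every indexed tail monomial by brackets\<close>

lemma generated_generator: "i \<le> 1 \<Longrightarrow> generated TYPE('k::field) {} i"
  unfolding generated_def tail_mon_empty
  by (intro exI[of _ 1] exI[of _ "d i"] conjI) (auto simp: le_Suc_eq intro: lie_monomial.generator)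

text \<open>Since i itself is the least letter of B from i on, bracketing with $v_i$ replaces $x_i$
  by the empty product.\<close>

lemma generated_remove:
  assumes "generated TYPE('k::field) {} i" "generated TYPE('k) B m" "B \<subseteq> {..<m}" "i \<in> B"
  shows "generated TYPE('k) (B - {i}) m"
proof -
  have "i \<in> B \<inter> {i..<m}" using assms by auto
  then have "i \<le> m" "B \<inter> {i..<m} \<noteq> {}" by auto
  from superbracket_tail_mon_overlap[OF empty_subsetI assms(3) this, where 'k = 'k]
  show ?thesis
  proof cases
    case 1
    then show ?thesis using assms(4) by simp
  next
    case (2 c j)
    have "j = i" using 2(1,2,4) assms(4) by (cases "i < j") auto
    then show ?thesis using generated_bracket[OF assms(1,2) 2(7,6)] by simp
  qed
qed

lemma generated_odd:
  assumes "generated TYPE('k::field) {} n" "generated TYPE('k) B m" "B \<subseteq> {..<n}" "n \<le> m" "odd (m - n)"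
  shows "generated TYPE('k) (B \<union> {n..<m}) (m + 1)"
proof -
  obtain c where "superbracket (tail_mon {} n) (tail_mon B m :: 'k gop) =
      op_scale c (tail_mon ({} \<union> B \<union> {n..<m}) (m + 1))" "c \<noteq> 0"
    using superbracket_tail_mon_odd[OF empty_subsetI assms(3-5), where 'a = 'k] by auto
  from generated_bracket[OF assms(1,2) this] show ?thesis by simp
qed

lemma generated_even:
  assumes "generated TYPE('k::field) {} n" "generated TYPE('k) B m" "B \<subseteq> {..<n}" "n \<le> m" "even (m - n)"
    and "(2 :: 'k) \<noteq> 0"
  shows "generated TYPE('k) (B \<union> {n..<m} \<union> {m + 1}) (m + 2)"
proof -
  obtain c where "superbracket (tail_mon {} n) (tail_mon B m :: 'k gop) =
      op_scale c (tail_mon ({} \<union> B \<union> {n..<m} \<union> {m + 1}) (m + 2))" "c \<noteq> 0"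
    using superbracket_tail_mon_even[OF empty_subsetI assms(3-5), where 'k = 'k] assms(6) by auto
  from generated_bracket[OF assms(1,2) this] show ?thesis by simp
qed

text \<open>$[v_n, v_{n+1}] = -x_n v_{n+2}$, and a further bracket with $v_n$ removes $x_n$; hence
  the induction on consecutive pairs.\<close>

lemma generated_pivot: "generated TYPE('k::field) {} n"
proof -
  have "generated TYPE('k) {} n \<and> generated TYPE('k) {} (n + 1)"
  proof (induction n)
    case 0
    then show ?case using generated_generator[of 0] generated_generator[of 1] by simp
  next
    case (Suc n)
    then have g: "generated TYPE('k) {} n" "generated TYPE('k) {} (n + 1)" by auto
    have "{n..<n + 1} = {n}" by auto
    then have "generated TYPE('k) {n} (n + 2)" using generated_odd[OF g] by simp
    from generated_remove[OF g(1) this] show ?case using g(2) by simp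
  qed
  then show ?thesis by blast
qed

text \<open>Bracketing $x_0 ... x_{n-1} v_{n+1}$ with $v_n$ appends the letter $x_n$ and raises the
  tail by one.\<close>

lemma generated_full: "generated TYPE('k::field) {..<n} (n + 1)"
proof (induction n)
  case 0
  then show ?case using generated_pivot[of 1] by simp
next
  case (Suc n)
  have "{..<n} \<union> {n..<n + 1} = {..<Suc n}" by auto
  then show ?case using generated_odd[OF generated_pivot Suc, of n] by simp
qed

lemma generated_subset:
  assumes A: "generated TYPE('k::field) A n" "A \<subseteq> {..<n}" and B: "B \<subseteq> A"
  shows "generated TYPE('k) B n"
proof -
  have "generated TYPE('k) (A - X) n" if "finite X" "X \<subseteq> A" for X
    using that
  proof (induction X rule: finite_induct)
    case (insert i X)
    have "generated TYPE('k) (A - X - {i}) n"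
      by (rule generated_remove[OF generated_pivot]) (use insert A in auto)
    moreover have "A - insert i X = A - X - {i}" by blast
    ultimately show ?case by (simp only:)
  qed (use A in simp)
  moreover have "finite A" by (rule finite_subset[OF A(2)]) simp
  then have "finite (A - B)" by simp
  moreover have "A - (A - B) = B" using B by blast
  ultimately show ?thesis by (metis Diff_subset)
qed

lemma generated_tail_index:
  assumes "(A, n) \<in> tail_index P" "P \<longleftrightarrow> (2 :: 'k::field) \<noteq> 0"
  shows "generated TYPE('k) A n"
proof (cases "(A, n) \<in> tail_index1")
  case True
  then have A: "i + 2 \<le> n" if "i \<in> A" for i using that by (auto simp: tail_index1_def)
  show ?thesis
  proof (cases n)
    case 0
    then have "A = {}" using A by force
    then show ?thesis using generated_pivot by simp
  next
    case (Suc l)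
    then have "A \<subseteq> {..<l}" using A by force
    then show ?thesis using generated_subset[OF generated_full[of l], of A] Suc by auto
  qed
next
  case False
  then have A2: "(A, n) \<in> tail_index2" and "(2 :: 'k) \<noteq> 0"
    using assms by (auto simp: tail_index_def split: if_splits)
  then have A: "2 \<le> n" "n - 1 \<in> A" "\<And>i. i \<in> A \<Longrightarrow> i = n - 1 \<or> i + 3 \<le> n" "(A, n) \<noteq> ({0, 2}, 3)"
    by (auto simp: tail_index2_def)
  \<comment> \<open>From $[v_m, v_m] = 2 v_m^2$. It settles n = 2 and n = 3, where only the single
    letter n - 1 is possible.\<close>
  have sq: "generated TYPE('k) {m + 1} (m + 2)" for m
    using generated_even[OF generated_pivot[of m] generated_pivot[of m]] \<open>(2 :: 'k) \<noteq> 0\<close> by simp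
  consider "n = 2" | "n = 3" | "4 \<le> n" using A(1) by linarith
  then show ?thesis
  proof cases
    case 1
    have "A \<subseteq> {1}"
    proof
      fix i assume "i \<in> A"
      then show "i \<in> {1}" using A(3)[of i] 1 by simp
    qed
    then have "A = {1}" using A(2) 1 by auto
    then show ?thesis using sq[of 0] 1 by (simp add: numeral_2_eq_2)
  next
    case 2
    have "A \<subseteq> {0, 2}"
    proof
      fix i assume "i \<in> A"
      then show "i \<in> {0, 2}" using A(3)[of i] 2 by auto
    qed
    moreover have "2 \<in> A" using A(2) 2 by simp
    ultimately have "A = {2}" using A(4) 2 by auto
    then show ?thesis using sq[of 1] 2 by (simp add: numeral_2_eq_2 numeral_3_eq_3)
  next
    case 3
    \<comment> \<open>$[v_m, x_0 ... x_{m-1} v_{m+2}]$ is twice a multiple of a monomial with tail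
      $v_n$ that contains all letters admissible for n; removing letters leaves A.\<close>
    obtain m where m: "n = m + 4" using 3 by (metis add.commute le_Suc_ex)
    have "{..<m} \<subseteq> {..<m + 1}" by auto
    from generated_subset[OF generated_full[of "m + 1"] _ this]
    have "generated TYPE('k) {..<m} (m + 2)" by simp
    from generated_even[OF generated_pivot this subset_refl _ _ \<open>(2 :: 'k) \<noteq> 0\<close>]
    have "generated TYPE('k) ({..<m} \<union> {m..<m + 2} \<union> {m + 3}) n" by (simp add: m numeral_eq_Suc)
    moreover have "{..<m} \<union> {m..<m + 2} \<union> {m + 3} \<subseteq> {..<n}" by (auto simp: m)
    moreover have "A \<subseteq> {..<m} \<union> {m..<m + 2} \<union> {m + 3}"
    proof
      fix i assume "i \<in> A"
      then have "i = m + 3 \<or> i + 3 \<le> m + 4" using A(3) m by fastforce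
      then show "i \<in> {..<m} \<union> {m..<m + 2} \<union> {m + 3}" by auto
    qed
    ultimately show ?thesis by (rule generated_subset)
  qed
qed

text \<open>A Lie monomial of weight k is a multiple of some \<open>tm q\<close> with
  \<open>deg q = int k\<close>. If it is also a nonzero multiple of \<open>tm p\<close>, the dual
  functional yields q = p.\<close>

lemma generated_degree:
  assumes p: "p \<in> tail_index P" and P: "P \<longleftrightarrow> (2 :: 'k::field) \<noteq> 0"
  obtains c k where "c \<noteq> 0" "lie_monomial generators (op_scale c (tm p :: 'k gop)) k" "deg p = int k"
proof -
  obtain c k where c: "c \<noteq> 0" "lie_monomial generators (op_scale c (tm p :: 'k gop)) k"
    using generated_tail_index[of "fst p" "snd p" P] p P unfolding generated_def by auto
  obtain b q where q: "op_scale c (tm p) = op_scale b (tm q :: 'k gop)"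
    "b \<noteq> 0 \<longrightarrow> q \<in> tail_index P \<and> deg q = int k"
    using lie_monomial_tm[OF c(2) P] by blast
  have "coef (op_scale c (tm p) (gvar (snd p) :: 'k grass)) (fst p) = c"
    using tm_dual[of p p, where 'a = 'k] p tail_index_mono by (auto simp: op_scale_def coef_simps)
  then have "b * coef (tm q (gvar (snd p) :: 'k grass)) (fst p) = c"
    unfolding q(1) by (simp add: op_scale_def coef_simps)
  then have "b \<noteq> 0" "coef (tm q (gvar (snd p) :: 'k grass)) (fst p) \<noteq> 0" using c(1) by auto
  moreover have "p \<in> tail_index True" "q \<in> tail_index True"
    using p q(2) \<open>b \<noteq> 0\<close> tail_index_mono by blast+
  ultimately have "p = q"
    using tm_dual[of q p, where 'a = 'k] by (auto split: if_splits)
  then show thesis using that c q(2) \<open>b \<noteq> 0\<close> by blast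
qed

text \<open>For nonempty A, both $v_n(x_A)$ and $x_A x_A$ vanish, so only pivot elements have
  nonzero squares.\<close>

lemma tail_mon_square:
  assumes A: "A \<subseteq> {..<n}"
  shows "tail_mon A n \<circ> tail_mon A n = (if A = {} then tail_mon {n + 1} (n + 2) else (0 :: 'k::field gop))"
proof (cases "A = {}")
  case True
  then show ?thesis unfolding True tail_mon_empty
    by (simp add: fun_eq_iff pivot_pivot tail_mon_def gvar_def)
next
  case False
  have "gmon A * pivot n (gmon A * f) = 0" for f :: "'k grass"
  proof -
    have "pivot n (gmon A * f) = pivot n (gmon A) * f + (-1) ^ card A * (gmon A * pivot n f)"
      by (rule pivot_mult[OF gpart_gmon])
    moreover have "gmon A * (gmon A * g) = 0" for g :: "'k grass"
      using False finite_subset[OF A] by (simp add: mult.assoc[symmetric] gmon_mult)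
    ultimately show ?thesis
      using pivot_gmon_below[OF A, where 'a = 'k] by (simp add: sign_mult gscale_mult)
  qed
  then show ?thesis using False by (simp add: fun_eq_iff tail_mon_def)
qed

section \<open>A basis of each filtration step\<close>

lemma deg_square: "deg ({n + 1}, n + 2) = 2 * deg ({}, n)"
  using d_rec[of n] by (simp add: deg_pair)

lemma lie_filtration_eq:
  "lie_filtration generators m =
    gop.span ((tm :: _ \<Rightarrow> 'k::field gop) ` {p \<in> growth_index TYPE('k). deg p \<le> int m})"
    (is "_ = gop.span ?B")
proof
  define P where "P \<longleftrightarrow> (2 :: 'k) \<noteq> 0"
  have P: "P \<longleftrightarrow> (2 :: 'k) \<noteq> 0" by (simp add: P_def)
  have PI: "tail_index P \<subseteq> growth_index TYPE('k)" by (auto simp: P_def growth_index_def)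
  have base: "op_scale c (tm p) \<in> gop.span ?B"
    if "c \<noteq> 0 \<longrightarrow> p \<in> growth_index TYPE('k) \<and> deg p \<le> int m" for c :: 'k and p
  proof (cases "c = 0")
    case False
    then have "tm p \<in> ?B" using that by blast
    then show ?thesis by (intro gop.span_scale gop.span_base)
  qed (simp add: gop.span_zero)
  show "lie_filtration generators m \<subseteq> gop.span ?B"
    unfolding lie_filtration_def
  proof (rule gop.span_minimal[OF _ gop.subspace_span], rule subsetI)
    fix S :: "'k gop" assume "S \<in> lie_spanning generators m"
    then consider n where "n \<le> m" "lie_monomial generators S n"
      | T n where "S = T \<circ> T" "CHAR('k) = 2" "op_part 1 T = T" "2 * n \<le> m"
        "lie_monomial generators T n"
      unfolding lie_spanning_def by blast
    then show "S \<in> gop.span ?B"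
    proof cases
      case 1
      obtain c p where "S = op_scale c (tm p)" "c \<noteq> 0 \<longrightarrow> p \<in> tail_index P \<and> deg p = int n"
        using lie_monomial_tm[OF 1(2) P] by blast
      then show ?thesis using 1(1) base[of c p] PI by auto
    next
      case 2
      obtain c p where T: "T = op_scale c (tm p)" "c \<noteq> 0 \<longrightarrow> p \<in> tail_index P \<and> deg p = int n"
        using lie_monomial_tm[OF 2(5) P] by blast
      have "glinear (tm p :: 'k gop)" by (rule glinear_tail_mon)
      then have S: "S = op_scale (c * c) (tm p \<circ> tm p)"
        unfolding 2(1) T(1) by (simp add: fun_eq_iff op_scale_def glinear_simps)
      show ?thesis
      proof (cases "c = 0")
        case True
        then show ?thesis using S gop.span_zero by simp
      next
        case c: False
        then have p: "p \<in> tail_index P" "deg p = int n" using T(2) by auto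
        have sq: "tm p \<circ> tm p = (if fst p = {} then tail_mon {snd p + 1} (snd p + 2) else (0 :: 'k gop))"
          by (rule tail_mon_square) (use p tail_index_subset[of "fst p" "snd p" P] in simp)
        show ?thesis
        proof (cases "fst p = {}")
          case True
          then have "p = ({}, snd p)" by (simp add: prod_eq_iff)
          then have "deg ({snd p + 1}, snd p + 2) \<le> int m"
            using p(2) 2(4) deg_square[of "snd p"] by simp
          moreover have "({snd p + 1}, snd p + 2) \<in> growth_index TYPE('k)"
            using square_index[of "snd p"] by (auto simp: growth_index_def simp del: add_2_eq_Suc')
          ultimately show ?thesis
            using base[of "c * c" "({snd p + 1}, snd p + 2)"] True unfolding S sq by simp
        qed (simp add: S sq gop.span_zero)
      qed
    qed
  qed
  have gen: "(tm p :: 'k gop) \<in> lie_filtration generators m"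
    if p: "p \<in> growth_index TYPE('k)" "deg p \<le> int m" for p
  proof -
    have unscale: "(tm p :: 'k gop) \<in> lie_filtration generators m"
      if "op_scale c (tm p :: 'k gop) \<in> lie_spanning generators m" "c \<noteq> 0" for c :: 'k
    proof -
      have "op_scale (inverse c) (op_scale c (tm p :: 'k gop)) \<in> lie_filtration generators m"
        unfolding lie_filtration_def by (intro gop.span_scale gop.span_base that)
      then show ?thesis using that(2) by simp
    qed
    show ?thesis
    proof (cases "p \<in> tail_index P")
      case True
      obtain c k where c: "c \<noteq> 0" "lie_monomial generators (op_scale c (tm p :: 'k gop)) k" "deg p = int k"
        using generated_degree[OF True P] .
      then show ?thesis using p(2) by (intro unscale[of c]) (auto simp: lie_spanning_def)
    next
      case False
      \<comment> \<open>An index outside the reach of brackets occurs only in characteristic 2, and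
        its tail monomial is the square of $v_n$.\<close>
      then obtain n where n: "p = ({n + 1}, n + 2)" and two: "(2 :: 'k) = 0"
        using p(1) by (auto simp: growth_index_def P_def split: if_splits)
      have "({}, n) \<in> tail_index P" by (simp add: tail_index_def tail_index1_def)
      then obtain c k where c: "c \<noteq> 0" "lie_monomial generators (op_scale c (pivot n :: 'k gop)) k"
          "deg ({}, n) = int k"
        using generated_degree[OF _ P, of "({}, n)"] by (auto simp: tail_mon_empty)
      let ?T = "op_scale c (pivot n :: 'k gop)"
      have "op_part 1 ?T = ?T" by (simp only: op_part_scale op_part_pivot)
      moreover have "2 * k \<le> m" using p(2) c(3) unfolding n deg_square by simp
      ultimately have "?T \<circ> ?T \<in> lie_spanning generators m"
        using c(2) two unfolding lie_spanning_def char_eq_2_iff by blast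
      also have "?T \<circ> ?T = op_scale (c * c) (tm p)"
        using tail_mon_square[of "{}" n, where 'k = 'k]
        by (simp add: n tail_mon_empty fun_eq_iff op_scale_def glinear_simps[OF glinear_pivot])
      finally show ?thesis using c(1) by (intro unscale[of "c * c"]) simp_all
    qed
  qed
  show "gop.span ?B \<subseteq> lie_filtration generators m"
    unfolding lie_filtration_def[of _ m]
    by (rule gop.span_minimal[OF _ gop.subspace_span]) (use gen in \<open>auto simp: lie_filtration_def\<close>)
qed

theorem lie_growth_eq:
  "lie_growth (generators :: ('k::field gop \<times> nat) set) m =
    card {p \<in> growth_index TYPE('k). deg p \<le> int m}"
proof -
  let ?I = "{p \<in> growth_index TYPE('k). deg p \<le> int m}"
  have sub: "?I \<subseteq> tail_index True" using growth_index_subset by blast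
  have "lie_growth (generators :: ('k gop \<times> nat) set) m = card ((tm :: _ \<Rightarrow> 'k gop) ` ?I)"
    unfolding lie_growth_def lie_filtration_eq gop.dim_span
    by (rule gop.dim_eq_card_independent[OF independent_tm[OF sub]])
  also have "\<dots> = card ?I"
    by (rule card_image[OF inj_on_subset[OF inj_on_tm sub]])
  finally show ?thesis .
qed

end

section \<open>Counting basis elements by weight\<close>

interpretation wt: pivot_weights "\<lambda>n. 2 ^ n"
  by standard simp

text \<open>The length of $v_n$.\<close>

fun jacobsthal :: "nat \<Rightarrow> nat" where
  "jacobsthal 0 = 1"
| "jacobsthal (Suc 0) = 1"
| "jacobsthal (Suc (Suc n)) = jacobsthal (Suc n) + 2 * jacobsthal n"

interpretation len: pivot_weights jacobsthal
  by standard simp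

text \<open>Three times the length of $v_n$ differs from twice its weight by a sign only; the
  comparison of the two growth functions rests on this.\<close>

lemma jacobsthal_closed: "3 * int (jacobsthal n) = 2 * 2 ^ n + (-1) ^ n"
  by (induction n rule: jacobsthal.induct) simp_all

text \<open>\<open>set_encode A\<close> is the number whose binary digits 1 stand at the positions
  in A.\<close>

lemma wt_deg_encode: "finite A \<Longrightarrow> wt.deg (A, n) = 2 ^ n - int (set_encode A)"
  by (simp add: wt.deg_pair set_encode_def)

lemma set_encode_less:
  assumes "A \<subseteq> {..<k}"
  shows "set_encode A < 2 ^ k"
proof -
  have "set_encode A \<le> (\<Sum>i<k. 2 ^ i)"
    using assms finite_subset[OF assms] by (auto simp: set_encode_def intro: sum_mono2)
  also have "\<dots> < 2 ^ k" by (simp add: mask_eq_sum_exp_nat[symmetric] lessThan_def)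
  finally show ?thesis .
qed

lemma set_decode_subset: "x < 2 ^ k \<Longrightarrow> set_decode x \<subseteq> {..<k}"
proof
  fix i assume x: "x < 2 ^ k" and "i \<in> set_decode x"
  then have "2 ^ i \<le> set_encode (set_decode x)"
    unfolding set_encode_def by (intro member_le_sum) (auto simp: finite_set_decode)
  then have "2 ^ i \<le> x" by simp
  then have "(2 :: nat) ^ i < 2 ^ k" using x by (rule order.strict_trans1)
  then show "i \<in> {..<k}" by simp
qed

lemma tail_index1_Suc: "(A, Suc n) \<in> tail_index1 \<longleftrightarrow> A \<subseteq> {..<n}"
  by (auto simp: tail_index1_def)

lemma tail_index1_0: "(A, 0) \<in> tail_index1 \<longleftrightarrow> A = {}"
  by (auto simp: tail_index1_def)

text \<open>The letters lie below n - 1, so less than $2^{n-1}$ is subtracted and the weight lies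
  above $2^{n-1}$ and up to $2^n$. The doubled form of the last bound includes n = 0.\<close>

lemma wt_deg_bounds:
  assumes "(A, n) \<in> tail_index1"
  shows "0 < wt.deg (A, n)" "wt.deg (A, n) \<le> 2 ^ n" "2 ^ n < 2 * wt.deg (A, n)"
proof -
  have "0 < wt.deg (A, n) \<and> wt.deg (A, n) \<le> 2 ^ n \<and> 2 ^ n < 2 * wt.deg (A, n)"
  proof (cases n)
    case 0
    then show ?thesis using assms by (simp add: tail_index1_0 wt.deg_pair)
  next
    case (Suc l)
    then have A: "A \<subseteq> {..<l}" using assms by (simp add: tail_index1_Suc)
    then have "finite A" by (rule finite_subset) simp
    moreover have "int (set_encode A) < 2 ^ l"
      using set_encode_less[OF A] by (metis of_nat_less_iff of_nat_numeral of_nat_power)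
    moreover have "wt.deg (A, n) = 2 * 2 ^ l - int (set_encode A)"
      using \<open>finite A\<close> by (simp only: Suc wt_deg_encode power_Suc)
    ultimately show ?thesis unfolding Suc power_Suc by linarith
  qed
  then show "0 < wt.deg (A, n)" "wt.deg (A, n) \<le> 2 ^ n" "2 ^ n < 2 * wt.deg (A, n)" by blast+
qed

text \<open>The dyadic interval that contains the weight determines n, and the binary expansion of
  $2^n$ minus the weight determines A.\<close>

lemma bij_betw_wt_deg: "bij_betw wt.deg {p \<in> tail_index1. wt.deg p \<le> int m} {1..int m}"
  unfolding bij_betw_def
proof (intro conjI set_eqI iffI)
  have le: "n \<le> k" if "(A, n) \<in> tail_index1" "(B, k) \<in> tail_index1" "wt.deg (A, n) = wt.deg (B, k)"
    for A B n k
  proof (rule ccontr)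
    assume "\<not> n \<le> k"
    then have "(2 :: int) ^ Suc k \<le> 2 ^ n" by (intro power_increasing) auto
    then show False using wt_deg_bounds[OF that(1)] wt_deg_bounds[OF that(2)] that(3) by simp
  qed
  show "inj_on wt.deg {p \<in> tail_index1. wt.deg p \<le> int m}"
  proof (rule inj_onI, clarify)
    fix A n B k
    assume *: "(A, n) \<in> tail_index1" "(B, k) \<in> tail_index1" "wt.deg (A, n) = wt.deg (B, k)"
    have "n = k" using le[OF *] le[OF *(2,1)] * by simp
    have fin: "finite A" "finite B"
      using * tail_index_finite[of _ _ False] by (auto simp: tail_index_def)
    then have "set_encode A = set_encode B" using *(3) \<open>n = k\<close> by (simp add: wt_deg_encode)
    then have "A = B" using fin by (simp add: set_encode_eq)
    then show "A = B \<and> n = k" using \<open>n = k\<close> by simp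
  qed
next
  fix w assume w: "w \<in> {1..int m}"
  have "\<exists>n. w \<le> 2 ^ n"
    using w by (intro exI[of _ "nat w"]) (auto intro: order.trans[OF _ less_imp_le[OF of_nat_less_two_power]])
  \<comment> \<open>Minimality gives $2^n - w < 2^{n-1}$ for n > 0, so the binary digits of this
    difference are admissible letters.\<close>
  define n where "n = (LEAST n. w \<le> 2 ^ n)"
  have n: "w \<le> 2 ^ n" unfolding n_def using \<open>\<exists>n. w \<le> 2 ^ n\<close> by (rule LeastI_ex)
  have "\<exists>A. (A, n) \<in> tail_index1 \<and> wt.deg (A, n) = w"
  proof (cases n)
    case 0
    then show ?thesis using n w by (intro exI[of _ "{}"]) (simp add: tail_index1_0 wt.deg_pair)
  next
    case (Suc l)
    then have "\<not> w \<le> 2 ^ l" using not_less_Least[of l "\<lambda>n. w \<le> 2 ^ n"] unfolding n_def by simp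
    define x where "x = nat (2 ^ n - w)"
    have x: "int x = 2 ^ n - w" using n by (simp add: x_def)
    have "int x < int (2 ^ l)" using x \<open>\<not> w \<le> 2 ^ l\<close> by (simp add: Suc)
    then have "x < 2 ^ l" by (simp only: of_nat_less_iff)
    then have "(set_decode x, n) \<in> tail_index1"
      using set_decode_subset by (simp add: Suc tail_index1_Suc)
    then show ?thesis using x
      by (intro exI[of _ "set_decode x"]) (simp add: wt_deg_encode finite_set_decode)
  qed
  then show "w \<in> wt.deg ` {p \<in> tail_index1. wt.deg p \<le> int m}" using w by force
next
  fix w assume "w \<in> wt.deg ` {p \<in> tail_index1. wt.deg p \<le> int m}"
  then show "w \<in> {1..int m}" using wt_deg_bounds(1) by force
qed

lemma card_tail_index1: "card {p \<in> tail_index1. wt.deg p \<le> int m} = m"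
  using bij_betw_same_card[OF bij_betw_wt_deg[of m]] by simp

lemma finite_tail_index1: "finite {p \<in> tail_index1. wt.deg p \<le> int m}"
  using bij_betw_finite[OF bij_betw_wt_deg[of m]] by simp

text \<open>Preserves the weight, as $2^{n+1} - 2^n = 2^n$.\<close>

definition raise :: "nat set \<times> nat \<Rightarrow> nat set \<times> nat" where
  "raise p = (insert (snd p) (fst p), snd p + 1)"

text \<open>Dropping the letter n - 1 and lowering the tail inverts \<open>raise\<close>. The two
  omitted pairs would be raised to the exceptions $x_0 v_1$ and $x_0 x_2 v_3$.\<close>

lemma tail_index2_eq: "tail_index2 = raise ` (tail_index1 - {({}, 0), ({0}, 2)})"
proof (intro set_eqI iffI)
  fix p assume "p \<in> raise ` (tail_index1 - {({}, 0), ({0}, 2)})"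
  then obtain q where q: "q \<in> tail_index1" "q \<noteq> ({}, 0)" "q \<noteq> ({0}, 2)" "p = raise q" by blast
  obtain A n where An: "q = (A, n)" by (cases q)
  note A = q(1-3)[unfolded An]
  have p: "p = (insert n A, n + 1)" using q(4) by (simp add: An raise_def)
  have "n \<noteq> 0" using A(1,2) by (cases n) (auto simp: tail_index1_0)
  moreover have "(insert n A, n + 1) \<noteq> ({0, 2}, 3)"
  proof
    assume *: "(insert n A, n + 1) = ({0, 2}, 3)"
    then have "n = 2" by simp
    then have "A = insert n A - {2}" using tail_index1_notin[OF A(1)] by auto
    also have "insert n A = {0, 2}" using * by (simp only: prod.inject)
    also have "{0, 2} - {2} = {0 :: nat}" by auto
    finally have "A = {0}" .
    then show False using A(3) \<open>n = 2\<close> by simp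
  qed
  moreover have "i = n \<or> i + 3 \<le> n + 1" if "i \<in> insert n A" for i
  proof (cases "i = n")
    case False
    then have "i + 2 \<le> n" using A(1) that unfolding tail_index1_def by blast
    then show ?thesis by simp
  qed simp
  ultimately show "p \<in> tail_index2"
    unfolding p tail_index2_def by simp
next
  fix p assume "p \<in> tail_index2"
  then obtain A n where p: "p = (A, n)" and A: "2 \<le> n" "n - 1 \<in> A"
      "\<And>i. i \<in> A \<Longrightarrow> i = n - 1 \<or> i + 3 \<le> n" "(A, n) \<noteq> ({0, 2}, 3)"
    by (auto simp: tail_index2_def)
  let ?q = "(A - {n - 1}, n - 1)"
  have r: "raise ?q = p" using A(1,2) by (auto simp: raise_def p)
  moreover have "i + 2 \<le> n - 1" if "i \<in> A - {n - 1}" for i using A(3)[of i] that by auto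
  then have "?q \<in> tail_index1" by (simp add: tail_index1_def)
  moreover have "?q \<noteq> ({}, 0)" using A(1) by auto
  moreover have "?q \<noteq> ({0}, 2)"
  proof
    assume "?q = ({0}, 2)"
    with r have "raise ({0}, 2) = p" by (simp only:)
    then show False using A(4) by (auto simp: p raise_def insert_commute)
  qed
  ultimately show "p \<in> raise ` (tail_index1 - {({}, 0), ({0}, 2)})"
    by (intro image_eqI[of _ _ ?q]) auto
qed

section \<open>Counting the second kind and the squares\<close>

lemma wt_deg_raise:
  assumes "p \<in> tail_index1"
  shows "wt.deg (raise p) = wt.deg p"
proof -
  have "finite (fst p)" "snd p \<notin> fst p"
    using assms tail_index_finite[of "fst p" "snd p" False] tail_index1_notin
    by (auto simp: tail_index_def)
  then show ?thesis by (simp add: wt.deg_def raise_def)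
qed

lemma inj_on_raise: "inj_on raise tail_index1"
proof (rule inj_onI)
  fix p q assume p: "p \<in> tail_index1" "q \<in> tail_index1" and eq: "raise p = raise q"
  have n: "snd p = snd q" "snd p \<notin> fst p" "snd q \<notin> fst q"
    using eq p[THEN tail_index1_notin] by (simp_all add: raise_def)
  then have "fst p = fst q" using eq insert_ident[of "snd p" "fst p" "fst q"] by (simp add: raise_def)
  then show "p = q" using n(1) by (rule prod_eqI)
qed

lemma tail_index2_weight:
  "{p \<in> tail_index2. wt.deg p \<le> int m} =
    raise ` ({p \<in> tail_index1. wt.deg p \<le> int m} - {({}, 0), ({0}, 2)})"
  unfolding tail_index2_eq using wt_deg_raise by force

lemma tail_index_disjoint: "tail_index1 \<inter> tail_index2 = {}"
  by (force simp: tail_index1_def tail_index2_def)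

lemma finite_tail_index: "finite {p \<in> tail_index True. wt.deg p \<le> int m}"
proof -
  have "{p \<in> tail_index True. wt.deg p \<le> int m} =
      {p \<in> tail_index1. wt.deg p \<le> int m} \<union> {p \<in> tail_index2. wt.deg p \<le> int m}"
    by (auto simp: tail_index_def)
  then show ?thesis unfolding tail_index2_weight using finite_tail_index1 by simp
qed

text \<open>The two exceptions would have weights 1 and 3, so from m = 3 on the second kind
  contributes m - 2.\<close>

lemma card_tail_index:
  assumes "3 \<le> m"
  shows "card {p \<in> tail_index True. wt.deg p \<le> int m} = 2 * m - 2"
proof -
  let ?X = "{p \<in> tail_index1. wt.deg p \<le> int m}"
  have "card {p \<in> tail_index2. wt.deg p \<le> int m} = card (?X - {({}, 0), ({0}, 2)})"
    unfolding tail_index2_weight by (rule card_image[OF inj_on_subset[OF inj_on_raise]]) auto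
  also have "\<dots> = m - 2"
  proof -
    have "{({}, 0), ({0}, 2)} \<subseteq> ?X"
      using assms by (auto simp: tail_index1_def wt.deg_pair)
    then have "card (?X - {({}, 0), ({0}, 2)}) = card ?X - card {({} :: nat set, 0 :: nat), ({0}, 2)}"
      by (intro card_Diff_subset) auto
    then show ?thesis using card_tail_index1[of m] by simp
  qed
  finally have "card {p \<in> tail_index2. wt.deg p \<le> int m} = m - 2" .
  moreover have "{p \<in> tail_index True. wt.deg p \<le> int m} =
      ?X \<union> {p \<in> tail_index2. wt.deg p \<le> int m}"
    by (auto simp: tail_index_def)
  moreover have "finite {p \<in> tail_index2. wt.deg p \<le> int m}"
    unfolding tail_index2_weight using finite_tail_index1 by simp
  ultimately have "card {p \<in> tail_index True. wt.deg p \<le> int m} = m + (m - 2)"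
    using tail_index_disjoint finite_tail_index1[of m] card_tail_index1[of m]
    by (simp add: card_Un_disjoint disjoint_iff)
  then show ?thesis using assms by simp
qed

text \<open>The square of $v_n$ has weight $2^{n+1}$, so the count is that of the powers of two from
  2 up to m.\<close>

lemma card_squares:
  assumes "1 \<le> m"
  shows "int (card {p \<in> range (\<lambda>n. ({n + 1}, n + 2)). wt.deg p \<le> int m}) = \<lfloor>log 2 (real m)\<rfloor>"
proof -
  let ?f = "\<lambda>n::nat. ({n + 1}, n + 2)"
  have "0 \<le> \<lfloor>log 2 (real m)\<rfloor>" using assms by simp
  have "wt.deg (?f n) \<le> int m \<longleftrightarrow> n < nat \<lfloor>log 2 (real m)\<rfloor>" for n
  proof -
    have "wt.deg (?f n) = int (2 ^ (n + 1))" by (simp add: wt.deg_pair)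
    then have "wt.deg (?f n) \<le> int m \<longleftrightarrow> 2 ^ (n + 1) \<le> m" by (simp only: of_nat_le_iff)
    also have "\<dots> \<longleftrightarrow> real (2 ^ (n + 1)) \<le> real m" by (simp only: of_nat_le_iff)
    also have "\<dots> \<longleftrightarrow> 2 powr real (n + 1) \<le> real m" by (subst powr_realpow) simp_all
    also have "\<dots> \<longleftrightarrow> real (n + 1) \<le> log 2 (real m)"
      using assms by (subst le_log_iff) auto
    also have "\<dots> \<longleftrightarrow> int (n + 1) \<le> \<lfloor>log 2 (real m)\<rfloor>" by (simp add: le_floor_iff)
    also have "\<dots> \<longleftrightarrow> n < nat \<lfloor>log 2 (real m)\<rfloor>" by linarith
    finally show ?thesis .
  qed
  then have "{p \<in> range ?f. wt.deg p \<le> int m} = ?f ` {..<nat \<lfloor>log 2 (real m)\<rfloor>}" by auto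
  then show ?thesis using \<open>0 \<le> \<lfloor>log 2 (real m)\<rfloor>\<close> by (simp add: card_image inj_on_def)
qed

section \<open>Exact weight growth\<close>

lemma weight_growth_eq:
  "R_weight_growth TYPE('k::field) m = card {p \<in> growth_index TYPE('k). wt.deg p \<le> int m}"
  using wt.lie_growth_eq[of m, where 'k = 'k] by (simp add: R_weight_growth_def)

lemma growth_eq:
  "R_growth TYPE('k::field) m = card {p \<in> growth_index TYPE('k). len.deg p \<le> int m}"
  using len.lie_growth_eq[of m, where 'k = 'k] by (simp add: R_growth_def)

lemma weight_growth_char_not_2:
  assumes "CHAR('k::field) \<noteq> 2" "3 \<le> m"
  shows "R_weight_growth TYPE('k) m = 2 * m - 2"
  using assms card_tail_index[OF assms(2)]
  by (simp add: weight_growth_eq char_eq_2_iff growth_index_def)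

lemma weight_growth_char_2:
  assumes "CHAR('k::field) = 2" "1 \<le> m"
  shows "int (R_weight_growth TYPE('k) m) = int m + \<lfloor>log 2 (real m)\<rfloor>"
proof -
  let ?Q = "{p \<in> range (\<lambda>n. ({n + 1}, n + 2)). wt.deg p \<le> int m}"
  have eq: "{p \<in> growth_index TYPE('k). wt.deg p \<le> int m} = {p \<in> tail_index1. wt.deg p \<le> int m} \<union> ?Q"
    using assms(1) by (auto simp: char_eq_2_iff growth_index_def tail_index_def)
  have "?Q \<subseteq> {p \<in> tail_index True. wt.deg p \<le> int m}"
    using square_index by (auto simp del: add_2_eq_Suc')
  then have "finite ?Q" by (rule finite_subset[OF _ finite_tail_index])
  moreover have "{p \<in> tail_index1. wt.deg p \<le> int m} \<inter> ?Q = {}"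
    by (auto simp: tail_index1_def)
  ultimately show ?thesis
    unfolding weight_growth_eq eq using finite_tail_index1[of m] card_tail_index1[of m]
      card_squares[OF assms(2)]
    by (simp add: card_Un_disjoint)
qed


section \<open>Growth with respect to length\<close>

text \<open>By \<open>jacobsthal_closed\<close> the tail and every letter each contribute a sign to
  the difference, and there are at most n letters.\<close>

lemma len_deg_approx:
  assumes "p \<in> tail_index True"
  shows "\<bar>3 * len.deg p - 2 * wt.deg p\<bar> \<le> int (snd p) + 1"
proof -
  obtain A n where p: "p = (A, n)" by (cases p)
  have A: "A \<subseteq> {..<n}" using assms unfolding p by (rule tail_index_subset)
  have "3 * len.deg p - 2 * wt.deg p =
      (3 * int (jacobsthal n) - 2 * 2 ^ n) - (\<Sum>i\<in>A. 3 * int (jacobsthal i) - 2 * 2 ^ i)"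
    by (simp add: p len.deg_pair wt.deg_pair sum_subtractf sum_distrib_left algebra_simps)
  also have "\<dots> = (-1) ^ n - (\<Sum>i\<in>A. (-1) ^ i)"
    by (simp add: jacobsthal_closed)
  also have "\<bar>\<dots>\<bar> \<le> \<bar>(-1) ^ n\<bar> + (\<Sum>i\<in>A. \<bar>(-1) ^ i\<bar>)"
    by (rule order.trans[OF abs_triangle_ineq4 add_left_mono[OF sum_abs]])
  also have "\<dots> = 1 + int (card A)" by (simp add: power_abs)
  also have "\<dots> \<le> int (snd p) + 1" using card_mono[OF _ A] by (simp add: p)
  finally show ?thesis .
qed

text \<open>The constant is 4 rather than 2 because \<open>raise\<close> keeps the weight but
  increases the tail index by one.\<close>

lemma wt_deg_lower:
  assumes "p \<in> tail_index True"
  shows "0 < wt.deg p" "2 ^ snd p \<le> 4 * wt.deg p"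
proof -
  have 1: "0 < wt.deg q \<and> 2 ^ snd q < 2 * wt.deg q" if "q \<in> tail_index1" for q
    using that wt_deg_bounds[of "fst q" "snd q"] by simp
  have "0 < wt.deg p \<and> 2 ^ snd p \<le> 4 * wt.deg p"
  proof (cases "p \<in> tail_index1")
    case True
    then show ?thesis using 1[of p] by simp
  next
    case False
    then have "p \<in> tail_index2" using assms by (simp add: tail_index_def)
    then obtain q where q: "q \<in> tail_index1" "p = raise q" unfolding tail_index2_eq by blast
    then show ?thesis using 1[OF q(1)] wt_deg_raise[OF q(1)] by (simp add: raise_def)
  qed
  then show "0 < wt.deg p" "2 ^ snd p \<le> 4 * wt.deg p" by blast+
qed

text \<open>The tail index is at most the binary logarithm of four times the weight, which
  contributes 2 to the constant 3.\<close>

lemma len_deg_approx_log: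
  assumes "p \<in> tail_index True"
  shows "\<bar>3 * real_of_int (len.deg p) - 2 * real_of_int (wt.deg p)\<bar> \<le> log 2 (real_of_int (wt.deg p)) + 3"
proof -
  have "real_of_int (2 ^ snd p) \<le> real_of_int (4 * wt.deg p)"
    using wt_deg_lower(2)[OF assms] by (simp only: of_int_le_iff)
  then have "2 powr real (snd p) \<le> 4 * real_of_int (wt.deg p)" by (simp add: powr_realpow)
  then have "real (snd p) \<le> log 2 (4 * real_of_int (wt.deg p))"
    using wt_deg_lower(1)[OF assms] by (subst le_log_iff) auto
  also have "\<dots> = log 2 4 + log 2 (real_of_int (wt.deg p))"
    using wt_deg_lower(1)[OF assms] by (intro log_mult_pos) auto
  also have "log 2 4 = (2 :: real)" using log_pow_cancel[of 2 2] by simp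
  finally have "real (snd p) + 1 \<le> log 2 (real_of_int (wt.deg p)) + 3" by simp
  moreover have "real_of_int \<bar>3 * len.deg p - 2 * wt.deg p\<bar> \<le> real_of_int (int (snd p) + 1)"
    using len_deg_approx[OF assms] by (simp only: of_int_le_iff)
  ultimately show ?thesis by simp
qed

text \<open>The tangent bound of ln at 1, applied to x / 2 and to 1 / 2; the latter gives that ln 2
  is at least 1 / 2.\<close>

lemma log2_le_self:
  assumes "0 < x"
  shows "log 2 x \<le> (x :: real)"
proof -
  have "ln x = ln (x / 2) + ln 2" using assms by (simp add: ln_divide_pos)
  also have "\<dots> \<le> x / 2" using ln_le_minus_one[of "x / 2"] ln_2_less_1 assms by simp
  also have "\<dots> \<le> x * ln 2"
    using ln_le_minus_one[of "1 / 2"] mult_left_mono[of "1 / 2" "ln 2" x] assms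
    by (simp add: ln_divide_pos)
  finally show ?thesis by (simp add: log_def divide_le_eq)
qed

text \<open>Bootstrapping: length at most m gives $2w \<le> 3m + 3 + log w$, hence $w \<le> 3m + 3$
  because $log w \<le> w$; this turns log w into a bound in m alone. Allowing any I covers both
  characteristics.\<close>

lemma growth_sandwich:
  assumes "I \<subseteq> tail_index True"
  shows "card {p \<in> I. wt.deg p \<le> int (nat \<lfloor>(3 * real m - 3 - log 2 (3 * real m + 3)) / 2\<rfloor>)}
      \<le> card {p \<in> I. len.deg p \<le> int m}" (is "card ?L \<le> card ?M")
    "card {p \<in> I. len.deg p \<le> int m}
      \<le> card {p \<in> I. wt.deg p \<le> int (nat \<lfloor>(3 * real m + 3 + log 2 (3 * real m + 3)) / 2\<rfloor>)}"
      (is "_ \<le> card ?U")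
proof -
  have fin: "finite {p \<in> I. wt.deg p \<le> int k}" for k
    by (rule finite_subset[OF _ finite_tail_index[of k]]) (use assms in auto)
  have MU: "?M \<subseteq> ?U"
  proof
    fix p assume p: "p \<in> ?M"
    let ?w = "real_of_int (wt.deg p)"
    have "p \<in> tail_index True" using p assms by blast
    then have w: "0 < ?w" "p \<in> tail_index True" using wt_deg_lower(1)[of p] by simp_all
    have "real_of_int (len.deg p) \<le> real m" using p by simp
    then have 2: "2 * ?w \<le> 3 * real m + 3 + log 2 ?w" using len_deg_approx_log[OF w(2)] by linarith
    then have "?w \<le> 3 * real m + 3" using log2_le_self[OF w(1)] by linarith
    then have "log 2 ?w \<le> log 2 (3 * real m + 3)" using w(1) by simp
    then have "?w \<le> (3 * real m + 3 + log 2 (3 * real m + 3)) / 2" using 2 by simp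
    then have "wt.deg p \<le> \<lfloor>(3 * real m + 3 + log 2 (3 * real m + 3)) / 2\<rfloor>" by (simp add: le_floor_iff)
    then show "p \<in> ?U" using p by simp
  qed
  then show "card ?M \<le> card ?U" by (intro card_mono fin)
  have "?L \<subseteq> ?M"
  proof
    fix p assume p: "p \<in> ?L"
    let ?w = "real_of_int (wt.deg p)"
    have "p \<in> tail_index True" using p assms by blast
    then have w: "0 < wt.deg p" "p \<in> tail_index True" using wt_deg_lower(1)[of p] by simp_all
    \<comment> \<open>\<open>nat\<close> truncates a negative bound to 0, which is harmless as
      weights are positive.\<close>
    define z where "z = \<lfloor>(3 * real m - 3 - log 2 (3 * real m + 3)) / 2\<rfloor>"
    have "wt.deg p \<le> int (nat z)" using p by (simp only: z_def mem_Collect_eq)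
    then have "wt.deg p \<le> z" using w(1) by linarith
    then have 1: "2 * ?w \<le> 3 * real m - 3 - log 2 (3 * real m + 3)"
      by (simp add: z_def le_floor_iff)
    moreover have "0 \<le> log 2 (3 * real m + 3)" by simp
    ultimately have "?w \<le> 3 * real m + 3" using w(1) by linarith
    then have "log 2 ?w \<le> log 2 (3 * real m + 3)" using w(1) by simp
    then have "3 * real_of_int (len.deg p) \<le> 3 * real m"
      using 1 len_deg_approx_log[OF w(2)] by linarith
    then show "p \<in> ?M" using p by simp
  qed
  then show "card ?L \<le> card ?M" by (intro card_mono finite_subset[OF MU fin])
qed

section \<open>Asymptotics of the ordinary growth\<close>

lemma nat_floor_bounds:
  fixes r :: real
  assumes "3 \<le> r"
  shows "3 \<le> nat \<lfloor>r\<rfloor>" "real (nat \<lfloor>r\<rfloor>) \<le> r" "r - 1 \<le> real (nat \<lfloor>r\<rfloor>)"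
  using assms by linarith+

text \<open>The growth is squeezed between values of the weight growth at $3m/2 + O(log m)$. In the
  error allowed by N, the 2 serves characteristic different from 2 and the logarithm serves
  characteristic 2.\<close>

lemma growth_limit:
  fixes a :: real
  assumes "0 < a"
    and N: "\<And>x. 3 \<le> x \<Longrightarrow> \<bar>real (R_weight_growth TYPE('k::field) x) - a * real x\<bar> \<le> 2 + log 2 (real x)"
  shows "(\<lambda>m. real (R_growth TYPE('k) m) / real m) \<longlonglongrightarrow> 3 * a / 2"
proof (rule tendsto_sandwich)
  let ?l = "\<lambda>m. log 2 (3 * real m + 3)"
  \<comment> \<open>The -1 accounts for rounding down; -2 and the last logarithm are the error from
    N.\<close>
  let ?lo = "\<lambda>m. a * ((3 * real m - 3 - ?l m) / 2 - 1) - 2 - ?l m"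
  let ?up = "\<lambda>m. a * ((3 * real m + 3 + ?l m) / 2) + 2 + ?l m"
  show "(\<lambda>m. ?lo m / real m) \<longlonglongrightarrow> 3 * a / 2"
    by real_asymp
  show "(\<lambda>m. ?up m / real m) \<longlonglongrightarrow> 3 * a / 2"
    by real_asymp
  have sandwich:
    "R_weight_growth TYPE('k) (nat \<lfloor>(3 * real m - 3 - ?l m) / 2\<rfloor>) \<le> R_growth TYPE('k) m"
    "R_growth TYPE('k) m \<le> R_weight_growth TYPE('k) (nat \<lfloor>(3 * real m + 3 + ?l m) / 2\<rfloor>)" for m
    using growth_sandwich[OF growth_index_subset[where 'k = 'k], of m]
    by (simp_all add: weight_growth_eq growth_eq)
  have big: "\<forall>\<^sub>F m in sequentially. 3 \<le> (3 * real m - 3 - ?l m) / 2"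
    by real_asymp
  show "\<forall>\<^sub>F m in sequentially. ?lo m / real m \<le> real (R_growth TYPE('k) m) / real m"
    using big
  proof eventually_elim
    case (elim m)
    let ?x = "nat \<lfloor>(3 * real m - 3 - ?l m) / 2\<rfloor>"
    have l: "0 \<le> ?l m" by simp
    note x = nat_floor_bounds[OF elim]
    have "(3 * real m - 3 - t) / 2 \<le> 3 * real m + 3" if "0 \<le> t" for t using that by simp
    then have "real ?x \<le> 3 * real m + 3" using x(2) l order.trans by blast
    then have "log 2 (real ?x) \<le> ?l m" using x(1) by (subst log_le_cancel_iff) linarith+
    moreover have "a * ((3 * real m - 3 - ?l m) / 2 - 1) \<le> a * real ?x"
      using assms(1) x(3) by (intro mult_left_mono) auto
    moreover have "real (R_weight_growth TYPE('k) ?x) \<le> real (R_growth TYPE('k) m)"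
      using sandwich(1)[of m] by (simp only: of_nat_le_iff)
    ultimately have "?lo m \<le> real (R_growth TYPE('k) m)" using N[OF x(1)] by linarith
    then show ?case by (intro divide_right_mono) auto
  qed
  show "\<forall>\<^sub>F m in sequentially. real (R_growth TYPE('k) m) / real m \<le> ?up m / real m"
    using big
  proof eventually_elim
    case (elim m)
    let ?x = "nat \<lfloor>(3 * real m + 3 + ?l m) / 2\<rfloor>"
    have l: "0 \<le> ?l m" by simp
    have "?l m \<le> 3 * real m + 3" by (rule log2_le_self) simp
    have "3 \<le> (3 * real m + 3 + t) / 2" if "3 \<le> (3 * real m - 3 - t) / 2" "0 \<le> t" for t
      using that by simp
    note x = nat_floor_bounds[OF this[OF elim l]]
    have "(3 * real m + 3 + t) / 2 \<le> 3 * real m + 3" if "t \<le> 3 * real m + 3" for t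
      using that by simp
    then have "real ?x \<le> 3 * real m + 3" using x(2) \<open>?l m \<le> 3 * real m + 3\<close> order.trans by blast
    then have "log 2 (real ?x) \<le> ?l m" using x(1) by (subst log_le_cancel_iff) linarith+
    moreover have "a * real ?x \<le> a * ((3 * real m + 3 + ?l m) / 2)"
      using assms(1) x(2) by (intro mult_left_mono) auto
    moreover have "real (R_growth TYPE('k) m) \<le> real (R_weight_growth TYPE('k) ?x)"
      using sandwich(2)[of m] by (simp only: of_nat_le_iff)
    ultimately have "real (R_growth TYPE('k) m) \<le> ?up m" using N[OF x(1)] by linarith
    then show ?case by (intro divide_right_mono) auto
  qed
qed

lemma growth_limit_char_not_2:
  assumes "CHAR('k::field) \<noteq> 2"
  shows "(\<lambda>m. real (R_growth TYPE('k) m) / real m) \<longlonglongrightarrow> 3"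
proof -
  have "\<bar>real (R_weight_growth TYPE('k) x) - 2 * real x\<bar> \<le> 2 + log 2 (real x)" if "3 \<le> x" for x
    using weight_growth_char_not_2[OF assms that] that by simp
  from growth_limit[OF _ this] show ?thesis by simp
qed

lemma growth_limit_char_2:
  assumes "CHAR('k::field) = 2"
  shows "(\<lambda>m. real (R_growth TYPE('k) m) / real m) \<longlonglongrightarrow> 3 / 2"
proof -
  have "\<bar>real (R_weight_growth TYPE('k) x) - 1 * real x\<bar> \<le> 2 + log 2 (real x)" if "3 \<le> x" for x
  proof -
    have "real (R_weight_growth TYPE('k) x) = real x + real_of_int \<lfloor>log 2 (real x)\<rfloor>"
      using weight_growth_char_2[OF assms, of x] that
      by (metis of_int_add of_int_of_nat_eq order.trans one_le_numeral)
    moreover have "0 \<le> log 2 (real x)" using that by simp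
    then have "0 \<le> \<lfloor>log 2 (real x)\<rfloor>" by simp
    ultimately show ?thesis by linarith
  qed
  from growth_limit[OF _ this] show ?thesis by simp
qed

text \<open>The quotient of logarithms is 1 plus $ln(\<gamma>(m)/m) / ln m$, whose numerator
  converges because c is positive.\<close>

lemma GKdim_linear:
  assumes lim: "(\<lambda>m. real (\<gamma> m) / real m) \<longlonglongrightarrow> c" and "0 < c"
  shows "upper_GKdim \<gamma> = 1" "lower_GKdim \<gamma> = 1"
proof -
  have "(\<lambda>m. ln (real (\<gamma> m) / real m) / ln (real m) + 1) \<longlonglongrightarrow> 0 + 1"
  proof (rule tendsto_add)
    have "filterlim (\<lambda>m::nat. ln (real m)) at_top sequentially" by real_asymp
    then show "(\<lambda>m. ln (real (\<gamma> m) / real m) / ln (real m)) \<longlonglongrightarrow> 0"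
      by (intro tendsto_divide_0[OF tendsto_ln[OF lim]] filterlim_at_top_imp_at_infinity)
        (use \<open>0 < c\<close> in auto)
  qed simp
  moreover have "\<forall>\<^sub>F m in sequentially.
      ln (real (\<gamma> m) / real m) / ln (real m) + 1 = ln (real (\<gamma> m)) / ln (real m)"
    using order_tendstoD(1)[OF lim \<open>0 < c\<close>] eventually_gt_at_top[of 1]
  proof eventually_elim
    case (elim m)
    then have "0 < real (\<gamma> m)" by (simp add: zero_less_divide_iff)
    then have "ln (real (\<gamma> m) / real m) = ln (real (\<gamma> m)) - ln (real m)"
      using elim by (intro ln_divide_pos) auto
    moreover have "ln (real m) \<noteq> 0" using elim by simp
    ultimately show ?case by (simp add: diff_divide_distrib)
  qed
  ultimately have "(\<lambda>m. ln (real (\<gamma> m)) / ln (real m)) \<longlonglongrightarrow> 1"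
    by (simp add: tendsto_cong)
  then have "(\<lambda>m. ereal (ln (real (\<gamma> m)) / ln (real m))) \<longlonglongrightarrow> ereal 1"
    by (rule tendsto_ereal)
  then show "upper_GKdim \<gamma> = 1" "lower_GKdim \<gamma> = 1"
    unfolding upper_GKdim_def lower_GKdim_def
    by (simp_all add: lim_imp_Limsup lim_imp_Liminf one_ereal_def)
qed

theorem theorem8p5:
  shows "(\<lambda>m. real (R_growth TYPE('k::field) m)) \<in> \<Theta>(\<lambda>m. real m) \<and>
    (CHAR('k) \<noteq> 2 \<longrightarrow> (\<forall>m\<ge>3. R_weight_growth TYPE('k) m = 2 * m - 2)) \<and>
    (CHAR('k) = 2 \<longrightarrow>
      (\<forall>m\<ge>1. int (R_weight_growth TYPE('k) m) = int m + \<lfloor>log 2 (real m)\<rfloor>)) \<and>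
    (upper_GKdim (R_growth TYPE('k)) = 1 \<and> lower_GKdim (R_growth TYPE('k)) = 1) \<and>
    (CHAR('k) \<noteq> 2 \<longrightarrow>
      (\<lambda>m. real (R_growth TYPE('k) m) / (3 * real m)) \<longlonglongrightarrow> 1) \<and>
    (CHAR('k) = 2 \<longrightarrow>
      (\<lambda>m. real (R_growth TYPE('k) m) / (3 * real m / 2)) \<longlonglongrightarrow> 1)"
proof -
  \<comment> \<open>The limit is 3 or 3 / 2 by characteristic; its positivity alone yields linear
    growth and both GK dimensions.\<close>
  obtain c where c: "0 < c" "(\<lambda>m. real (R_growth TYPE('k) m) / real m) \<longlonglongrightarrow> c"
    using growth_limit_char_2[where 'k = 'k] growth_limit_char_not_2[where 'k = 'k]
    by (cases "CHAR('k) = 2") (auto intro: that[of 3] that[of "3 / 2"])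
  have "(\<lambda>m. real (R_growth TYPE('k) m)) \<in> \<Theta>(\<lambda>m. real m)"
    by (rule bigthetaI_tendsto[OF _ c(2)]) (use c(1) in simp)
  moreover have "(\<lambda>m. real (R_growth TYPE('k) m) / (3 * real m)) \<longlonglongrightarrow> 1" if "CHAR('k) \<noteq> 2"
    using tendsto_divide[OF growth_limit_char_not_2[OF that] tendsto_const[of 3]]
    by (simp add: mult.commute)
  moreover have "(\<lambda>m. real (R_growth TYPE('k) m) / (3 * real m / 2)) \<longlonglongrightarrow> 1" if "CHAR('k) = 2"
    using tendsto_divide[OF growth_limit_char_2[OF that] tendsto_const[of "3 / 2"]]
    by (simp add: mult.commute)
  ultimately show ?thesis
    using weight_growth_char_not_2[where 'k = 'k] weight_growth_char_2[where 'k = 'k]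
      GKdim_linear[OF c(2,1)] by blast
qed

end
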